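(* Let $N\in\mathbb{N}$ and $2\leq p<N$. There is a constant $K_{N,p}>0$, depending only on $N$ and $p$, such that for any domain $\Omega\subsetneq\mathbb{R}^N$ and any $u\in C_0^\infty(\Omega)$ $$ \int_\Omega \left( |\nabla u|^p - \left(\frac{p-1}{p}\right)^p \frac{|u|^p}{(D_{\Omega,p})^p} \right) dx \geq K_{N,p} \left( \int_\Omega |u|^{\frac{Np}{N-p}} \,dx \right)^{\frac{N-p}{N}} . $$
   Context: A domain is a nonempty connected open set; $\Omega^c=\mathbb{R}^N\setminus\Omega$. $C_0^\infty(\Omega)$ denotes the smooth (complex-valued) functions with compact support in $\Omega$. For $x\in\Omega$ and $e\in\mathbb{S}^{N-1}$ (the unit sphere in $\mathbb{R}^N$, with surface measure $de$ and total measure $|\mathbb{S}^{N-1}|$) set $$d_e(x) := \inf\{ |t| : t\in\mathbb{R},\ x+te \in\Omega^c \},$$ with $\inf\emptyset=+\infty$ and $(+\infty)^{-p}=0$. The weight $D_{\Omega,p}$ is $$ D_{\Omega,p}(x) := \left( \frac{\sqrt\pi\ \Gamma(\tfrac{N+p}2)}{\Gamma(\tfrac{p+1}2)\ \Gamma(\tfrac N2)} \ |\mathbb{S}^{N-1}|^{-1} \int_{\mathbb{S}^{N-1}} d_e(x)^{-p} \,de \right)^{-\frac1p}, $$ where $\Gamma$ is the Gamma function; thus $D_{\Omega,p}(x)^{-p}$ is the expression inside the outer parentheses. *)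

theory Defs
  imports "HOL-Analysis.Analysis"
begin

text \<open>Recursion through all directional derivatives. On an open set, membership for every
  order is equivalent to having continuous partial derivatives of all orders.\<close>

primrec times_differentiable_on ::
    "nat \<Rightarrow> ('a::euclidean_space \<Rightarrow> 'b::real_normed_vector) \<Rightarrow> 'a set \<Rightarrow> bool" where
  "times_differentiable_on 0 f S \<longleftrightarrow> continuous_on S f"
| "times_differentiable_on (Suc k) f S \<longleftrightarrow>
     (\<forall>x\<in>S. f differentiable (at x)) \<and>
     (\<forall>v. times_differentiable_on k (\<lambda>x. frechet_derivative f (at x) v) S)"

definition smooth_on :: "('a::euclidean_space \<Rightarrow> 'b::real_normed_vector) \<Rightarrow> 'a set \<Rightarrow> bool" where
  "smooth_on f S \<longleftrightarrow> (\<forall>k. times_differentiable_on k f S)"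

text \<open>A test function on \<open>\<Omega>\<close> is identified with its extension by zero to the whole space.\<close>

definition test_functions :: "'a::euclidean_space set \<Rightarrow> ('a \<Rightarrow> complex) set" where
  "test_functions \<Omega> =
     {u. smooth_on u UNIV \<and> compact (closure {x. u x \<noteq> 0}) \<and> closure {x. u x \<noteq> 0} \<subseteq> \<Omega>}"

text \<open>The norm of this vector is \<open>sqrt (\<Sum>i. |\<partial>\<^sub>i u|\<^sup>2)\<close>, with complex moduli.\<close>

definition gradient :: "(real ^ 'n \<Rightarrow> complex) \<Rightarrow> real ^ 'n \<Rightarrow> complex ^ 'n" where
  "gradient u x = (\<chi> i. frechet_derivative u (at x) (axis i 1))"

text \<open>Surface measure on the unit sphere, via polar coordinates: a set \<open>A\<close> of directions gets
  \<open>N\<close> times the volume of the part of the unit ball lying in the cone over \<open>A\<close>.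
  Here \<open>sgn x = x /\<^sub>R norm x\<close>.\<close>

definition sphere_measure :: "(real ^ 'n) measure" where
  "sphere_measure =
     scale_measure (of_nat CARD('n))
       (distr (restrict_space lborel (ball 0 1 - {0})) (restrict_space borel (sphere 0 1)) sgn)"

lemma emeasure_sphere_measure:
  fixes A :: "(real ^ 'n) set"
  assumes "A \<in> sets borel" "A \<subseteq> sphere 0 1"
  shows "emeasure sphere_measure A =
           of_nat CARD('n) * emeasure lborel {x \<in> ball 0 1 - {0}. sgn x \<in> A}"
proof -
  let ?B = "ball 0 1 - {0::real ^ 'n}"
  have B: "?B \<in> sets borel" by simp
  have m: "sgn \<in> restrict_space lborel ?B \<rightarrow>\<^sub>M restrict_space borel (sphere (0::real ^ 'n) 1)"
  proof (rule measurable_restrict_space2)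
    show "sgn \<in> space (restrict_space lborel ?B) \<rightarrow> sphere 0 1"
      by (auto simp: space_restrict_space norm_sgn)
    show "sgn \<in> borel_measurable (restrict_space lborel ?B)"
      unfolding sgn_div_norm[abs_def] by (rule measurable_restrict_space1) measurable
  qed
  have A: "A \<in> sets (restrict_space borel (sphere 0 1))"
    using assms by (auto simp: sets_restrict_space_iff)
  have "emeasure (distr (restrict_space lborel ?B) (restrict_space borel (sphere 0 1)) sgn) A
      = emeasure (restrict_space lborel ?B) {x \<in> ?B. sgn x \<in> A}"
    by (subst emeasure_distr[OF m A], rule arg_cong[where f="emeasure _"])
       (auto simp: space_restrict_space)
  also have "\<dots> = emeasure lborel {x \<in> ?B. sgn x \<in> A}"
    using B by (subst emeasure_restrict_space) auto
  finally show ?thesis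
    by (simp add: sphere_measure_def)
qed

text \<open>Real powers of extended nonnegative numbers; in particular, for \<open>r < 0\<close>,
  \<open>\<infinity>\<^sup>r = 0\<close> and \<open>0\<^sup>r = \<infinity>\<close>.\<close>

definition ennreal_powr :: "ennreal \<Rightarrow> real \<Rightarrow> ennreal" where
  "ennreal_powr a r =
     (if r = 0 then 1
      else if a = 0 then (if r < 0 then \<infinity> else 0)
      else if a = \<infinity> then (if r < 0 then 0 else \<infinity>)
      else ennreal (enn2real a powr r))"

text \<open>The infimum is taken in \<^typ>\<open>ennreal\<close>, so it is \<open>\<infinity>\<close> over the empty set.\<close>

definition dir_dist :: "(real ^ 'n) set \<Rightarrow> real ^ 'n \<Rightarrow> real ^ 'n \<Rightarrow> ennreal" where
  "dir_dist \<Omega> e x = (INF t \<in> {t. x + t *\<^sub>R e \<in> - \<Omega>}. ennreal \<bar>t\<bar>)"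

text \<open>The value is \<open>\<infinity>\<close> when almost no line through \<open>x\<close> meets the complement of \<open>\<Omega>\<close>.\<close>

definition mean_dist :: "(real ^ 'n) set \<Rightarrow> real \<Rightarrow> real ^ 'n \<Rightarrow> ennreal" where
  "mean_dist \<Omega> p x =
     ennreal_powr
       (ennreal (sqrt pi * Gamma ((real CARD('n) + p) / 2) /
                 (Gamma ((p + 1) / 2) * Gamma (real CARD('n) / 2)))
        * inverse (emeasure sphere_measure (sphere (0 :: real ^ 'n) 1))
        * (\<integral>\<^sup>+ e. ennreal_powr (dir_dist \<Omega> e x) (- p) \<partial>sphere_measure))
       (- 1 / p)"

end

theory Submission imports Defs begin

text \<open>
  Write \<open>\<alpha> = (p - 1) / p\<close>, \<open>q = N p / (N - p)\<close> and, for a direction \<open>e\<close>, let \<open>E e\<close> be the integral of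
  \<open>|\<partial>\<^sub>e u|\<^sup>p - \<alpha>\<^sup>p |u|\<^sup>p / d\<^sub>e\<^sup>p\<close>. The mean of \<open>|e \<bullet> a|\<^sup>p\<close> over unit vectors \<open>e\<close> is a multiple of \<open>|a|\<^sup>p\<close>,
  and the Gamma factors in \<open>D\<close> are precisely the reciprocal of that multiple. Hence the left-hand side
  of the theorem is bounded below by a constant times the mean of \<open>E e\<close>, and it is enough to bound that
  mean below by a multiple of \<open>\<parallel>u\<parallel>\<^sub>q\<^sup>p\<close>. This is the strategy of Frank and Loss: all the analysis happens
  on lines, and the Sobolev term is recovered as in Gagliardo's proof of the Sobolev inequality.

  On a line, substituting \<open>f = t\<^sup>\<alpha> g\<close> near an endpoint of an interval turns the Hardy difference into a
  weighted energy of \<open>g\<close> plus a nonnegative term at the midpoint. What remains is strong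
  enough to control \<open>sup |f|\<^sup>s\<close>, where \<open>s = p (N - 1) / (N - p)\<close>, by the Hardy difference and
  the integral of \<open>|f|\<^sup>q\<close>, with the same exponents as without the Hardy term (\<open>line_bound\<close>). The bound
  is kept in an additive form with a free parameter \<open>\<mu>\<close>, so that it can be integrated directly over
  parallel lines.

  Multiplying these bounds for the \<open>N\<close> coordinate directions and integrating by means of Gagliardo's lemma
  (\<open>marginal_prod_le\<close>) bounds \<open>\<parallel>u\<parallel>\<^sub>q\<^sup>p\<close> by a multiple of the sum of \<open>E e\<close> over the coordinate axes
  (\<open>axis_Hardy_Sobolev\<close>). Composing \<open>u\<close> with a linear map gives the same for every basis
  whose determinant is not too small (\<open>frame_inequality\<close>).

  To pass to the mean over the sphere, note that \<open>E e\<close> cannot be small at some direction near each of the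
  \<open>N\<close> axes, since those directions would form a basis that violates the last inequality. So near at least one axis
  \<open>E e\<close> is bounded below by a multiple of \<open>\<parallel>u\<parallel>\<^sub>q\<^sup>p\<close>, and it is nonnegative everywhere else
  (\<open>cone_inequality\<close>, \<open>sphere_inequality\<close>).
\<close>

section \<open>Convexity inequalities for powers of norms\<close>

text \<open>Convexity of \<open>t powr r\<close>, with the boundary point \<open>0\<close> included.\<close>

lemma powr_weighted_mean_le:
  fixes x y \<alpha> \<beta> r :: real
  assumes "1 \<le> r" "0 \<le> x" "0 \<le> y" "0 \<le> \<alpha>" "0 \<le> \<beta>" "\<alpha> + \<beta> = 1"
  shows "(\<alpha> * x + \<beta> * y) powr r \<le> \<alpha> * x powr r + \<beta> * y powr r"
proof -
  have shrink: "(c * z) powr r \<le> c * z powr r" if "0 \<le> c" "c \<le> 1" "0 \<le> z" for c z :: real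
  proof -
    have "c powr r \<le> c powr 1"
      using that assms(1) by (intro powr_mono') auto
    then show ?thesis
      using that by (simp add: powr_mult mult_right_mono)
  qed
  show ?thesis
  proof (cases "x = 0 \<or> y = 0")
    case True
    then show ?thesis
      using shrink[of \<alpha> x] shrink[of \<beta> y] assms by auto
  next
    case False
    with assms have "x \<in> {0<..}" "y \<in> {0<..}" by auto
    moreover have \<alpha>: "\<alpha> = 1 - \<beta>" using assms by simp
    ultimately show ?thesis
      unfolding \<alpha> using convex_onD[OF powr_convex[OF assms(1)], of \<beta> x y] assms by simp
  qed
qed

lemma powr_superadditive:
  fixes x y r :: real
  assumes "1 \<le> r" "0 \<le> x" "0 \<le> y"
  shows "x powr r + y powr r \<le> (x + y) powr r"
proof -
  have split: "z powr r = z * z powr (r - 1)" if "0 \<le> z" for z :: real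
    using that by (cases "z = 0") (auto simp: powr_diff)
  have "x powr r + y powr r \<le> x * (x + y) powr (r - 1) + y * (x + y) powr (r - 1)"
    unfolding split[OF assms(2)] split[OF assms(3)]
    using assms by (intro add_mono mult_left_mono powr_mono2) auto
  also have "\<dots> = (x + y) powr r"
    using split[of "x + y"] assms by (simp add: algebra_simps)
  finally show ?thesis .
qed

text \<open>By the parallelogram law the squared norms of the half sum and the half difference add up to the
  mean of the squared norms of \<open>x\<close> and \<open>y\<close>; superadditivity and convexity of
  \<open>t powr (p / 2)\<close> turn this into the claim. Here \<open>p \<ge> 2\<close> is essential.\<close>

lemma Clarkson_inequality:
  fixes x y :: "'a::real_inner"
  assumes "2 \<le> p"
  shows "2 * norm ((1/2) *\<^sub>R (x + y)) powr p + 2 * norm ((1/2) *\<^sub>R (x - y)) powr p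
         \<le> norm x powr p + norm y powr p"
proof -
  have sq: "norm z powr p = (norm z ^ 2) powr (p / 2)" for z :: 'a
    by (cases "z = 0") (auto simp flip: powr_numeral simp: powr_powr)
  let ?m = "norm ((1/2) *\<^sub>R (x + y)) ^ 2" and ?d = "norm ((1/2) *\<^sub>R (x - y)) ^ 2"
  have par: "?m + ?d = 1/2 * norm x ^ 2 + 1/2 * norm y ^ 2"
    unfolding power2_norm_eq_inner
    by (simp add: inner_add_left inner_add_right inner_diff_left inner_diff_right inner_commute field_simps)
  have "?m powr (p/2) + ?d powr (p/2) \<le> (?m + ?d) powr (p/2)"
    using assms by (intro powr_superadditive) auto
  also have "\<dots> \<le> 1/2 * (norm x ^ 2) powr (p/2) + 1/2 * (norm y ^ 2) powr (p/2)"
    unfolding par using assms by (intro powr_weighted_mean_le) auto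
  finally show ?thesis unfolding sq by linarith
qed

text \<open>The tangent plane of the convex function \<open>norm powr p\<close> at \<open>a\<close>, obtained from Young's inequality.\<close>

lemma norm_powr_tangent:
  fixes a b :: "'a::real_inner"
  assumes "1 < p"
  shows "norm a powr p + p * norm a powr (p - 2) * (a \<bullet> b) \<le> norm (a + b) powr p"
proof (cases "a = 0")
  case False
  let ?a = "norm a" and ?c = "norm (a + b)"
  have "?a powr (p - 2) * (a \<bullet> (a + b)) \<le> ?a powr (p - 2) * (?a * ?c)"
    using norm_cauchy_schwarz by (intro mult_left_mono) auto
  also have "\<dots> = ?a powr (p - 1) * ?c"
    using False by (simp add: powr_diff power2_eq_square)
  also have "\<dots> \<le> (?a powr (p - 1)) powr (p / (p - 1)) / (p / (p - 1)) + ?c powr p / p"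
    using assms by (intro Youngs_inequality) (auto simp: field_simps)
  also have "\<dots> = ?a powr p * (p - 1) / p + ?c powr p / p"
    using assms by (simp add: powr_powr)
  finally have "?a powr (p - 2) * (a \<bullet> a) + ?a powr (p - 2) * (a \<bullet> b)
                \<le> (?a powr p * (p - 1) + ?c powr p) / p"
    by (simp add: inner_add_right distrib_left add_divide_distrib)
  moreover have "?a powr (p - 2) * (a \<bullet> a) = ?a powr p"
    using False by (simp add: powr_diff power2_norm_eq_inner[symmetric])
  ultimately have "p * (?a powr p + ?a powr (p - 2) * (a \<bullet> b)) \<le> ?a powr p * (p - 1) + ?c powr p"
    using assms by (simp add: field_simps)
  then show ?thesis by (simp add: algebra_simps)
qed (use assms in auto)

text \<open>The quantitative form of \<open>norm_powr_tangent\<close> that leaves a remainder in Hardy's inequality. Clarkson's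
  inequality for \<open>a + b\<close> and \<open>a\<close> compares the gap between function and tangent at \<open>b\<close> with twice the gap
  at \<open>b / 2\<close>, which is nonnegative, and the excess is the remainder.\<close>

lemma norm_powr_uniform_convexity:
  fixes a b :: "'a::real_inner"
  assumes "2 \<le> p"
  shows "norm a powr p + p * norm a powr (p - 2) * (a \<bullet> b) + 2 powr (1 - p) * norm b powr p
         \<le> norm (a + b) powr p"
proof -
  have "norm ((1/2) *\<^sub>R b) powr p = norm b powr p / 2 powr p"
    by (simp add: powr_divide)
  then have half: "2 * norm ((1/2) *\<^sub>R b) powr p = 2 powr (1 - p) * norm b powr p"
    by (simp add: powr_diff)
  have e: "(1/2::real) *\<^sub>R (a + b + a) = a + (1/2) *\<^sub>R b" "(a + b) - a = b"
    by (simp_all add: algebra_simps flip: scaleR_2)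
  have "2 * norm (a + (1/2) *\<^sub>R b) powr p + 2 * norm ((1/2) *\<^sub>R b) powr p
        \<le> norm (a + b) powr p + norm a powr p"
    using Clarkson_inequality[OF assms, of "a + b" a] unfolding e .
  moreover have "norm a powr p + p * norm a powr (p - 2) * (a \<bullet> ((1/2) *\<^sub>R b))
        \<le> norm (a + (1/2) *\<^sub>R b) powr p"
    by (rule norm_powr_tangent) (use assms in simp)
  ultimately show ?thesis using half by simp
qed

text \<open>Young's inequality with a free scaling \<open>\<mu>\<close> and with the factors \<open>1 / p\<close> and \<open>1 - 1 / p\<close> dropped.
  Using it instead of Hoelder's inequality keeps all later bounds linear in the two integrals, so that they
  can be integrated further.\<close>

lemma Youngs_inequality_scaled:
  fixes x y \<mu> p :: real
  assumes "1 < p" "0 \<le> x" "0 \<le> y" "0 < \<mu>"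
  shows "x * y \<le> \<mu> * x powr p + \<mu> powr (- 1 / (p - 1)) * y powr (p / (p - 1))"
proof -
  let ?x = "\<mu> powr (1/p) * x" and ?y = "\<mu> powr (- 1/p) * y"
  have "x * y = ?x * ?y"
    using assms by (simp add: powr_minus field_simps)
  also have "\<dots> \<le> ?x powr p / p + ?y powr (p / (p - 1)) / (p / (p - 1))"
    using assms by (intro Youngs_inequality) (auto simp: field_simps)
  also have "\<dots> \<le> ?x powr p + ?y powr (p / (p - 1))"
  proof (intro add_mono)
    have div_le: "z / r \<le> z" if "1 \<le> r" "0 \<le> z" for z r :: real
      using that mult_left_mono[of 1 r z] by (simp add: field_simps)
    show "?x powr p / p \<le> ?x powr p"
      using assms by (intro div_le) auto
    show "?y powr (p / (p - 1)) / (p / (p - 1)) \<le> ?y powr (p / (p - 1))"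
      using assms by (intro div_le) auto
  qed
  also have "\<dots> = \<mu> * x powr p + \<mu> powr (- 1 / (p - 1)) * y powr (p / (p - 1))"
    using assms by (simp add: powr_mult powr_powr)
  finally show ?thesis .
qed

section \<open>A one-dimensional inequality on half an interval\<close>

text \<open>At the origin the exponent \<open>r - 2\<close> may be negative; the formula then relies on \<open>0 powr _ = 0\<close>, and the
  derivative is \<open>0\<close> because \<open>r > 1\<close>.\<close>

lemma has_derivative_norm_powr:
  fixes x :: "'a::real_inner"
  assumes "1 < r"
  shows "((\<lambda>x. norm x powr r) has_derivative (\<lambda>h. r * norm x powr (r - 2) * (x \<bullet> h))) (at x)"
proof (cases "x = 0")
  case True
  have "((\<lambda>h. norm (h::'a) powr (r - 1)) \<longlongrightarrow> 0) (at 0)"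
    using assms by (auto intro!: tendsto_eq_intros tendsto_norm_zero)
  then have "((\<lambda>h. norm (norm (h::'a) powr r) / norm h) \<longlongrightarrow> 0) (at 0)"
    by (rule Lim_transform_eventually)
       (auto simp: eventually_at_filter powr_diff divide_simps)
  then show ?thesis
    using True assms by (simp add: has_derivative_at bounded_linear_zero)
next
  case False
  have "((\<lambda>x. norm x powr r) has_derivative (\<lambda>h. (r * norm x powr (r - 1)) * (sgn x \<bullet> h))) (at x)"
  proof -
    have 1: "(norm has_derivative (\<lambda>h. sgn x \<bullet> h)) (at x)"
      using has_derivative_norm[OF False] by (simp add: inner_commute)
    have 2: "((\<lambda>y. y powr r) has_derivative (\<lambda>h. r * norm x powr (r - 1) * h)) (at (norm x))"
      using has_real_derivative_powr[of "norm x" r] False by (simp add: has_field_derivative_def)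
    show ?thesis using has_derivative_compose[OF 1 2] by simp
  qed
  moreover have "(r * norm x powr (r - 1)) * (sgn x \<bullet> h) = r * norm x powr (r - 2) * (x \<bullet> h)" for h
    using False by (simp add: sgn_div_norm powr_diff power2_eq_square divide_inverse mult_ac)
  ultimately show ?thesis by simp
qed

text \<open>With \<open>g = t powr (- \<alpha>) * f\<close> this is the derivative of \<open>norm g powr r\<close>. The vector \<open>f' - (\<alpha> / t) f\<close> is
  \<open>t powr \<alpha>\<close> times the derivative of \<open>g\<close>; it vanishes for \<open>f = t powr \<alpha>\<close>, the virtual ground state of
  Hardy's inequality.\<close>

lemma has_real_derivative_weighted_norm_powr:
  fixes f :: "real \<Rightarrow> 'a::real_inner"
  assumes "1 < r" "0 < t" "(f has_vector_derivative f') (at t within S)"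
  shows "((\<lambda>t. t powr (- \<alpha> * r) * norm (f t) powr r) has_vector_derivative
            r * t powr (- \<alpha> * r) * norm (f t) powr (r - 2) * (f t \<bullet> (f' - (\<alpha> / t) *\<^sub>R f t)))
         (at t within S)"
proof -
  have "((\<lambda>t. norm (f t) powr r) has_derivative (\<lambda>h. r * norm (f t) powr (r - 2) * (f t \<bullet> (h *\<^sub>R f'))))
        (at t within S)"
    using has_derivative_compose[OF assms(3)[unfolded has_vector_derivative_def]
        has_derivative_norm_powr[OF assms(1), of "f t"]] by simp
  then have 1: "((\<lambda>t. norm (f t) powr r) has_vector_derivative r * norm (f t) powr (r - 2) * (f t \<bullet> f'))
        (at t within S)"
    by (simp add: has_vector_derivative_def mult_ac)
  have 2: "((\<lambda>t. t powr (- \<alpha> * r)) has_vector_derivative (- \<alpha> * r) * t powr (- \<alpha> * r - 1)) (at t within S)"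
    using has_real_derivative_powr[OF assms(2), of "- \<alpha> * r"]
    by (metis has_field_derivative_at_within has_real_derivative_iff_has_vector_derivative)
  have sq: "norm (f t) powr (r - 2) * (f t \<bullet> f t) = norm (f t) powr r"
    by (cases "f t = 0") (auto simp: powr_diff power2_norm_eq_inner[symmetric])
  have "t powr (- \<alpha> * r) * (r * norm (f t) powr (r - 2) * (f t \<bullet> f'))
          + (- \<alpha> * r) * t powr (- \<alpha> * r - 1) * norm (f t) powr r
        = r * t powr (- \<alpha> * r) * norm (f t) powr (r - 2) * (f t \<bullet> (f' - (\<alpha> / t) *\<^sub>R f t))"
  proof -
    have "t powr (- \<alpha> * r - 1) = t powr (- \<alpha> * r) / t"
      using assms(2) by (simp only: powr_diff) simp
    then show ?thesis
      unfolding inner_diff_right inner_scaleR_right sq[symmetric] by (simp add: algebra_simps)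
  qed
  with has_vector_derivative_mult[OF 2 1] show ?thesis
    by simp
qed

text \<open>The three summands come from the variation of \<open>t powr (- \<alpha> * s) * norm f powr s\<close>, from the boundary term
  of the energy at \<open>L\<close>, and from the case in which \<open>f\<close> stays large near \<open>L\<close>.\<close>

definition interpolation_const :: "real \<Rightarrow> real \<Rightarrow> real" where
  "interpolation_const p s = (let \<beta> = (p - 1) / p * s in
     s * (1 + 2 * 2 powr \<beta>) * (1 + 2 powr (p - 1)) + ((p - 1) / p) powr (1 - p)
     + 2 * 2 powr ((\<beta> + 1) * (p * (s - 1) / (p - 1)) / s))"

lemma interpolation_const_pos: "2 \<le> p \<Longrightarrow> 1 < s \<Longrightarrow> 0 < interpolation_const p s"
  unfolding interpolation_const_def Let_def by (intro add_nonneg_pos add_nonneg_nonneg mult_nonneg_nonneg mult_pos_pos) auto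

lemma continuous_on_norm_powr:
  fixes f :: "'a::topological_space \<Rightarrow> 'b::real_normed_vector"
  assumes "continuous_on S f" "0 < r"
  shows "continuous_on S (\<lambda>t. norm (f t) powr r)"
  using assms by (intro continuous_on_powr' continuous_intros) auto

abbreviation interpolation_bound :: "real \<Rightarrow> real \<Rightarrow> real \<Rightarrow> real \<Rightarrow> real \<Rightarrow> real" where
  "interpolation_bound p s \<mu> a y \<equiv> interpolation_const p s * (\<mu> * a + \<mu> powr (- 1 / (p - 1)) * y)"

text \<open>The interval \<open>{\<epsilon>..L}\<close> stands for \<open>{0..L}\<close>: the function is to be continued by 0 to the left of
  \<open>\<epsilon>\<close>. It is unrestricted at \<open>L\<close>, which will be the midpoint of an interval. The equation for \<open>q\<close> says \<open>s = 1 + \<alpha> * q\<close>.\<close>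

locale half_interval_function =
  fixes f f' :: "real \<Rightarrow> 'a::real_inner" and p s \<epsilon> L \<alpha> q :: real
  assumes p: "2 \<le> p" and s: "1 < s" and \<alpha>: "\<alpha> = (p - 1) / p" and q: "q = p * (s - 1) / (p - 1)"
    and \<epsilon>: "0 < \<epsilon>" "\<epsilon> < L"
    and f': "\<And>t. t \<in> {\<epsilon>..L} \<Longrightarrow> (f has_vector_derivative f' t) (at t within {\<epsilon>..L})"
    and cont: "continuous_on {\<epsilon>..L} f'" and f\<epsilon>: "f \<epsilon> = 0"
begin

definition energy where "energy = integral {\<epsilon>..L} (\<lambda>t. norm (f' t) powr p - \<alpha> powr p * norm (f t) powr p / t powr p)"
definition b where "b t = f' t - (\<alpha> / t) *\<^sub>R f t"
definition defect where "defect = integral {\<epsilon>..L} (\<lambda>t. norm (b t) powr p)"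
definition mass where "mass = integral {\<epsilon>..L} (\<lambda>t. norm (f t) powr q)"
definition h where "h t = t powr (- \<alpha> * s) * norm (f t) powr s"

lemma exponents: "0 < \<alpha>" "\<alpha> < 1" "0 < q" "\<alpha> * p = p - 1" "\<alpha> * q = s - 1"
  using p s by (auto simp: \<alpha> q field_simps)

lemma cont_f: "continuous_on {\<epsilon>..L} f"
  unfolding continuous_on_eq_continuous_within using f' has_vector_derivative_continuous by blast

lemma cont_b: "continuous_on {\<epsilon>..L} b"
  unfolding b_def[abs_def] using \<epsilon> by (intro continuous_on_norm_powr continuous_intros cont cont_f) auto

text \<open>Expand \<open>norm (f') powr p\<close> around \<open>(\<alpha> / t) f\<close> by uniform convexity. The zeroth-order term cancels the Hardy
  weight, the first-order term is the derivative of \<open>t powr (1 - p) * norm f powr p\<close> and integrates to a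
  nonnegative boundary term at \<open>L\<close>, and the remainder is the defect.\<close>

lemma energy_lower_bound:
  "\<alpha> powr (p - 1) * (L powr (1 - p) * norm (f L) powr p) + 2 powr (1 - p) * defect \<le> energy"
proof -
  define G where "G t = t powr (1 - p) * norm (f t) powr p" for t
  define G' where "G' t = p * t powr (1 - p) * norm (f t) powr (p - 2) * (f t \<bullet> b t)" for t
  have e: "- \<alpha> * p = 1 - p" using exponents by simp
  have "(G has_vector_derivative G' t) (at t within {\<epsilon>..L})" if "t \<in> {\<epsilon>..L}" for t
    using has_real_derivative_weighted_norm_powr[of p t f "f' t" "{\<epsilon>..L}" \<alpha>] f'[OF that] that p \<epsilon>
    unfolding e G_def[abs_def] G'_def b_def by simp
  then have G: "(G' has_integral G L - G \<epsilon>) {\<epsilon>..L}"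
    using \<epsilon> by (intro fundamental_theorem_of_calculus) auto
  have G\<epsilon>: "G \<epsilon> = 0" by (simp add: G_def f\<epsilon>)
  have int_defect: "(\<lambda>t. norm (b t) powr p) integrable_on {\<epsilon>..L}"
    using p by (intro integrable_continuous_interval continuous_on_norm_powr continuous_intros cont_b) auto
  have int_energy: "(\<lambda>t. norm (f' t) powr p - \<alpha> powr p * norm (f t) powr p / t powr p) integrable_on {\<epsilon>..L}"
    using p \<epsilon> by (intro integrable_continuous_interval continuous_on_norm_powr continuous_intros cont_f cont) auto
  have "integral {\<epsilon>..L} (\<lambda>t. \<alpha> powr (p - 1) * G' t + 2 powr (1 - p) * norm (b t) powr p) \<le> energy"
    unfolding energy_def
  proof (rule integral_le[OF _ int_energy])
    show "(\<lambda>t. \<alpha> powr (p - 1) * G' t + 2 powr (1 - p) * norm (b t) powr p) integrable_on {\<epsilon>..L}"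
      using G int_defect by (intro integrable_add integrable_on_mult_right) auto
    fix t assume t: "t \<in> {\<epsilon>..L}"
    then have t0: "0 < t" using \<epsilon> by auto
    let ?a = "(\<alpha> / t) *\<^sub>R f t"
    have na: "norm ?a powr r = \<alpha> powr r * t powr (- r) * norm (f t) powr r" for r
      using exponents t0 by (simp add: powr_mult powr_divide powr_minus divide_simps)
    have "norm ?a powr (p - 2) * (?a \<bullet> b t) = \<alpha> powr (p - 1) * t powr (1 - p) * norm (f t) powr (p - 2) * (f t \<bullet> b t)"
      unfolding na using exponents t0
      by (simp add: powr_diff powr_minus field_simps power2_eq_square)
    then have "p * norm ?a powr (p - 2) * (?a \<bullet> b t) = \<alpha> powr (p - 1) * G' t"
      by (simp add: G'_def mult_ac)
    moreover have "norm ?a powr p = \<alpha> powr p * norm (f t) powr p / t powr p"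
      unfolding na by (simp add: powr_minus field_simps)
    moreover have "?a + b t = f' t" by (simp add: b_def)
    ultimately show "\<alpha> powr (p - 1) * G' t + 2 powr (1 - p) * norm (b t) powr p
          \<le> norm (f' t) powr p - \<alpha> powr p * norm (f t) powr p / t powr p"
      using norm_powr_uniform_convexity[OF p, of ?a "b t"] by simp
  qed
  moreover have "integral {\<epsilon>..L} (\<lambda>t. \<alpha> powr (p - 1) * G' t + 2 powr (1 - p) * norm (b t) powr p)
      = \<alpha> powr (p - 1) * G L + 2 powr (1 - p) * defect"
    unfolding defect_def using has_integral_add[OF has_integral_mult_right[OF G] has_integral_mult_right[OF integrable_integral[OF int_defect]]]
    by (intro integral_unique) (simp add: G\<epsilon>)
  ultimately show ?thesis by (simp add: G_def)
qed

lemma defect_nonneg: "0 \<le> defect" and mass_nonneg: "0 \<le> mass"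
  unfolding defect_def mass_def by (auto intro!: integral_nonneg integrable_continuous_interval continuous_on_norm_powr continuous_intros
      cont_f cont_b simp: exponents) (use p exponents in auto)

lemma Hardy: "0 \<le> energy"
proof -
  have "0 \<le> \<alpha> powr (p - 1) * (L powr (1 - p) * norm (f L) powr p) + 2 powr (1 - p) * defect"
    using defect_nonneg by (intro add_nonneg_nonneg mult_nonneg_nonneg) auto
  then show ?thesis using energy_lower_bound by linarith
qed

text \<open>The derivative of \<open>h\<close> is at most \<open>s * t powr (- \<alpha> * s) * norm f powr (s - 1) * norm b\<close>. As the power of
  \<open>t\<close> is decreasing it can be taken out at \<open>t1\<close>, and Young's inequality splits the rest; the exponent
  \<open>q\<close> is the one for which \<open>norm f powr (s - 1)\<close> becomes \<open>norm f powr q\<close>.\<close>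

lemma h_variation:
  assumes t: "\<epsilon> \<le> t1" "t1 \<le> t2" "t2 \<le> L" and \<mu>: "0 < \<mu>"
  shows "\<bar>h t2 - h t1\<bar> \<le> t1 powr (- \<alpha> * s) * (s * (\<mu> * defect + \<mu> powr (- 1 / (p - 1)) * mass))"
proof -
  let ?\<nu> = "\<mu> powr (- 1 / (p - 1))"
  define h' where "h' t = s * t powr (- \<alpha> * s) * norm (f t) powr (s - 2) * (f t \<bullet> b t)" for t
  define k where "k t = s * (\<mu> * norm (b t) powr p + ?\<nu> * norm (f t) powr q)" for t
  have "(h has_vector_derivative h' t) (at t within {t1..t2})" if "t \<in> {t1..t2}" for t
  proof (rule has_vector_derivative_within_subset)
    show "(h has_vector_derivative h' t) (at t within {\<epsilon>..L})"
      using has_real_derivative_weighted_norm_powr[of s t f "f' t" "{\<epsilon>..L}" \<alpha>] f'[of t] that t s \<epsilon>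
      unfolding h_def[abs_def] h'_def b_def by simp
  qed (use t in auto)
  then have int: "(h' has_integral h t2 - h t1) {t1..t2}"
    using t by (intro fundamental_theorem_of_calculus) auto
  have ck: "continuous_on {\<epsilon>..L} k"
    unfolding k_def[abs_def] using p exponents by (intro continuous_on_norm_powr continuous_intros cont_f cont_b) auto
  have ik: "k integrable_on {\<epsilon>..L}" "k integrable_on {t1..t2}"
    using ck t by (auto intro!: integrable_continuous_interval intro: continuous_on_subset)
  have k0: "0 \<le> k t" for t
    unfolding k_def using s \<mu> by simp
  have bound: "norm (h' t) \<le> t1 powr (- \<alpha> * s) * k t" if "t \<in> {t1..t2}" for t
  proof -
    have t0: "0 < t1" "t1 \<le> t" using that t \<epsilon> by auto
    have "norm (h' t) \<le> s * t powr (- \<alpha> * s) * norm (f t) powr (s - 2) * (norm (f t) * norm (b t))"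
      unfolding h'_def real_norm_def abs_mult using s
      by (intro mult_mono) (auto simp: Cauchy_Schwarz_ineq2)
    also have "\<dots> = t powr (- \<alpha> * s) * (s * (norm (b t) * norm (f t) powr (s - 1)))"
      by (cases "f t = 0") (auto simp: powr_diff power2_eq_square)
    also have "\<dots> \<le> t1 powr (- \<alpha> * s) * k t"
    proof (intro mult_mono)
      show "t powr (- \<alpha> * s) \<le> t1 powr (- \<alpha> * s)"
        using t0 exponents s by (intro powr_mono2') auto
      have "norm (b t) * norm (f t) powr (s - 1)
            \<le> \<mu> * norm (b t) powr p + ?\<nu> * (norm (f t) powr (s - 1)) powr (p / (p - 1))"
        using p \<mu> by (intro Youngs_inequality_scaled) auto
      then show "s * (norm (b t) * norm (f t) powr (s - 1)) \<le> k t"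
        unfolding k_def using s by (intro mult_left_mono) (auto simp: powr_powr q mult_ac)
    qed (use s in auto)
    finally show ?thesis .
  qed
  have "norm (integral {t1..t2} h') \<le> integral {t1..t2} (\<lambda>t. t1 powr (- \<alpha> * s) * k t)"
    using int ik bound by (intro integral_norm_bound_integral integrable_on_mult_right) auto
  also have "\<dots> = t1 powr (- \<alpha> * s) * integral {t1..t2} k"
    by simp
  also have "\<dots> \<le> t1 powr (- \<alpha> * s) * integral {\<epsilon>..L} k"
    using ik k0 t by (intro mult_left_mono integral_subset_le) auto
  also have "integral {\<epsilon>..L} k = s * (\<mu> * defect + ?\<nu> * mass)"
  proof -
    have "(\<lambda>t. norm (b t) powr p) integrable_on {\<epsilon>..L}" "(\<lambda>t. norm (f t) powr q) integrable_on {\<epsilon>..L}"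
      using p exponents by (auto intro!: integrable_continuous_interval continuous_on_norm_powr continuous_intros cont_f cont_b)
    then show ?thesis
      unfolding k_def defect_def mass_def by (simp add: integral_add integrable_on_mult_right)
  qed
  also have "integral {t1..t2} h' = h t2 - h t1"
    using int by (rule integral_unique)
  finally show ?thesis by simp
qed

text \<open>By \<open>h_variation\<close> it is enough to bound \<open>f\<close> at the free endpoint \<open>L\<close>. Either \<open>h\<close> drops to
  half of \<open>h L\<close> somewhere in the right half, and the variation bound controls \<open>h L\<close>; or \<open>f\<close> is comparable with
  \<open>f L\<close> on the right half, and its integral together with the boundary term of the energy controls \<open>f L\<close>.\<close>

lemma sup_bound:
  assumes T: "T \<in> {\<epsilon>..L}" and \<mu>: "0 < \<mu>"
  shows "norm (f T) powr s \<le> interpolation_bound p s \<mu> energy mass"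
proof -
  define \<nu> where "\<nu> = \<mu> powr (- 1 / (p - 1))"
  define R where "R = \<mu> * defect + \<nu> * mass"
  define \<beta> where "\<beta> = \<alpha> * s"
  define \<kappa> where "\<kappa> = 2 powr ((\<beta> + 1) * q / s)"
  have \<nu>: "0 < \<nu>" using \<mu> by (simp add: \<nu>_def)
  have \<beta>: "0 < \<beta>" using exponents s by (simp add: \<beta>_def)
  have R: "0 \<le> R" unfolding R_def using \<mu> \<nu> defect_nonneg mass_nonneg by simp
  have G0: "0 \<le> \<alpha> powr (p - 1) * (L powr (1 - p) * norm (f L) powr p)" by simp
  have "2 powr (1 - p) * defect \<le> energy" using energy_lower_bound G0 by linarith
  then have defect: "defect \<le> 2 powr (p - 1) * energy"
    by (simp add: powr_diff field_simps)
  have "0 \<le> 2 powr (1 - p) * defect" using defect_nonneg by simp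
  then have "\<alpha> powr (p - 1) * (L powr (1 - p) * norm (f L) powr p) \<le> energy"
    using energy_lower_bound by linarith
  note G0 = this
  have G: "L powr (1 - p) * norm (f L) powr p \<le> \<alpha> powr (1 - p) * energy"
  proof -
    have "\<alpha> powr (1 - p) * \<alpha> powr (p - 1) = 1"
      using exponents by (simp flip: powr_add)
    then show ?thesis
      using mult_left_mono[OF G0, of "\<alpha> powr (1 - p)"] by (simp flip: mult.assoc)
  qed
  have hf: "t powr \<beta> * h t = norm (f t) powr s" if "0 < t" for t
    using that by (simp add: h_def \<beta>_def flip: mult.assoc powr_add)
  have h0: "0 \<le> h t" for t by (simp add: h_def)
  have var: "\<bar>h t2 - h t1\<bar> \<le> t1 powr (- \<beta>) * (s * R)" if "\<epsilon> \<le> t1" "t1 \<le> t2" "t2 \<le> L" for t1 t2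
    using h_variation[OF that \<mu>] by (simp add: R_def \<nu>_def \<beta>_def)
  have endpoint: "norm (f L) powr s \<le> 2 * 2 powr \<beta> * (s * R) + (\<mu> * (\<alpha> powr (1 - p) * energy) + \<nu> * (2 * \<kappa> * mass))"
  proof (cases "\<exists>t0\<in>{\<epsilon>..L}. L / 2 \<le> t0 \<and> h t0 \<le> h L / 2")
    case True
    then obtain t0 where t0: "\<epsilon> \<le> t0" "t0 \<le> L" "L / 2 \<le> t0" "h t0 \<le> h L / 2" by auto
    have "h L / 2 \<le> t0 powr (- \<beta>) * (s * R)"
      using var[of t0 L] t0 by linarith
    also have "\<dots> \<le> (L / 2) powr (- \<beta>) * (s * R)"
      using t0 \<epsilon> \<beta> R s by (intro mult_right_mono powr_mono2') auto
    finally have "L powr \<beta> * h L \<le> L powr \<beta> * (2 * ((L / 2) powr (- \<beta>) * (s * R)))"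
      by (intro mult_left_mono) auto
    also have "\<dots> = 2 * 2 powr \<beta> * (s * R)"
      using \<epsilon> by (simp add: powr_minus powr_divide field_simps)
    finally have "norm (f L) powr s \<le> 2 * 2 powr \<beta> * (s * R)"
      using hf[of L] \<epsilon> by simp
    moreover have "0 \<le> \<mu> * (\<alpha> powr (1 - p) * energy) + \<nu> * (2 * \<kappa> * mass)"
      using \<mu> \<nu> Hardy mass_nonneg by (simp add: \<kappa>_def)
    ultimately show ?thesis by simp
  next
    case False
    then have big: "h L / 2 < h t" if "\<epsilon> \<le> t" "t \<le> L" "L / 2 \<le> t" for t
      using that by force
    have "h \<epsilon> = 0" by (simp add: h_def f\<epsilon>)
    then have \<epsilon>L: "\<epsilon> < L / 2"
      using big[of \<epsilon>] h0[of L] \<epsilon> by force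
    let ?F = "norm (f L)"
    have lower: "?F powr q / \<kappa> \<le> norm (f t) powr q" if t: "t \<in> {L/2..L}" for t
    proof -
      have "?F powr s / 2 powr (\<beta> + 1) = (L / 2) powr \<beta> * (h L / 2)"
        using hf[of L] \<epsilon> by (simp add: powr_divide powr_add field_simps)
      also have "\<dots> \<le> t powr \<beta> * h t"
        using t \<epsilon>L \<epsilon> \<beta> h0[of L] big[of t] by (intro mult_mono powr_mono2) auto
      also have "\<dots> = norm (f t) powr s" using t \<epsilon> hf[of t] by auto
      finally have "(?F powr s / 2 powr (\<beta> + 1)) powr (q / s) \<le> (norm (f t) powr s) powr (q / s)"
        using exponents s by (intro powr_mono2) auto
      then show ?thesis
        using s by (simp add: powr_divide powr_powr \<kappa>_def)
    qed
    have cq: "continuous_on {\<epsilon>..L} (\<lambda>t. norm (f t) powr q)"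
      using exponents by (intro continuous_on_norm_powr continuous_intros cont_f) auto
    have "(L / 2) * (?F powr q / \<kappa>) = integral {L/2..L} (\<lambda>t. ?F powr q / \<kappa>)"
      using \<epsilon> by simp
    also have "\<dots> \<le> integral {L/2..L} (\<lambda>t. norm (f t) powr q)"
      using lower cq \<epsilon>L by (intro integral_le integrable_continuous_interval) (auto intro: continuous_on_subset)
    also have "\<dots> \<le> mass" unfolding mass_def
      using cq \<epsilon>L by (intro integral_subset_le integrable_continuous_interval) (auto intro: continuous_on_subset)
    finally have LY: "L * ?F powr q \<le> 2 * \<kappa> * mass"
      by (simp add: \<kappa>_def field_simps)
    have "?F powr s = (L powr (- \<alpha>) * ?F) * (L powr \<alpha> * ?F powr (s - 1))"
      using \<epsilon> by (cases "f L = 0") (simp_all add: powr_minus powr_diff)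
    also have "\<dots> \<le> \<mu> * (L powr (- \<alpha>) * ?F) powr p + \<nu> * (L powr \<alpha> * ?F powr (s - 1)) powr (p / (p - 1))"
      unfolding \<nu>_def using p \<mu> by (intro Youngs_inequality_scaled) auto
    also have "(L powr (- \<alpha>) * ?F) powr p = L powr (1 - p) * ?F powr p"
      using exponents by (simp add: powr_mult powr_powr)
    also have "(L powr \<alpha> * ?F powr (s - 1)) powr (p / (p - 1)) = L * ?F powr q"
    proof -
      have "\<alpha> * (p / (p - 1)) = 1" "(s - 1) * (p / (p - 1)) = q" using p by (auto simp: \<alpha> q)
      then show ?thesis using \<epsilon> by (simp only: powr_mult powr_powr) simp
    qed
    finally have "?F powr s \<le> \<mu> * (L powr (1 - p) * ?F powr p) + \<nu> * (L * ?F powr q)" .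
    also have "\<dots> \<le> \<mu> * (\<alpha> powr (1 - p) * energy) + \<nu> * (2 * \<kappa> * mass)"
      using G LY \<mu> \<nu> by (intro add_mono mult_left_mono) auto
    finally show ?thesis using R s by (simp add: add_increasing)
  qed
  have T0: "0 < T" using T \<epsilon> by auto
  have "h T \<le> h L + T powr (- \<beta>) * (s * R)" using var[of T L] T by auto
  then have "T powr \<beta> * h T \<le> T powr \<beta> * (h L + T powr (- \<beta>) * (s * R))"
    by (intro mult_left_mono) auto
  also have "\<dots> = T powr \<beta> * h L + s * R"
    using T0 by (simp add: distrib_left powr_minus)
  also have "\<dots> \<le> L powr \<beta> * h L + s * R"
    using T T0 \<beta> h0 by (intro add_right_mono mult_right_mono powr_mono2) auto
  finally have 1: "norm (f T) powr s \<le> norm (f L) powr s + s * R"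
    using hf[of T] hf[of L] T0 \<epsilon> by simp
  define C1 where "C1 = s * (1 + 2 * 2 powr \<beta>)"
  have C1: "0 \<le> C1" using s by (simp add: C1_def)
  have C: "interpolation_const p s = C1 * (1 + 2 powr (p - 1)) + \<alpha> powr (1 - p) + 2 * \<kappa>"
    by (simp add: interpolation_const_def Let_def C1_def \<kappa>_def \<beta>_def \<alpha> q)
  have "norm (f T) powr s \<le> C1 * R + (\<mu> * (\<alpha> powr (1 - p) * energy) + \<nu> * (2 * \<kappa> * mass))"
    using 1 endpoint by (simp add: C1_def algebra_simps)
  also have "C1 * R \<le> C1 * (\<mu> * (2 powr (p - 1) * energy) + \<nu> * mass)"
    unfolding R_def using defect \<mu> C1 \<nu> by (intro mult_left_mono add_mono) auto
  also have "C1 * (\<mu> * (2 powr (p - 1) * energy) + \<nu> * mass) + (\<mu> * (\<alpha> powr (1 - p) * energy) + \<nu> * (2 * \<kappa> * mass))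
      = (C1 * 2 powr (p - 1) + \<alpha> powr (1 - p)) * (\<mu> * energy) + (C1 + 2 * \<kappa>) * (\<nu> * mass)"
    by (simp add: algebra_simps)
  also have "\<dots> \<le> interpolation_const p s * (\<mu> * energy) + interpolation_const p s * (\<nu> * mass)"
  proof (intro add_mono mult_right_mono)
    show "C1 * 2 powr (p - 1) + \<alpha> powr (1 - p) \<le> interpolation_const p s"
      using C1 by (simp add: C \<kappa>_def algebra_simps)
    show "C1 + 2 * \<kappa> \<le> interpolation_const p s"
      using C1 by (simp add: C algebra_simps)
  qed (use \<mu> \<nu> Hardy mass_nonneg in auto)
  finally show ?thesis by (simp add: \<nu>_def algebra_simps)
qed

end

section \<open>The one-dimensional inequality on an interval and on open subsets of the line\<close>

text \<open>Only an upper bound for the weight is used, because a larger weight lowers the energy. Where \<open>f\<close> vanishes,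
  the energy density is \<open>norm f' powr p\<close>, so enlarging the interval of integration does not decrease the energy.\<close>

lemma left_half_interval_bound:
  fixes f f' :: "real \<Rightarrow> 'a::real_inner" and F W :: "real \<Rightarrow> real"
  assumes p: "2 \<le> p" and s: "1 < s" and \<alpha>: "\<alpha> = (p - 1) / p" and q: "q = p * (s - 1) / (p - 1)"
    and am: "a < m" and \<epsilon>: "0 < \<epsilon>" "\<epsilon> < m - a"
    and f': "\<And>t. (f has_vector_derivative f' t) (at t)" and cont: "continuous_on UNIV f'"
    and f0: "\<And>t. t \<in> {a..a + \<epsilon>} \<Longrightarrow> f t = 0"
    and W: "\<And>t. t \<in> {a<..m} \<Longrightarrow> f t \<noteq> 0 \<Longrightarrow> W t \<le> (t - a) powr (- p)"
    and F: "F = (\<lambda>t. norm (f' t) powr p - \<alpha> powr p * norm (f t) powr p * W t)"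
    and intF: "F integrable_on {a..m}"
  shows "0 \<le> integral {a..m} F"
    and "T \<in> {a..m} \<Longrightarrow> 0 < \<mu> \<Longrightarrow> norm (f T) powr s \<le>
           interpolation_bound p s \<mu> (integral {a..m} F) (integral {a..m} (\<lambda>t. norm (f t) powr q))"
proof -
  interpret H: half_interval_function "f \<circ> (+) a" "f' \<circ> (+) a" p s \<epsilon> "m - a" \<alpha> q
  proof
    show "(f \<circ> (+) a has_vector_derivative (f' \<circ> (+) a) t) (at t within {\<epsilon>..m - a})" for t
    proof -
      have "((+) a has_vector_derivative 1) (at t)"
        using has_vector_derivative_add[OF has_vector_derivative_const[of a] has_vector_derivative_id[of "at t"]] by simp
      from vector_diff_chain_at[OF this f'] show ?thesis
        by (simp add: has_vector_derivative_at_within o_def)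
    qed
    show "continuous_on {\<epsilon>..m - a} (f' \<circ> (+) a)"
      by (intro continuous_on_compose continuous_intros continuous_on_subset[OF cont]) auto
    show "(f \<circ> (+) a) \<epsilon> = 0" using f0[of "a + \<epsilon>"] \<epsilon> by simp
  qed (fact p s \<alpha> q \<epsilon>)+
  let ?F0 = "\<lambda>t. norm (f' t) powr p - \<alpha> powr p * norm (f t) powr p / (t - a) powr p"
  have cf: "continuous_on S f" for S
    using f' by (meson continuous_at_imp_continuous_on has_vector_derivative_continuous)
  have iF0: "?F0 integrable_on {a + \<epsilon>..m}"
    using p \<epsilon>
    by (intro integrable_continuous_interval continuous_on_norm_powr continuous_intros cf continuous_on_subset[OF cont]) auto
  have iF: "F integrable_on {a + \<epsilon>..m}" "F integrable_on {a..a + \<epsilon>}"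
    using intF \<epsilon> by (auto intro: integrable_on_subinterval)
  have iq: "(\<lambda>t. norm (f t) powr q) integrable_on {c..d}" for c d
    using H.exponents by (intro integrable_continuous_interval continuous_on_norm_powr cf)
  have "H.energy = integral {\<epsilon>..m - a} (?F0 \<circ> (+) a)"
    unfolding H.energy_def by (simp add: o_def)
  also have "\<dots> = integral {a + \<epsilon>..m} ?F0"
    by (simp add: integral_shift_Icc_real add.commute)
  also have "\<dots> \<le> integral {a + \<epsilon>..m} F"
  proof (rule integral_le[OF iF0 iF(1)])
    fix t assume t: "t \<in> {a + \<epsilon>..m}"
    have "norm (f t) powr p * W t \<le> norm (f t) powr p / (t - a) powr p"
      using W[of t] t \<epsilon> by (cases "f t = 0") (auto simp: powr_minus divide_inverse)
    then have "\<alpha> powr p * (norm (f t) powr p * W t) \<le> \<alpha> powr p * (norm (f t) powr p / (t - a) powr p)"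
      by (rule mult_left_mono) simp
    then show "?F0 t \<le> F t" by (simp add: F mult.assoc)
  qed
  also have "\<dots> \<le> integral {a..a + \<epsilon>} F + integral {a + \<epsilon>..m} F"
  proof -
    have "0 \<le> F t" if "t \<in> {a..a + \<epsilon>}" for t
      using f0[OF that] by (simp add: F)
    then show ?thesis
      using Henstock_Kurzweil_Integration.integral_nonneg[OF iF(2)] by simp
  qed
  also have "\<dots> = integral {a..m} F"
    by (rule Henstock_Kurzweil_Integration.integral_combine[OF _ _ intF]) (use \<epsilon> in auto)
  finally have energy: "H.energy \<le> integral {a..m} F" .
  show nonneg: "0 \<le> integral {a..m} F" using energy H.Hardy by linarith
  have "H.mass = integral {\<epsilon>..m - a} ((\<lambda>t. norm (f t) powr q) \<circ> (+) a)"
    unfolding H.mass_def by (simp add: o_def)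
  also have "\<dots> = integral {a + \<epsilon>..m} (\<lambda>t. norm (f t) powr q)"
    by (simp add: integral_shift_Icc_real add.commute)
  also have "\<dots> \<le> integral {a..m} (\<lambda>t. norm (f t) powr q)"
    using \<epsilon> by (intro integral_subset_le iq) auto
  finally have mass: "H.mass \<le> integral {a..m} (\<lambda>t. norm (f t) powr q)" .
  show "norm (f T) powr s \<le>
           interpolation_bound p s \<mu> (integral {a..m} F) (integral {a..m} (\<lambda>t. norm (f t) powr q))"
    if T: "T \<in> {a..m}" and \<mu>: "0 < \<mu>"
  proof (cases "a + \<epsilon> \<le> T")
    case True
    then have "norm (f T) powr s \<le> interpolation_bound p s \<mu> H.energy H.mass"
      using H.sup_bound[of "T - a" \<mu>] T \<mu> by simp
    also have "\<dots> \<le> interpolation_bound p s \<mu> (integral {a..m} F) (integral {a..m} (\<lambda>t. norm (f t) powr q))"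
      using energy mass \<mu> interpolation_const_pos[OF p s] by (intro mult_left_mono add_mono) auto
    finally show ?thesis .
  next
    case False
    then have "f T = 0" using f0 T by auto
    moreover have "0 \<le> integral {a..m} (\<lambda>t. norm (f t) powr q)"
      using mass H.mass_nonneg by linarith
    ultimately show ?thesis
      using nonneg \<mu> interpolation_const_pos[OF p s] by simp
  qed
qed

text \<open>On each half of the interval the distance to the boundary is the distance to one endpoint; the right half
  is reflected. Since both half energies are nonnegative, each of them is at most the total energy.\<close>

lemma interval_bound:
  fixes f f' :: "real \<Rightarrow> 'a::real_inner" and F W :: "real \<Rightarrow> real"
  assumes p: "2 \<le> p" and s: "1 < s" and \<alpha>: "\<alpha> = (p - 1) / p" and q: "q = p * (s - 1) / (p - 1)"
    and ab: "a < b" and \<epsilon>: "0 < \<epsilon>"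
    and f': "\<And>t. (f has_vector_derivative f' t) (at t)" and cont: "continuous_on UNIV f'"
    and f0: "\<And>t. t \<in> {a..a + \<epsilon>} \<Longrightarrow> f t = 0" "\<And>t. t \<in> {b - \<epsilon>..b} \<Longrightarrow> f t = 0"
    and W: "\<And>t. t \<in> {a<..<b} \<Longrightarrow> f t \<noteq> 0 \<Longrightarrow> W t \<le> min (t - a) (b - t) powr (- p)"
    and F: "F = (\<lambda>t. norm (f' t) powr p - \<alpha> powr p * norm (f t) powr p * W t)"
    and intF: "F integrable_on {a..b}"
  shows "0 \<le> integral {a..b} F"
    and "T \<in> {a..b} \<Longrightarrow> 0 < \<mu> \<Longrightarrow> norm (f T) powr s \<le>
           interpolation_bound p s \<mu> (integral {a..b} F) (integral {a..b} (\<lambda>t. norm (f t) powr q))"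
proof -
  define m where "m = (a + b) / 2"
  have m: "a < m" "m < b" using ab by (auto simp: m_def)
  \<comment> \<open>The function must still vanish near the endpoints on an interval shorter than each half.\<close>
  define \<delta> where "\<delta> = min \<epsilon> ((b - a) / 4)"
  have \<delta>: "0 < \<delta>" "\<delta> < m - a" "\<delta> < b - m" "\<delta> \<le> \<epsilon>" using ab \<epsilon> by (auto simp: m_def \<delta>_def min_def field_simps)
  have iF: "F integrable_on {a..m}" "F integrable_on {m..b}"
    using intF m by (auto intro: integrable_on_subinterval)
  let ?g = "\<lambda>t. norm (f t) powr q"
  have q0: "0 < q" using p s by (simp add: q)
  have cf: "continuous_on S f" for S
    using f' by (meson continuous_at_imp_continuous_on has_vector_derivative_continuous)
  have iq: "?g integrable_on {c..d}" for c d
    using q0 by (intro integrable_continuous_interval continuous_on_norm_powr cf)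
  have Wl: "W t \<le> (t - a) powr (- p)" if "t \<in> {a<..m}" "f t \<noteq> 0" for t
  proof -
    have "min (t - a) (b - t) = t - a" "t \<in> {a<..<b}" using that m by (auto simp: m_def)
    then show ?thesis using W[of t] that by metis
  qed
  have Wr: "W (- t) \<le> (t - (- b)) powr (- p)" if "t \<in> {- b<..- m}" "f (- t) \<noteq> 0" for t
  proof -
    have "b - - t \<le> - t - a" "- t \<in> {a<..<b}" using that m(1) unfolding m_def by (simp_all add: field_simps)
    then have "min (- t - a) (b - - t) = t - (- b)" "- t \<in> {a<..<b}" by auto
    then show ?thesis using W[of "- t"] that by metis
  qed
  note left = left_half_interval_bound[OF p s \<alpha> q m(1) \<delta>(1,2) f' cont _ Wl F iF(1)]
  have l: "0 \<le> integral {a..m} F"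
    by (rule left(1)) (use f0 \<delta> in auto)
  have l': "norm (f T) powr s \<le> interpolation_bound p s \<mu> (integral {a..m} F) (integral {a..m} ?g)"
    if "T \<in> {a..m}" "0 < \<mu>" for T \<mu>
    by (rule left(2)) (use f0 \<delta> that in auto)
  have rf': "((\<lambda>t. f (- t)) has_vector_derivative - f' (- t)) (at t)" for t
  proof -
    have "(uminus has_vector_derivative - (1::real)) (at t)"
      using has_vector_derivative_minus[OF has_vector_derivative_id[of "at t"]] by simp
    from vector_diff_chain_at[OF this f'] show ?thesis
      by (simp add: o_def)
  qed
  have rcont: "continuous_on UNIV (\<lambda>t. - f' (- t))"
    by (intro continuous_intros continuous_on_compose2[OF cont]) auto
  have rF: "(\<lambda>t. F (- t)) = (\<lambda>t. norm (- f' (- t)) powr p - \<alpha> powr p * norm (f (- t)) powr p * W (- t))"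
    by (simp add: F)
  have riF: "(\<lambda>t. F (- t)) integrable_on {- b..- m}"
    using iF(2) Henstock_Kurzweil_Integration.integrable_reflect_real[of F b m] by simp
  have rm: "- b < - m" "\<delta> < - m - (- b)" using m \<delta> by auto
  note right = left_half_interval_bound[where W = "\<lambda>t. W (- t)", OF p s \<alpha> q rm(1) \<delta>(1) rm(2) rf' rcont _ Wr rF riF]
  have r: "0 \<le> integral {m..b} F"
    using right(1) f0 \<delta> Henstock_Kurzweil_Integration.integral_reflect_real[of b m F] by simp
  have r': "norm (f T) powr s \<le> interpolation_bound p s \<mu> (integral {m..b} F) (integral {m..b} ?g)"
    if "T \<in> {m..b}" "0 < \<mu>" for T \<mu>
    using right(2)[of "- T" \<mu>] f0 \<delta> Henstock_Kurzweil_Integration.integral_reflect_real[of b m F] Henstock_Kurzweil_Integration.integral_reflect_real[of b m ?g] that by simp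
  have sumF: "integral {a..b} F = integral {a..m} F + integral {m..b} F"
    by (rule Henstock_Kurzweil_Integration.integral_combine[OF _ _ intF, symmetric]) (use m in auto)
  have sumg: "integral {a..b} ?g = integral {a..m} ?g + integral {m..b} ?g"
    by (rule Henstock_Kurzweil_Integration.integral_combine[OF _ _ iq, symmetric]) (use m in auto)
  have g0: "0 \<le> integral {c..d} ?g" for c d
    by (intro integral_nonneg iq) auto
  show "0 \<le> integral {a..b} F" using l r sumF by simp
  show "norm (f T) powr s \<le> interpolation_bound p s \<mu> (integral {a..b} F) (integral {a..b} ?g)"
    if T: "T \<in> {a..b}" and \<mu>: "0 < \<mu>"
  proof -
    have *: "interpolation_bound p s \<mu> X Z
      \<le> interpolation_bound p s \<mu> (integral {a..b} F) (integral {a..b} ?g)"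
      if "X \<le> integral {a..b} F" "Z \<le> integral {a..b} ?g" for X Z
      using that \<mu> interpolation_const_pos[OF p s] by (intro mult_left_mono add_mono) auto
    show ?thesis
    proof (cases "T \<le> m")
      case True
      then show ?thesis
        using l'[of T \<mu>] T \<mu> l r sumF sumg g0[of m b]
        by (intro order_trans[OF l'[of T \<mu>] *]) auto
    next
      case False
      then show ?thesis
        using T \<mu> l r sumF sumg g0[of a m]
        by (intro order_trans[OF r'[of T \<mu>] *]) auto
    qed
  qed
qed

text \<open>Finitely many components of a bounded open neighbourhood cover the compact set. The endpoints
  of a component do not belong to the neighbourhood, as the component could otherwise be enlarged.\<close>

lemma compact_subset_open_real_intervals:
  fixes K V :: "real set"
  assumes "compact K" "open V" "K \<subseteq> V"
  obtains \<I> where "finite \<I>" "disjoint \<I>" "K \<subseteq> \<Union>\<I>"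
    "\<And>I. I \<in> \<I> \<Longrightarrow> \<exists>a b. a < b \<and> I = {a<..<b} \<and> I \<subseteq> V \<and> a \<notin> K \<and> b \<notin> K"
proof -
  obtain R where R: "K \<subseteq> ball 0 R"
    using compact_imp_bounded[OF assms(1)] bounded_subset_ballD by blast
  define U where "U = V \<inter> ball 0 R"
  have U: "open U" "K \<subseteq> U" "bounded U" using assms R by (auto simp: U_def intro: bounded_subset[OF bounded_ball])
  obtain \<I> where \<I>: "\<I> \<subseteq> components U" "finite \<I>" "K \<subseteq> \<Union>\<I>"
    using compactE[OF assms(1), of "components U"] U open_components[of U] Union_components[of U] by metis
  have comps: "\<exists>a b. a < b \<and> I = {a<..<b} \<and> I \<subseteq> V \<and> a \<notin> K \<and> b \<notin> K" if "I \<in> \<I>" for I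
  proof -
    have I: "I \<in> components U" using that \<I> by auto
    have "open I" "I \<noteq> {}" "connected I" "I \<subseteq> U"
      using I U open_components in_components_nonempty in_components_connected in_components_subset by blast+
    then have "bounded I" using U bounded_subset by blast
    obtain a b where ab: "I = {a<..<b}" "a < b"
    proof
      define a where "a = Inf I"
      define b where "b = Sup I"
      have bd: "bdd_above I" "bdd_below I" using \<open>bounded I\<close> by (auto intro: bounded_imp_bdd_above bounded_imp_bdd_below)
      have notin: "a \<notin> I" "b \<notin> I"
      proof -
        show "a \<notin> I"
        proof
          assume "a \<in> I"
          then obtain e where "0 < e" "ball a e \<subseteq> I" using \<open>open I\<close> openE by blast
          then have "a - e/2 \<in> I" by (auto simp: dist_real_def)
          then show False using cInf_lower[OF _ bd(2)] \<open>0 < e\<close> unfolding a_def by fastforce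
        qed
        show "b \<notin> I"
        proof
          assume "b \<in> I"
          then obtain e where "0 < e" "ball b e \<subseteq> I" using \<open>open I\<close> openE by blast
          then have "b + e/2 \<in> I" by (auto simp: dist_real_def)
          then show False using cSup_upper[OF _ bd(1)] \<open>0 < e\<close> unfolding b_def by fastforce
        qed
      qed
      show *: "I = {a<..<b}"
      proof (intro equalityI subsetI)
        fix x assume "x \<in> I"
        then show "x \<in> {a<..<b}"
          using cInf_lower[OF _ bd(2)] cSup_upper[OF _ bd(1)] notin unfolding a_def b_def
          by (metis greaterThanLessThan_iff less_eq_real_def)
      next
        fix x assume x: "x \<in> {a<..<b}"
        obtain y where "y \<in> I" "y < x" using cInf_lessD[of I x] x \<open>I \<noteq> {}\<close> a_def by auto
        moreover obtain z where "z \<in> I" "x < z" using less_cSupD[of I x] x \<open>I \<noteq> {}\<close> b_def by auto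
        ultimately show "x \<in> I" using connectedD_interval[OF \<open>connected I\<close>] by (meson less_imp_le)
      qed
      show "a < b" using * \<open>I \<noteq> {}\<close> by auto
    qed
    define m where "m = (a + b) / 2"
    have m: "a < m" "m < b" using ab by (auto simp: m_def)
    have "a \<notin> U"
    proof
      assume "a \<in> U"
      then have "{a..m} \<subseteq> U" using m ab \<open>I \<subseteq> U\<close> by (force simp: less_eq_real_def)
      then have "{a..m} \<subseteq> I" using m ab by (intro components_maximal[OF I]) auto
      then have "a \<in> I" using m by auto
      then show False using ab by auto
    qed
    moreover have "b \<notin> U"
    proof
      assume "b \<in> U"
      then have "{m..b} \<subseteq> U" using m ab \<open>I \<subseteq> U\<close> by (force simp: less_eq_real_def)
      then have "{m..b} \<subseteq> I" using m ab by (intro components_maximal[OF I]) auto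
      then have "b \<in> I" using m by auto
      then show False using ab by auto
    qed
    ultimately show ?thesis using ab U \<open>I \<subseteq> U\<close> unfolding U_def by blast
  qed
  have "disjoint \<I>"
    using pairwise_subset[OF pairwise_disjoint_components \<I>(1)] by (simp add: pairwise_def disjnt_def)
  then show ?thesis by (rule that[OF \<I>(2) _ \<I>(3) comps])
qed

text \<open>The energy splits over the intervals that cover the support, and all the pieces are nonnegative. Hence the
  piece that contains the point \<open>T\<close> has at most the total energy. The weight enters only through balls
  contained in \<open>V\<close>, which covers an infinite distance to the complement as well.\<close>

lemma line_bound:
  fixes f f' :: "real \<Rightarrow> 'a::real_inner" and F W :: "real \<Rightarrow> real"
  assumes p: "2 \<le> p" and s: "1 < s" and \<alpha>: "\<alpha> = (p - 1) / p" and q: "q = p * (s - 1) / (p - 1)"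
    and K: "compact K" and V: "open V" "K \<subseteq> V" and f0: "\<And>t. t \<notin> K \<Longrightarrow> f t = 0"
    and f': "\<And>t. (f has_vector_derivative f' t) (at t)" and cont: "continuous_on UNIV f'"
    and W: "\<And>t r. f t \<noteq> 0 \<Longrightarrow> 0 < r \<Longrightarrow> {t - r<..<t + r} \<subseteq> V \<Longrightarrow> W t \<le> r powr (- p)"
    and F: "F = (\<lambda>t. norm (f' t) powr p - \<alpha> powr p * norm (f t) powr p * W t)"
    and intF: "integrable lborel F"
  shows "0 \<le> (LINT t|lborel. F t)"
    and "0 < \<mu> \<Longrightarrow> norm (f T) powr s \<le>
           interpolation_bound p s \<mu> (LINT t|lborel. F t) (LINT t|lborel. norm (f t) powr q)"
proof -
  obtain \<I> where fin: "finite \<I>" and disj: "disjoint \<I>" and cover: "K \<subseteq> \<Union>\<I>"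
    and \<I>: "\<And>I. I \<in> \<I> \<Longrightarrow> \<exists>a b. a < b \<and> I = {a<..<b} \<and> I \<subseteq> V \<and> a \<notin> K \<and> b \<notin> K"
    using compact_subset_open_real_intervals[OF K V] by metis
  let ?g = "\<lambda>t. norm (f t) powr q"
  have q0: "0 < q" using p s by (simp add: q)
  have cf: "continuous_on S f" for S
    using f' by (meson continuous_at_imp_continuous_on has_vector_derivative_continuous)
  have intg: "integrable lborel ?g"
  proof -
    have "integrable lborel (\<lambda>t. indicator K t *\<^sub>R ?g t)"
      using q0 by (intro borel_integrable_compact K continuous_on_norm_powr cf)
    moreover have "(\<lambda>t. indicator K t *\<^sub>R ?g t) = ?g"
    proof
      show "indicator K t *\<^sub>R ?g t = ?g t" for t
        using f0[of t] by (cases "t \<in> K") auto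
    qed
    ultimately show ?thesis by simp
  qed
  have conv: "(LINT t|lborel. indicator {a<..<b} t * h t) = integral {a..b} h" "h integrable_on {a..b}"
    if "integrable lborel h" for h :: "real \<Rightarrow> real" and a b
  proof -
    have "set_integrable lborel {a<..<b} h" "set_integrable lborel {a..b} h"
      unfolding set_integrable_def using that by (intro integrable_mult_indicator; simp)+
    note this[THEN set_borel_integral_eq_integral(2)] this[THEN set_borel_integral_eq_integral(1)]
    then show "(LINT t|lborel. indicator {a<..<b} t * h t) = integral {a..b} h" "h integrable_on {a..b}"
      using integral_open_interval_real[of a b h] by (auto simp: set_lebesgue_integral_def)
  qed
  have comp: "0 \<le> (LINT t|lborel. indicator I t * F t) \<and> (\<forall>T\<in>I. \<forall>\<mu>>0. norm (f T) powr s \<le>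
           interpolation_bound p s \<mu> (LINT t|lborel. indicator I t * F t) (LINT t|lborel. indicator I t * norm (f t) powr q))"
    if I: "I \<in> \<I>" for I
  proof -
    obtain a b where ab: "a < b" "I = {a<..<b}" "{a<..<b} \<subseteq> V" "a \<notin> K" "b \<notin> K"
      using \<I>[OF I] by metis
    have "open (- K)" using K by (simp add: compact_imp_closed open_Compl)
    obtain \<epsilon>1 \<epsilon>2 where e: "0 < \<epsilon>1" "ball a \<epsilon>1 \<subseteq> - K" "0 < \<epsilon>2" "ball b \<epsilon>2 \<subseteq> - K"
      using ab openE[OF \<open>open (- K)\<close>] by (metis ComplI)
    define \<epsilon> where "\<epsilon> = min \<epsilon>1 \<epsilon>2 / 2"
    have \<epsilon>: "0 < \<epsilon>" "\<epsilon> < \<epsilon>1" "\<epsilon> < \<epsilon>2" using e by (auto simp: \<epsilon>_def min_def)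
    have fa: "f t = 0" if "t \<in> {a..a + \<epsilon>}" for t
    proof -
      have "t \<in> ball a \<epsilon>1" using that \<epsilon> by (auto simp: dist_real_def)
      then show ?thesis using e f0 by auto
    qed
    have fb: "f t = 0" if "t \<in> {b - \<epsilon>..b}" for t
    proof -
      have "t \<in> ball b \<epsilon>2" using that \<epsilon> by (auto simp: dist_real_def)
      then show ?thesis using e f0 by auto
    qed
    have Wab: "W t \<le> min (t - a) (b - t) powr (- p)" if "t \<in> {a<..<b}" "f t \<noteq> 0" for t
    proof (rule W[OF that(2)])
      show "{t - min (t - a) (b - t)<..<t + min (t - a) (b - t)} \<subseteq> V"
        using ab(3) that by (auto simp: min_def subset_iff split: if_splits)
    qed (use that in auto)
    note ib = interval_bound[OF p s \<alpha> q ab(1) \<epsilon>(1) f' cont fa fb Wab F conv(2)[OF intF]]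
    show ?thesis
      unfolding ab(2) conv(1)[OF intF] conv(1)[OF intg]
      by (intro conjI ballI allI impI ib) auto
  qed
  define J where "J = (\<Sum>I\<in>\<I>. LINT t|lborel. indicator I t * F t)"
  have sets[measurable]: "I \<in> sets borel" if "I \<in> \<I>" for I
    using \<I>[OF that] by auto
  have iI: "integrable lborel (\<lambda>t. indicator I t * h t)" if "I \<in> \<I>" "integrable lborel h" for I and h :: "real \<Rightarrow> real"
    using integrable_mult_indicator[of I lborel h] that sets by simp
  have "J = (LINT t|lborel. (\<Sum>I\<in>\<I>. indicator I t * F t))"
    unfolding J_def using iI[OF _ intF] by (intro Bochner_Integration.integral_sum[symmetric])
  also have "\<dots> \<le> (LINT t|lborel. F t)"
  proof (rule integral_mono[OF _ intF])
    show "integrable lborel (\<lambda>t. \<Sum>I\<in>\<I>. indicator I t * F t)"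
      using iI[OF _ intF] by (intro Bochner_Integration.integrable_sum)
    fix t
    show "(\<Sum>I\<in>\<I>. indicator I t * F t) \<le> F t"
    proof (cases "\<exists>I\<in>\<I>. t \<in> I")
      case True
      then obtain I where I: "I \<in> \<I>" "t \<in> I" by auto
      have "(\<Sum>I\<in>\<I>. indicator I t * F t) = (\<Sum>I'\<in>{I}. indicator I' t * F t)"
        using I fin disj by (intro sum.mono_neutral_right) (auto simp: indicator_def pairwise_def disjnt_def)
      then show ?thesis using I by simp
    next
      case False
      then have "t \<notin> K" using cover by auto
      then show ?thesis using False f0 by (simp add: F)
    qed
  qed
  finally have J: "J \<le> (LINT t|lborel. F t)" .
  have "0 \<le> J" unfolding J_def using comp by (intro sum_nonneg) auto
  then show nonneg: "0 \<le> (LINT t|lborel. F t)" using J by linarith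
  have g0: "0 \<le> (LINT t|lborel. ?g t)" by simp
  show "norm (f T) powr s \<le> interpolation_bound p s \<mu> (LINT t|lborel. F t) (LINT t|lborel. norm (f t) powr q)" if \<mu>: "0 < \<mu>"
  proof (cases "T \<in> K")
    case True
    then obtain I where I: "I \<in> \<I>" "T \<in> I" using cover by auto
    have "(LINT t|lborel. indicator I t * F t) \<le> J"
      unfolding J_def using fin I comp by (intro member_le_sum) auto
    moreover have "(LINT t|lborel. indicator I t * ?g t) \<le> (LINT t|lborel. ?g t)"
      using I by (intro integral_mono iI intg) (auto simp: indicator_def)
    moreover have "norm (f T) powr s \<le>
           interpolation_bound p s \<mu> (LINT t|lborel. indicator I t * F t) (LINT t|lborel. indicator I t * ?g t)"
      using comp I \<mu> by blast
    ultimately show ?thesis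
      using J \<mu> interpolation_const_pos[OF p s]
      by (elim order_trans, intro mult_left_mono add_mono) auto
  next
    case False
    then show ?thesis using f0 nonneg g0 \<mu> interpolation_const_pos[OF p s] by simp
  qed
qed

section \<open>Hoelder's inequality and Gagliardo's lemma\<close>

lemma ennreal_powr_ennreal: "0 < r \<Longrightarrow> 0 \<le> x \<Longrightarrow> ennreal_powr (ennreal x) r = ennreal (x powr r)"
  by (auto simp: ennreal_powr_def)

lemma ennreal_powr_simps [simp]:
  "0 < r \<Longrightarrow> ennreal_powr 0 r = 0" "0 < r \<Longrightarrow> ennreal_powr top r = top"
  by (auto simp: ennreal_powr_def)

lemma ennreal_powr_eq_0_iff: "0 < r \<Longrightarrow> ennreal_powr a r = 0 \<longleftrightarrow> a = 0"
  by (cases a) (auto simp: ennreal_powr_def)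

lemma ennreal_powr_mono: "0 < r \<Longrightarrow> a \<le> b \<Longrightarrow> ennreal_powr a r \<le> ennreal_powr b r"
  by (cases a; cases b) (auto simp: ennreal_powr_ennreal top_unique intro!: ennreal_leI powr_mono2)

lemma ennreal_powr_mult: "0 < r \<Longrightarrow> ennreal_powr (a * b) r = ennreal_powr a r * ennreal_powr b r"
  by (cases a; cases b)
     (auto simp: ennreal_powr_ennreal ennreal_mult'[symmetric] powr_mult ennreal_mult_top ennreal_top_mult
        ennreal_powr_eq_0_iff ennreal_mult_eq_top_iff)

lemma borel_measurable_ennreal_powr [measurable (raw)]:
  assumes [measurable]: "f \<in> borel_measurable M"
  shows "(\<lambda>x. ennreal_powr (f x) r) \<in> borel_measurable M"
  unfolding ennreal_powr_def by measurable

lemma ennreal_AM_GM: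
  fixes a :: "'i \<Rightarrow> ennreal"
  assumes "finite J" "J \<noteq> {}"
  shows "(\<Prod>i\<in>J. ennreal_powr (a i) (1 / card J)) \<le> (\<Sum>i\<in>J. a i) * ennreal (1 / card J)"
proof (cases "\<exists>i\<in>J. a i = top")
  case True
  then obtain i where "i \<in> J" "a i = top" by auto
  then have "(\<Sum>i\<in>J. a i) = top"
    using member_le_sum[of i J a] assms by (simp add: top_unique)
  moreover have "0 < card J" using assms by (simp add: card_gt_0_iff)
  ultimately show ?thesis by (simp add: ennreal_top_mult)
next
  case False
  define x where "x i = enn2real (a i)" for i
  have a: "a i = ennreal (x i)" if "i \<in> J" for i
    using False that by (auto simp: x_def less_top)
  have x: "0 \<le> x i" for i by (simp add: x_def)
  have m: "0 < card J" using assms by (simp add: card_gt_0_iff)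
  have "(\<Prod>i\<in>J. ennreal_powr (a i) (1 / card J)) = (\<Prod>i\<in>J. ennreal (x i powr (1 / card J)))"
    using m x by (intro prod.cong) (auto simp: a ennreal_powr_ennreal)
  also have "\<dots> = ennreal ((\<Prod>i\<in>J. x i) powr (1 / card J))"
    using x by (simp add: prod_ennreal prod_powr_distrib)
  also have "\<dots> \<le> ennreal ((\<Sum>i\<in>J. x i) * (1 / card J))"
    using arith_geom_mean[OF assms, of x] x by (intro ennreal_leI) (simp add: sum_divide_distrib)
  also have "\<dots> = (\<Sum>i\<in>J. a i) * ennreal (1 / card J)"
  proof -
    have "(\<Sum>i\<in>J. a i) = ennreal (\<Sum>i\<in>J. x i)"
      using x by (simp add: a)
    then show ?thesis
      using x by (simp only: ennreal_mult' sum_nonneg)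
  qed
  finally show ?thesis .
qed

text \<open>After normalizing all integrals to \<open>1\<close> this is the inequality of the means. If one integral vanishes then so
  does the product almost everywhere, and if one is infinite while none vanishes then the right-hand side is infinite.\<close>

lemma nn_integral_Holder_prod:
  fixes g :: "'i \<Rightarrow> 'a \<Rightarrow> ennreal"
  assumes J: "finite J" "J \<noteq> {}" and [measurable]: "\<And>i. i \<in> J \<Longrightarrow> g i \<in> borel_measurable M"
  shows "(\<integral>\<^sup>+x. (\<Prod>i\<in>J. ennreal_powr (g i x) (1 / card J)) \<partial>M)
         \<le> (\<Prod>i\<in>J. ennreal_powr (\<integral>\<^sup>+x. g i x \<partial>M) (1 / card J))"
proof -
  let ?r = "1 / card J" and ?I = "\<lambda>i. \<integral>\<^sup>+x. g i x \<partial>M"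
  have m: "0 < card J" using J by (simp add: card_gt_0_iff)
  then have r: "0 < ?r" by simp
  consider (zero) i where "i \<in> J" "?I i = 0" | (infinite) i where "i \<in> J" "?I i = top" "\<And>i. i \<in> J \<Longrightarrow> ?I i \<noteq> 0"
    | (fin) "\<And>i. i \<in> J \<Longrightarrow> ?I i \<noteq> 0" "\<And>i. i \<in> J \<Longrightarrow> ?I i \<noteq> top" by metis
  then show ?thesis
  proof cases
    case zero
    then have "AE x in M. g i x = 0"
      using nn_integral_0_iff_AE[of "g i" M] by simp
    then have "AE x in M. (\<Prod>i\<in>J. ennreal_powr (g i x) ?r) = 0"
      using zero(1) J(1) r by (auto simp: ennreal_powr_eq_0_iff)
    then have "(\<integral>\<^sup>+x. (\<Prod>i\<in>J. ennreal_powr (g i x) ?r) \<partial>M) = 0"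
      by (subst nn_integral_0_iff_AE) auto
    then show ?thesis by simp
  next
    case infinite
    have "(\<Prod>j\<in>J - {i}. ennreal_powr (?I j) ?r) \<noteq> 0"
      using J infinite r by (simp add: ennreal_powr_eq_0_iff)
    then have "(\<Prod>j\<in>J. ennreal_powr (?I j) ?r) = top"
      using infinite J r by (simp add: prod.remove[OF J(1) infinite(1)] ennreal_top_mult)
    then show ?thesis by simp
  next
    case fin
    define c where "c i = enn2real (?I i)" for i
    have c: "?I i = ennreal (c i)" "0 < c i" if "i \<in> J" for i
      using fin[OF that] unfolding c_def
      by (simp_all add: less_top enn2real_positive_iff zero_less_iff_neq_zero)
    have cinv: "ennreal (c i) * ennreal (1 / c i) = 1" if "i \<in> J" for i
      using c(2)[OF that] ennreal_mult'[of "c i" "1 / c i"] by simp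
    have "(\<Prod>i\<in>J. ennreal_powr (g i x) ?r)
        \<le> (\<Prod>i\<in>J. ennreal_powr (?I i) ?r) * ((\<Sum>i\<in>J. g i x * ennreal (1 / c i)) * ennreal ?r)" for x
    proof -
      have e: "g i x = ?I i * (g i x * ennreal (1 / c i))" if "i \<in> J" for i
      proof -
        show ?thesis using cinv[OF that] unfolding c(1)[OF that] by (metis mult.left_commute mult.right_neutral)
      qed
      have "(\<Prod>i\<in>J. ennreal_powr (g i x) ?r)
          = (\<Prod>i\<in>J. ennreal_powr (?I i) ?r * ennreal_powr (g i x * ennreal (1 / c i)) ?r)"
      proof (intro prod.cong refl)
        fix i assume "i \<in> J"
        show "ennreal_powr (g i x) ?r = ennreal_powr (?I i) ?r * ennreal_powr (g i x * ennreal (1 / c i)) ?r"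
          using ennreal_powr_mult[OF r, of "?I i" "g i x * ennreal (1 / c i)"] unfolding e[OF \<open>i \<in> J\<close>, symmetric] .
      qed
      also have "\<dots> = (\<Prod>i\<in>J. ennreal_powr (?I i) ?r) * (\<Prod>i\<in>J. ennreal_powr (g i x * ennreal (1 / c i)) ?r)"
        by (rule prod.distrib)
      also have "\<dots> \<le> (\<Prod>i\<in>J. ennreal_powr (?I i) ?r) * ((\<Sum>i\<in>J. g i x * ennreal (1 / c i)) * ennreal ?r)"
        by (intro mult_left_mono ennreal_AM_GM J) auto
      finally show ?thesis .
    qed
    then have "(\<integral>\<^sup>+x. (\<Prod>i\<in>J. ennreal_powr (g i x) ?r) \<partial>M)
        \<le> (\<integral>\<^sup>+x. (\<Prod>i\<in>J. ennreal_powr (?I i) ?r) * ((\<Sum>i\<in>J. g i x * ennreal (1 / c i)) * ennreal ?r) \<partial>M)"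
      by (intro nn_integral_mono)
    also have "\<dots> = (\<Prod>i\<in>J. ennreal_powr (?I i) ?r) * ((\<Sum>i\<in>J. ?I i * ennreal (1 / c i)) * ennreal ?r)"
      by (simp add: nn_integral_cmult nn_integral_multc nn_integral_sum)
    also have "(\<Sum>i\<in>J. ?I i * ennreal (1 / c i)) = (\<Sum>i\<in>J. 1)"
      using c cinv by (intro sum.cong) auto
    also have "\<dots> * ennreal ?r = ennreal (real (card J)) * ennreal ?r"
      by (simp add: ennreal_of_nat_eq_real_of_nat)
    also have "\<dots> = 1"
      using m ennreal_mult'[of "real (card J)" ?r] by simp
    finally show ?thesis by simp
  qed
qed

definition set_coord :: "'a::euclidean_space \<Rightarrow> real \<Rightarrow> 'a \<Rightarrow> 'a" where
  "set_coord b t x = x + (t - x \<bullet> b) *\<^sub>R b"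

definition merge_coords :: "'a::euclidean_space set \<Rightarrow> ('a \<Rightarrow> real) \<Rightarrow> 'a \<Rightarrow> 'a" where
  "merge_coords A y x = (\<Sum>b\<in>Basis. (if b \<in> A then y b else x \<bullet> b) *\<^sub>R b)"

text \<open>The coordinates in \<open>A\<close> are integrated out, but the result remains a function on the whole space. All the
  marginals of a function thus live on one type, whatever \<open>A\<close> is.\<close>

definition marginal :: "'a::euclidean_space set \<Rightarrow> ('a \<Rightarrow> ennreal) \<Rightarrow> 'a \<Rightarrow> ennreal" where
  "marginal A f x = (\<integral>\<^sup>+y. f (merge_coords A y x) \<partial>Pi\<^sub>M A (\<lambda>_. lborel))"

lemma set_coord_inner:
  "b \<in> Basis \<Longrightarrow> k \<in> Basis \<Longrightarrow> set_coord k t x \<bullet> b = (if b = k then t else x \<bullet> b)"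
  by (auto simp: set_coord_def inner_add_left inner_Basis)

lemma merge_coords_inner:
  "b \<in> Basis \<Longrightarrow> merge_coords A y x \<bullet> b = (if b \<in> A then y b else x \<bullet> b)"
  by (simp add: merge_coords_def)

lemma merge_coords_insert:
  assumes "k \<in> Basis" "k \<notin> A"
  shows "merge_coords (insert k A) (y(k := t)) x = merge_coords A y (set_coord k t x)"
    and "merge_coords (insert k A) (y(k := t)) x = set_coord k t (merge_coords A y x)"
  by (rule euclidean_eqI; use assms in \<open>auto simp: merge_coords_inner set_coord_inner\<close>)+

lemma measurable_merge_coords [measurable]:
  "(\<lambda>(x, y). merge_coords A y x) \<in> borel \<Otimes>\<^sub>M Pi\<^sub>M A (\<lambda>_. lborel) \<rightarrow>\<^sub>M borel"
  unfolding merge_coords_def split_beta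
proof (intro borel_measurable_sum borel_measurable_scaleR borel_measurable_const)
  fix b :: 'a assume "b \<in> Basis"
  show "(\<lambda>p. if b \<in> A then snd p b else fst p \<bullet> b) \<in> borel \<Otimes>\<^sub>M Pi\<^sub>M A (\<lambda>_. lborel) \<rightarrow>\<^sub>M borel"
  proof (cases "b \<in> A")
    case True
    then have "(\<lambda>p. snd p b) \<in> borel \<Otimes>\<^sub>M Pi\<^sub>M A (\<lambda>_. lborel) \<rightarrow>\<^sub>M (lborel :: real measure)"
      by (intro measurable_compose[OF measurable_snd measurable_component_singleton])
    with True show ?thesis by simp
  next
    case False
    have "(\<lambda>p. fst p \<bullet> b) \<in> borel \<Otimes>\<^sub>M Pi\<^sub>M A (\<lambda>_. lborel) \<rightarrow>\<^sub>M borel"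
      by measurable
    with False show ?thesis by simp
  qed
qed

lemma measurable_merge_coords1 [measurable]:
  "(\<lambda>y. merge_coords A y x) \<in> Pi\<^sub>M A (\<lambda>_. lborel) \<rightarrow>\<^sub>M borel"
  using measurable_compose[OF measurable_Pair1'[of x borel] measurable_merge_coords[of A]] by simp

lemma measurable_set_coord [measurable]:
  "(\<lambda>(x, t). set_coord b t x) \<in> borel \<Otimes>\<^sub>M borel \<rightarrow>\<^sub>M borel"
  "set_coord b t \<in> borel \<rightarrow>\<^sub>M borel" "(\<lambda>t. set_coord b t x) \<in> borel \<rightarrow>\<^sub>M borel"
  unfolding set_coord_def[abs_def] by measurable

interpretation lborel_product: product_sigma_finite "\<lambda>_::'a::euclidean_space. lborel :: real measure"
  by standard

lemma borel_measurable_marginal [measurable (raw)]: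
  fixes A :: "'a::euclidean_space set"
  assumes A: "A \<subseteq> Basis" and f[measurable]: "f \<in> borel_measurable borel"
  shows "marginal A f \<in> borel_measurable borel"
proof -
  have "finite A" using A finite_subset[of A Basis] by simp
  then interpret finite_product_sigma_finite "\<lambda>_::'a. lborel :: real measure" A
    by (intro finite_product_sigma_finite.intro lborel_product.product_sigma_finite_axioms
        finite_product_sigma_finite_axioms.intro)
  have "(\<lambda>(x, y). f (merge_coords A y x)) \<in> borel_measurable (borel \<Otimes>\<^sub>M Pi\<^sub>M A (\<lambda>_. lborel))"
    using measurable_compose[OF measurable_merge_coords f] by (simp add: split_beta')
  then show ?thesis
    unfolding marginal_def by (rule borel_measurable_nn_integral)
qed

lemma marginal_empty: "f \<in> borel_measurable borel \<Longrightarrow> marginal {} f x = f x"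
  by (simp add: marginal_def PiM_empty nn_integral_count_space_finite merge_coords_def euclidean_representation)

text \<open>Tonelli's theorem: the new coordinate can be integrated last or first.\<close>

lemma marginal_insert:
  assumes A: "A \<subseteq> Basis" "k \<in> Basis" "k \<notin> A" and [measurable]: "f \<in> borel_measurable borel"
  shows "marginal (insert k A) f x = (\<integral>\<^sup>+t. marginal A f (set_coord k t x) \<partial>lborel)"
    and "marginal (insert k A) f x = marginal A (\<lambda>x. \<integral>\<^sup>+t. f (set_coord k t x) \<partial>lborel) x"
proof -
  have "finite A" using A finite_subset[of A Basis] by simp
  have m: "(\<lambda>y. f (merge_coords (insert k A) y x)) \<in> borel_measurable (Pi\<^sub>M (insert k A) (\<lambda>_. lborel))"
    by measurable
  show "marginal (insert k A) f x = (\<integral>\<^sup>+t. marginal A f (set_coord k t x) \<partial>lborel)"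
    and "marginal (insert k A) f x = marginal A (\<lambda>x. \<integral>\<^sup>+t. f (set_coord k t x) \<partial>lborel) x"
    using lborel_product.product_nn_integral_insert_rev[OF \<open>finite A\<close> A(3) m]
      lborel_product.product_nn_integral_insert[OF \<open>finite A\<close> A(3) m]
    by (simp_all add: marginal_def merge_coords_insert(1)[OF A(2,3)] flip: merge_coords_insert(2)[OF A(2,3)])
qed

lemma marginal_set_coord:
  assumes "k \<in> Basis" "k \<notin> A" "\<And>t x. f (set_coord k t x) = f x"
  shows "marginal A f (set_coord k t x) = marginal A f x"
proof -
  have "merge_coords A y (set_coord k t x) = set_coord k t (merge_coords A y x)" for y
    using merge_coords_insert[OF assms(1,2)] by metis
  then show ?thesis by (simp add: marginal_def assms(3))
qed

lemma marginal_Basis: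
  fixes f :: "'a::euclidean_space \<Rightarrow> ennreal"
  assumes [measurable]: "f \<in> borel_measurable borel"
  shows "marginal Basis f x = (\<integral>\<^sup>+x. f x \<partial>lborel)"
  by (subst lborel_eq) (simp add: nn_integral_distr marginal_def merge_coords_def)

text \<open>Gagliardo's lemma in a form that admits induction on the set \<open>A\<close> of integrated coordinates. When coordinate
  \<open>k\<close> is added, the factor of \<open>h k\<close> does not depend on it and is taken out, and Hoelder's inequality with equal
  exponents applies to the other \<open>DIM('a) - 1\<close> factors. Only \<open>A - {i}\<close> is integrated in the factor for \<open>i\<close>,
  and for \<open>A = Basis\<close> no factor depends on \<open>x\<close> any more.\<close>

lemma marginal_prod_le:
  fixes h :: "'a::euclidean_space \<Rightarrow> 'a \<Rightarrow> ennreal"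
  assumes N: "2 \<le> DIM('a)" and h[measurable]: "\<And>i. i \<in> Basis \<Longrightarrow> h i \<in> borel_measurable borel"
    and indep: "\<And>i t x. i \<in> Basis \<Longrightarrow> h i (set_coord i t x) = h i x"
    and A: "A \<subseteq> Basis"
  shows "marginal A (\<lambda>x. \<Prod>i\<in>Basis. ennreal_powr (h i x) (1 / (DIM('a) - 1))) x
         \<le> (\<Prod>i\<in>Basis. ennreal_powr (marginal (A - {i}) (h i) x) (1 / (DIM('a) - 1)))"
proof -
  let ?r = "1 / real (DIM('a) - 1)"
  have r: "0 < ?r" using N by simp
  have "finite A" using A finite_subset[of A Basis] by simp
  then show ?thesis using A
  proof (induction A arbitrary: x rule: finite_induct)
    case empty
    show ?case using h by (subst marginal_empty) (auto intro!: prod_mono simp: marginal_empty)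
  next
    case (insert k A)
    then have k: "k \<in> Basis" "A \<subseteq> Basis" by auto
    have fin: "finite (Basis - {k})" and card: "card (Basis - {k}) = DIM('a) - 1"
      using k by (auto simp: card_Diff_singleton)
    have ne: "Basis - {k} \<noteq> {}"
    proof
      assume "Basis - {k} = {}"
      then have "card (Basis - {k}) = 0" by (simp only: card.empty)
      then show False using card N by simp
    qed
    have [measurable]: "marginal (A - {i}) (h i) \<in> borel_measurable borel" if "i \<in> Basis" for i
      using that k by (intro borel_measurable_marginal) auto
    let ?m = "\<lambda>i x. marginal (A - {i}) (h i) x"
    have "marginal (insert k A) (\<lambda>x. \<Prod>i\<in>Basis. ennreal_powr (h i x) ?r) x
        = (\<integral>\<^sup>+t. marginal A (\<lambda>x. \<Prod>i\<in>Basis. ennreal_powr (h i x) ?r) (set_coord k t x) \<partial>lborel)"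
      using k insert.hyps by (intro marginal_insert) auto
    also have "\<dots> \<le> (\<integral>\<^sup>+t. (\<Prod>i\<in>Basis. ennreal_powr (?m i (set_coord k t x)) ?r) \<partial>lborel)"
      using insert.IH k by (intro nn_integral_mono) auto
    also have "\<dots> = (\<integral>\<^sup>+t. ennreal_powr (?m k x) ?r * (\<Prod>i\<in>Basis - {k}. ennreal_powr (?m i (set_coord k t x)) ?r) \<partial>lborel)"
      using k insert.hyps indep by (simp add: prod.remove[of Basis k] marginal_set_coord)
    also have "\<dots> = ennreal_powr (?m k x) ?r * (\<integral>\<^sup>+t. (\<Prod>i\<in>Basis - {k}. ennreal_powr (?m i (set_coord k t x)) ?r) \<partial>lborel)"
      by (intro nn_integral_cmult) auto
    also have "\<dots> \<le> ennreal_powr (?m k x) ?r * (\<Prod>i\<in>Basis - {k}. ennreal_powr (\<integral>\<^sup>+t. ?m i (set_coord k t x) \<partial>lborel) ?r)"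
      using nn_integral_Holder_prod[OF fin ne, of "\<lambda>i t. ?m i (set_coord k t x)" lborel]
      by (intro mult_left_mono) (auto simp: card)
    also have "(\<Prod>i\<in>Basis - {k}. ennreal_powr (\<integral>\<^sup>+t. ?m i (set_coord k t x) \<partial>lborel) ?r)
        = (\<Prod>i\<in>Basis - {k}. ennreal_powr (marginal (insert k A - {i}) (h i) x) ?r)"
    proof (intro prod.cong refl)
      fix i assume i: "i \<in> Basis - {k}"
      have "insert k A - {i} = insert k (A - {i})" using i by auto
      moreover have "marginal (insert k (A - {i})) (h i) x = (\<integral>\<^sup>+t. ?m i (set_coord k t x) \<partial>lborel)"
        using i k insert.hyps h by (intro marginal_insert) auto
      ultimately show "ennreal_powr (\<integral>\<^sup>+t. ?m i (set_coord k t x) \<partial>lborel) ?r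
          = ennreal_powr (marginal (insert k A - {i}) (h i) x) ?r" by simp
    qed
    also have "?m k x = marginal (insert k A - {k}) (h k) x" by simp
    also have "ennreal_powr (marginal (insert k A - {k}) (h k) x) ?r
        * (\<Prod>i\<in>Basis - {k}. ennreal_powr (marginal (insert k A - {i}) (h i) x) ?r)
        = (\<Prod>i\<in>Basis. ennreal_powr (marginal (insert k A - {i}) (h i) x) ?r)"
      using k by (simp add: prod.remove[of Basis k])
    finally show ?case .
  qed
qed

section \<open>The Hardy-Sobolev inequality for the coordinate directions\<close>

lemma integrable_Hardy_density:
  fixes f :: "'a::euclidean_space \<Rightarrow> 'b::real_normed_vector" and f' :: "'a \<Rightarrow> 'c::real_normed_vector"
  assumes r: "0 < r" and K: "compact K" "\<And>x. x \<notin> K \<Longrightarrow> f x = 0" "\<And>x. x \<notin> K \<Longrightarrow> f' x = 0"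
    and cont: "continuous_on UNIV f" "continuous_on UNIV f'"
    and W: "W \<in> borel_measurable borel" "\<And>x. 0 \<le> W x" "\<And>x. x \<in> K \<Longrightarrow> W x \<le> M"
  shows "integrable lborel (\<lambda>x. norm (f x) powr r)" "integrable lborel (\<lambda>x. norm (f' x) powr r)"
    "integrable lborel (\<lambda>x. norm (f x) powr r * W x)"
proof -
  have int: "integrable lborel (\<lambda>x. norm (g x) powr r)"
    if "continuous_on UNIV g" "\<And>x. x \<notin> K \<Longrightarrow> g x = 0" for g :: "'a \<Rightarrow> 'd::real_normed_vector"
  proof -
    have "integrable lborel (\<lambda>x. indicator K x *\<^sub>R norm (g x) powr r)"
      using r by (intro borel_integrable_compact K continuous_on_norm_powr continuous_on_subset[OF that(1)]) auto
    moreover have "(\<lambda>x. indicator K x *\<^sub>R norm (g x) powr r) = (\<lambda>x. norm (g x) powr r)"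
    proof
      show "indicator K x *\<^sub>R norm (g x) powr r = norm (g x) powr r" for x
        using that(2)[of x] by (cases "x \<in> K") auto
    qed
    ultimately show ?thesis by simp
  qed
  show 1: "integrable lborel (\<lambda>x. norm (f x) powr r)" and "integrable lborel (\<lambda>x. norm (f' x) powr r)"
    using int K cont by auto
  have [measurable]: "f \<in> borel_measurable borel" using cont by (simp add: borel_measurable_continuous_onI)
  show "integrable lborel (\<lambda>x. norm (f x) powr r * W x)"
  proof (rule Bochner_Integration.integrable_bound)
    show "integrable lborel (\<lambda>x. \<bar>M\<bar> * norm (f x) powr r)" using 1 by simp
    show "(\<lambda>x. norm (f x) powr r * W x) \<in> borel_measurable lborel"
      using W(1) cont r by (auto intro!: borel_measurable_times borel_measurable_continuous_onI continuous_on_norm_powr)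
    show "AE x in lborel. norm (norm (f x) powr r * W x) \<le> norm (\<bar>M\<bar> * norm (f x) powr r)"
    proof (intro AE_I2)
      fix x
      show "norm (norm (f x) powr r * W x) \<le> norm (\<bar>M\<bar> * norm (f x) powr r)"
      proof (cases "x \<in> K")
        case True
        have "W x \<le> \<bar>M\<bar>" using W(3)[OF True] by simp
        then have "norm (f x) powr r * W x \<le> norm (f x) powr r * \<bar>M\<bar>"
          by (rule mult_left_mono) simp
        then show ?thesis using W(2)[of x] by (simp add: abs_mult mult.commute)
      qed (use K in simp)
    qed
  qed
qed

text \<open>Fubini's theorem for a difference whose integrals over lines are known to be nonnegative. The
  subtracted part is moved to the other side, so that only nonnegative functions are integrated.\<close>

lemma marginal_slice_integral:
  fixes a c :: "'a::euclidean_space \<Rightarrow> real"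
  assumes b: "b \<in> Basis" and nonneg: "\<And>x. 0 \<le> a x" "\<And>x. 0 \<le> c x"
    and int: "integrable lborel a" "integrable lborel c"
    and slice: "\<And>x. integrable lborel (\<lambda>t. a (set_coord b t x))" "\<And>x. integrable lborel (\<lambda>t. c (set_coord b t x))"
    and pos: "\<And>x. 0 \<le> (LINT t|lborel. a (set_coord b t x) - c (set_coord b t x))"
  shows "marginal (Basis - {b}) (\<lambda>x. ennreal (LINT t|lborel. a (set_coord b t x) - c (set_coord b t x))) x
         = ennreal (LINT x|lborel. a x - c x)"
    and "0 \<le> (LINT x|lborel. a x - c x)"
proof -
  let ?B = "Basis - {b}"
  let ?e = "\<lambda>x. LINT t|lborel. a (set_coord b t x) - c (set_coord b t x)"
  let ?n = "\<lambda>f x. \<integral>\<^sup>+t. ennreal (f (set_coord b t x)) \<partial>lborel"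
  have [measurable]: "a \<in> borel_measurable borel" "c \<in> borel_measurable borel"
    using int by auto
  have [measurable]: "?e \<in> borel_measurable borel"
  proof -
    have "(\<lambda>(x, t). a (set_coord b t x) - c (set_coord b t x)) \<in> borel_measurable (borel \<Otimes>\<^sub>M lborel)"
      by measurable
    then show ?thesis by (rule lborel.borel_measurable_lebesgue_integral)
  qed
  have nm: "?n f \<in> borel_measurable borel" if [measurable]: "f \<in> borel_measurable borel" for f
  proof -
    have "(\<lambda>(x, t). ennreal (f (set_coord b t x))) \<in> borel_measurable (borel \<Otimes>\<^sub>M lborel)"
      by measurable
    then show ?thesis by (rule lborel.borel_measurable_nn_integral)
  qed
  have total: "marginal ?B (?n f) x = ennreal (LINT x|lborel. f x)"
    if "integrable lborel f" "\<And>x. 0 \<le> f x" for f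
  proof -
    have [measurable]: "f \<in> borel_measurable borel" using that by auto
    have "marginal ?B (?n f) x = marginal (insert b ?B) (\<lambda>x. ennreal (f x)) x"
      using b by (intro marginal_insert(2)[symmetric]) auto
    also have "\<dots> = ennreal (LINT x|lborel. f x)"
      using b that by (simp add: insert_absorb marginal_Basis nn_integral_eq_integral)
    finally show ?thesis .
  qed
  have pw: "ennreal (?e x) + ?n c x = ?n a x" for x
  proof -
    have "?n a x = ennreal (LINT t|lborel. a (set_coord b t x))" "?n c x = ennreal (LINT t|lborel. c (set_coord b t x))"
      using nonneg slice by (simp_all add: nn_integral_eq_integral)
    then show ?thesis
      using pos[of x] nonneg slice by (simp flip: ennreal_plus)
  qed
  have "marginal ?B (\<lambda>x. ennreal (?e x)) x + marginal ?B (?n c) x = marginal ?B (\<lambda>x. ennreal (?e x) + ?n c x) x"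
    unfolding marginal_def using nm[of c] by (intro nn_integral_add[symmetric]) measurable
  also have "\<dots> = marginal ?B (?n a) x" using pw by simp
  finally have *: "marginal ?B (\<lambda>x. ennreal (?e x)) x + ennreal (LINT x|lborel. c x) = ennreal (LINT x|lborel. a x)"
    using total[OF int(1)] total[OF int(2)] nonneg by simp
  then have "marginal ?B (\<lambda>x. ennreal (?e x)) x \<noteq> top" by auto
  then obtain m where m: "0 \<le> m" "marginal ?B (\<lambda>x. ennreal (?e x)) x = ennreal m"
    by (cases "marginal ?B (\<lambda>x. ennreal (?e x)) x") auto
  then have "m + (LINT x|lborel. c x) = (LINT x|lborel. a x)"
    using * nonneg by (simp flip: ennreal_plus)
  then have "(LINT x|lborel. a x - c x) = m" using int by simp
  then show "marginal ?B (\<lambda>x. ennreal (?e x)) x = ennreal (LINT x|lborel. a x - c x)"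
    "0 \<le> (LINT x|lborel. a x - c x)" using m by simp_all
qed

text \<open>The parameter is chosen so that the term with \<open>X\<close> on the right equals half of \<open>X powr ((N - 1) / N)\<close> and can be
  absorbed into the left-hand side.\<close>

lemma Sobolev_from_interpolation:
  fixes X J H N p :: real
  assumes "1 < p" "p < N" "0 \<le> X" "0 \<le> J" "0 < H"
    and bound: "\<And>\<mu>. 0 < \<mu> \<Longrightarrow> X \<le> (H * (\<mu> * J + \<mu> powr (- 1 / (p - 1)) * X)) powr (N / (N - 1))"
  shows "X powr ((N - p) / N) \<le> (2 * H) powr p * J"
proof (cases "X = 0")
  case True
  then show ?thesis using assms by simp
next
  case False
  then have X: "0 < X" using assms by simp
  \<comment> \<open>The value of \<open>\<mu>\<close> for which \<open>H * \<mu> powr (- 1 / (p - 1)) * X\<close> is half of \<open>X powr ((N - 1) / N)\<close>.\<close>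
  define \<mu> where "\<mu> = (2 * H) powr (p - 1) * X powr ((p - 1) / N)"
  have \<mu>: "0 < \<mu>" using X assms by (simp add: \<mu>_def)
  have \<mu>': "\<mu> powr (- 1 / (p - 1)) = 1 / (2 * H) * X powr (- 1 / N)"
  proof -
    have "(p - 1) * (- 1 / (p - 1)) = - 1" "(p - 1) / N * (- 1 / (p - 1)) = - 1 / N"
      using assms by (auto simp: field_simps)
    then show ?thesis
      using assms X by (simp only: \<mu>_def powr_mult powr_powr) (simp add: powr_minus_divide)
  qed
  have "X powr ((N - 1) / N) \<le> ((H * (\<mu> * J + \<mu> powr (- 1 / (p - 1)) * X)) powr (N / (N - 1))) powr ((N - 1) / N)"
    using bound[OF \<mu>] X assms by (intro powr_mono2) auto
  also have "\<dots> = H * (\<mu> * J + \<mu> powr (- 1 / (p - 1)) * X)"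
  proof -
    have "N / (N - 1) * ((N - 1) / N) = 1" using assms by simp
    then show ?thesis using assms \<mu> by (simp only: powr_powr) simp
  qed
  also have "\<dots> = H * \<mu> * J + X powr ((N - 1) / N) / 2"
  proof -
    have "X powr (- 1 / N) * X = X powr ((N - 1) / N)"
    proof -
      have "- 1 / N + 1 = (N - 1) / N" using assms by (simp add: field_simps)
      then show ?thesis using X powr_add[of X "- 1 / N" 1] by simp
    qed
    then have "H * (1 / (2 * H) * X powr (- 1 / N) * X) = X powr ((N - 1) / N) / 2"
      using assms by simp
    then show ?thesis unfolding \<mu>' distrib_left by simp
  qed
  finally have "X powr ((N - 1) / N) \<le> 2 * H * \<mu> * J" by simp
  also have "2 * H * \<mu> = (2 * H) powr p * X powr ((p - 1) / N)"
    using assms by (simp add: \<mu>_def powr_diff)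
  finally have "X powr ((N - 1) / N) * X powr (- ((p - 1) / N)) \<le> (2 * H) powr p * X powr ((p - 1) / N) * J * X powr (- ((p - 1) / N))"
    by (intro mult_right_mono) auto
  also have "X powr ((N - 1) / N) * X powr (- ((p - 1) / N)) = X powr ((N - p) / N)"
    by (simp flip: powr_add diff_divide_distrib)
  also have "(2 * H) powr p * X powr ((p - 1) / N) * J * X powr (- ((p - 1) / N)) = (2 * H) powr p * J"
    using X by (simp add: powr_minus)
  finally show ?thesis .
qed

lemma ennreal_powr_prod_mono:
  fixes a b :: "'i \<Rightarrow> ennreal"
  assumes "0 < r" "\<And>i. i \<in> I \<Longrightarrow> a i \<le> b i"
  shows "(\<Prod>i\<in>I. ennreal_powr (a i) r) \<le> (\<Prod>i\<in>I. ennreal_powr (b i) r)"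
  using assms by (induction I rule: infinite_finite_induct) (auto intro!: mult_mono ennreal_powr_mono)

text \<open>By \<open>line_bound\<close>, for each coordinate direction \<open>b\<close>, \<open>norm (v x) powr s\<close> is at most a function \<open>h b x\<close> that does
  not depend on coordinate \<open>b\<close> and whose integral over the remaining coordinates is a combination of \<open>J b\<close> and the integral of
  \<open>norm v powr q\<close>. The product over \<open>b\<close> of the powers \<open>1 / (N - 1)\<close> of these bounds has
  \<open>norm v powr q\<close> on the left, since \<open>s * N / (N - 1) = q\<close>, and Gagliardo's lemma integrates the right-hand side.\<close>

lemma axis_Hardy_Sobolev:
  fixes v :: "'a::euclidean_space \<Rightarrow> 'b::real_inner" and v' :: "'a \<Rightarrow> 'a \<Rightarrow> 'b" and W :: "'a \<Rightarrow> 'a \<Rightarrow> real"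
  assumes N: "N = real DIM('a)" and p: "2 \<le> p" "p < N" and \<alpha>: "\<alpha> = (p - 1) / p"
    and q: "q = N * p / (N - p)" and s: "s = p * (N - 1) / (N - p)"
    and K: "compact K" "K \<subseteq> \<Omega>" "open \<Omega>" and v0: "\<And>x. x \<notin> K \<Longrightarrow> v x = 0" and v_cont: "continuous_on UNIV v"
    and v': "\<And>b x. b \<in> Basis \<Longrightarrow> ((\<lambda>t. v (x + t *\<^sub>R b)) has_vector_derivative v' b x) (at 0)"
    and v'_cont: "\<And>b. b \<in> Basis \<Longrightarrow> continuous_on UNIV (v' b)"
    and W: "\<And>b. b \<in> Basis \<Longrightarrow> W b \<in> borel_measurable borel" "\<And>b x. 0 \<le> W b x"
      "\<And>b x. b \<in> Basis \<Longrightarrow> x \<in> K \<Longrightarrow> W b x \<le> M"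
    and W_le: "\<And>b x r. b \<in> Basis \<Longrightarrow> v x \<noteq> 0 \<Longrightarrow> 0 < r \<Longrightarrow> (\<And>t. \<bar>t\<bar> < r \<Longrightarrow> x + t *\<^sub>R b \<in> \<Omega>) \<Longrightarrow> W b x \<le> r powr (- p)"
    and J: "\<And>b. J b = (LINT x|lborel. norm (v' b x) powr p - \<alpha> powr p * (norm (v x) powr p * W b x))"
  shows "b \<in> Basis \<Longrightarrow> 0 \<le> J b"
    and "(LINT x|lborel. norm (v x) powr q) powr ((N - p) / N) \<le> (2 * interpolation_const p s) powr p * (\<Sum>b\<in>Basis. J b)"
proof -
  have N3: "2 < N" "2 \<le> DIM('a)" using p N by auto
  have s1: "1 < s" unfolding s using p N3 by (simp add: field_simps)
  have q': "q = p * (s - 1) / (p - 1)"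
  proof -
    have "s - 1 = N * (p - 1) / (N - p)" unfolding s using p by (simp add: field_simps)
    then show ?thesis unfolding q using p by simp
  qed
  have q0: "0 < q" unfolding q using p N3 by simp
  define H where "H = interpolation_const p s"
  have H: "0 < H" unfolding H_def by (rule interpolation_const_pos[OF p(1) s1])
  have v'0: "v' b x = 0" if b: "b \<in> Basis" and x: "x \<notin> K" for b x
  proof -
    have "open (- K)" using K by (simp add: compact_imp_closed open_Compl)
    then obtain e where e: "0 < e" "ball x e \<subseteq> - K" using x openE by (metis ComplI)
    have "((\<lambda>t. v (x + t *\<^sub>R b)) has_vector_derivative 0) (at 0)"
    proof (rule has_vector_derivative_transform_within_open[where f = "\<lambda>_. 0" and S = "{- e<..<e}"])
      fix t assume "t \<in> {- e<..<e}"
      then have "x + t *\<^sub>R b \<in> ball x e" using b by (auto simp: dist_norm)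
      then show "0 = v (x + t *\<^sub>R b)" using e v0 by auto
    qed (use e in auto)
    then show ?thesis using v'[OF b] vector_derivative_unique_at by blast
  qed
  have sc_cont: "continuous_on S (\<lambda>t. set_coord b t x)" for S and b x :: 'a
    unfolding set_coord_def by (intro continuous_intros)
  have slice_compact: "compact {t. set_coord b t x \<in> K}" if b: "b \<in> Basis" for b x
  proof -
    have "closed ((\<lambda>t. set_coord b t x) -` K)"
      using continuous_closed_vimage[OF compact_imp_closed[OF K(1)]] sc_cont[of UNIV b x]
      by (metis UNIV_I continuous_on_eq_continuous_at open_UNIV)
    moreover have "bounded {t. set_coord b t x \<in> K}"
    proof -
      obtain R where R: "\<And>y. y \<in> K \<Longrightarrow> norm y \<le> R" using compact_imp_bounded[OF K(1)] bounded_iff by blast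
      have "norm t \<le> R" if "set_coord b t x \<in> K" for t
      proof -
        have "\<bar>set_coord b t x \<bullet> b\<bar> \<le> norm (set_coord b t x)" using b by (rule Basis_le_norm)
        then show ?thesis using R[OF that] b by (simp add: set_coord_inner)
      qed
      then show ?thesis unfolding bounded_iff by blast
    qed
    ultimately show ?thesis by (simp add: compact_eq_bounded_closed vimage_def)
  qed
  define F where "F b x = norm (v' b x) powr p - \<alpha> powr p * norm (v x) powr p * W b x" for b x
  have p0: "0 < p" using p by simp
  have ints: "integrable lborel (\<lambda>x. norm (v x) powr r)" "integrable lborel (\<lambda>x. norm (v' b x) powr r)"
     "integrable lborel (\<lambda>x. norm (v x) powr r * W b x)" if b: "b \<in> Basis" and r: "0 < r" for b r
    using integrable_Hardy_density[OF r K(1) v0 v'0[OF b] v_cont v'_cont[OF b] W(1)[OF b] W(2) W(3)[OF b]]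
    by auto
  have slices: "integrable lborel (\<lambda>t. norm (v (set_coord b t x)) powr r)"
     "integrable lborel (\<lambda>t. norm (v' b (set_coord b t x)) powr r)"
     "integrable lborel (\<lambda>t. norm (v (set_coord b t x)) powr r * W b (set_coord b t x))"
    if b: "b \<in> Basis" and r: "0 < r" for b x r
  proof -
    have 1: "continuous_on UNIV (\<lambda>t. v (set_coord b t x))" "continuous_on UNIV (\<lambda>t. v' b (set_coord b t x))"
      by (rule continuous_on_compose2[OF v_cont sc_cont] continuous_on_compose2[OF v'_cont[OF b] sc_cont]; simp)+
    have 2: "(\<lambda>t. W b (set_coord b t x)) \<in> borel_measurable borel"
      using W(1)[OF b] by measurable
    have 3: "v (set_coord b t x) = 0" "v' b (set_coord b t x) = 0" if "t \<notin> {t. set_coord b t x \<in> K}" for t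
      using that v0 v'0[OF b] by auto
    have 4: "W b (set_coord b t x) \<le> M" if "t \<in> {t. set_coord b t x \<in> K}" for t
      using that W(3)[OF b] by auto
    show "integrable lborel (\<lambda>t. norm (v (set_coord b t x)) powr r)"
     "integrable lborel (\<lambda>t. norm (v' b (set_coord b t x)) powr r)"
     "integrable lborel (\<lambda>t. norm (v (set_coord b t x)) powr r * W b (set_coord b t x))"
      using integrable_Hardy_density[where f = "\<lambda>t. v (set_coord b t x)" and f' = "\<lambda>t. v' b (set_coord b t x)"
          and W = "\<lambda>t. W b (set_coord b t x)", OF r slice_compact[OF b] 3 1 2 W(2) 4] by auto
  qed
  have line: "0 \<le> (LINT t|lborel. F b (set_coord b t x))"
     "0 < \<mu> \<Longrightarrow> norm (v x) powr s \<le> H * (\<mu> * (LINT t|lborel. F b (set_coord b t x))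
             + \<mu> powr (- 1 / (p - 1)) * (LINT t|lborel. norm (v (set_coord b t x)) powr q))"
    if b: "b \<in> Basis" for b x \<mu>
  proof -
    let ?f = "\<lambda>t. v (set_coord b t x)" and ?f' = "\<lambda>t. v' b (set_coord b t x)"
    let ?K = "{t. set_coord b t x \<in> K}" and ?V = "{t. set_coord b t x \<in> \<Omega>}"
    have V: "open ?V" "?K \<subseteq> ?V"
      using open_vimage[OF K(3) sc_cont[of UNIV b x]] K(2) by (auto simp: vimage_def)
    have f': "(?f has_vector_derivative ?f' t) (at t)" for t
    proof -
      have shift: "((\<lambda>y. y - t) has_vector_derivative 1) (at t)"
        using has_vector_derivative_diff[OF has_vector_derivative_id[of "at t"] has_vector_derivative_const[of t]] by simp
      have "((\<lambda>h. v (set_coord b t x + h *\<^sub>R b)) has_vector_derivative ?f' t) (at (t - t))"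
        using v'[OF b] by simp
      then have "((\<lambda>h. v (set_coord b t x + h *\<^sub>R b)) \<circ> (\<lambda>y. y - t) has_vector_derivative 1 *\<^sub>R ?f' t) (at t)"
        by (rule vector_diff_chain_at[OF shift])
      moreover have "(\<lambda>h. v (set_coord b t x + h *\<^sub>R b)) \<circ> (\<lambda>y. y - t) = ?f"
        by (auto simp: set_coord_def algebra_simps)
      ultimately show ?thesis by simp
    qed
    have cont: "continuous_on UNIV ?f'"
      by (rule continuous_on_compose2[OF v'_cont[OF b] sc_cont]) simp
    have Wl: "W b (set_coord b t x) \<le> r powr (- p)" if "?f t \<noteq> 0" "0 < r" "{t - r<..<t + r} \<subseteq> ?V" for t r
    proof (rule W_le[OF b that(1,2)])
      fix h :: real assume "\<bar>h\<bar> < r"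
      then have "t + h \<in> {t - r<..<t + r}" by auto
      then have "t + h \<in> ?V" using that(3) by blast
      moreover have "set_coord b t x + h *\<^sub>R b = set_coord b (t + h) x"
        by (simp add: set_coord_def algebra_simps)
      ultimately show "set_coord b t x + h *\<^sub>R b \<in> \<Omega>" by simp
    qed
    have Feq: "(\<lambda>t. F b (set_coord b t x)) = (\<lambda>t. norm (?f' t) powr p - \<alpha> powr p * norm (?f t) powr p * W b (set_coord b t x))"
      by (simp add: F_def)
    have intF: "integrable lborel (\<lambda>t. F b (set_coord b t x))"
      unfolding Feq mult.assoc using slices[OF b p0, of x] by (intro Bochner_Integration.integrable_diff integrable_mult_right) auto
    have v0': "?f t = 0" if "t \<notin> ?K" for t using that v0 by simp
    note lb = line_bound[OF p(1) s1 \<alpha> q' slice_compact[OF b] V v0' f' cont Wl Feq intF]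
    show "0 \<le> (LINT t|lborel. F b (set_coord b t x))" by (rule lb(1))
    have "set_coord b (x \<bullet> b) x = x" by (simp add: set_coord_def)
    moreover have "norm (?f (x \<bullet> b)) powr s \<le> interpolation_bound p s \<mu> (LINT t|lborel. F b (set_coord b t x)) (LINT t|lborel. norm (v (set_coord b t x)) powr q)" if "0 < \<mu>"
      by (rule lb(2)[OF _ _ _ _ that])
    ultimately show "norm (v x) powr s \<le> H * (\<mu> * (LINT t|lborel. F b (set_coord b t x))
             + \<mu> powr (- 1 / (p - 1)) * (LINT t|lborel. norm (v (set_coord b t x)) powr q))" if "0 < \<mu>"
      using that by (simp add: H_def)
  qed
  define X where "X = (LINT x|lborel. norm (v x) powr q)"
  have X0: "0 \<le> X" by (simp add: X_def)
  have iF: "integrable lborel (F b)" "integrable lborel (\<lambda>t. F b (set_coord b t x))" if b: "b \<in> Basis" for b x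
    unfolding F_def mult.assoc using ints[OF b p0] slices[OF b p0, of x]
    by (auto intro!: Bochner_Integration.integrable_diff integrable_mult_right)
  have JF: "J b = (LINT x|lborel. F b x)" for b by (simp add: F_def J mult.assoc)
  define h where "h \<mu> \<nu> b x = (LINT t|lborel. H * (\<mu> * F b (set_coord b t x) + \<nu> * norm (v (set_coord b t x)) powr q))" for \<mu> \<nu> b x
  have marg: "marginal (Basis - {b}) (\<lambda>x. ennreal (h \<mu> \<nu> b x)) 0 = ennreal (H * (\<mu> * J b + \<nu> * X))"
    and total_pos: "0 \<le> H * (\<mu> * J b + \<nu> * X)"
    and h_meas: "h \<mu> \<nu> b \<in> borel_measurable borel"
    if b: "b \<in> Basis" and \<mu>: "0 \<le> \<mu>" "0 \<le> \<nu>" for b \<mu> \<nu>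
  proof -
    define a where "a x = H * \<mu> * norm (v' b x) powr p + H * \<nu> * norm (v x) powr q" for x
    define c where "c x = H * \<mu> * \<alpha> powr p * (norm (v x) powr p * W b x)" for x
    have nonneg: "0 \<le> a x" "0 \<le> c x" for x using H \<mu> W(2) by (auto simp: a_def c_def)
    have ia: "integrable lborel a" "integrable lborel c"
      unfolding a_def c_def using ints[OF b p0] ints[OF b q0]
      by (auto intro!: Bochner_Integration.integrable_add integrable_mult_right)
    have sl: "integrable lborel (\<lambda>t. a (set_coord b t x))" "integrable lborel (\<lambda>t. c (set_coord b t x))" for x
      unfolding a_def c_def
      by (intro Bochner_Integration.integrable_add integrable_mult_right slices[OF b p0] slices[OF b q0])+
    have "(\<lambda>t. a (set_coord b t x) - c (set_coord b t x))
        = (\<lambda>t. H * (\<mu> * F b (set_coord b t x) + \<nu> * norm (v (set_coord b t x)) powr q))" for x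
      by (auto simp: a_def c_def F_def algebra_simps)
    then have h: "h \<mu> \<nu> b x = (LINT t|lborel. a (set_coord b t x) - c (set_coord b t x))" for x
      by (simp add: h_def)
    have h_nonneg: "0 \<le> h \<mu> \<nu> b x" for x
      using line(1)[OF b, of x] iF(2)[OF b, of x] slices(1)[OF b q0, of x] H \<mu> by (simp add: h_def)
    note m = marginal_slice_integral[OF b nonneg ia sl h_nonneg[unfolded h]]
    have "marginal (Basis - {b}) (\<lambda>x. ennreal (h \<mu> \<nu> b x)) 0 = ennreal (LINT x|lborel. a x - c x)"
      unfolding h by (rule m(1))
    also have tot: "(LINT x|lborel. a x - c x) = (LINT x|lborel. H * (\<mu> * F b x + \<nu> * norm (v x) powr q))"
      by (rule Bochner_Integration.integral_cong) (auto simp: a_def c_def F_def algebra_simps)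
    also have tot': "\<dots> = H * (\<mu> * J b + \<nu> * X)"
      using iF(1)[OF b] ints(1)[OF b q0] by (simp add: X_def JF)
    finally show "marginal (Basis - {b}) (\<lambda>x. ennreal (h \<mu> \<nu> b x)) 0 = ennreal (H * (\<mu> * J b + \<nu> * X))" .
    show "0 \<le> H * (\<mu> * J b + \<nu> * X)" using m(2) unfolding tot tot' .
    have [measurable]: "a \<in> borel_measurable borel" "c \<in> borel_measurable borel" using ia by auto
    have "(\<lambda>(x, t). a (set_coord b t x) - c (set_coord b t x)) \<in> borel_measurable (borel \<Otimes>\<^sub>M lborel)"
      by measurable
    from lborel.borel_measurable_lebesgue_integral[OF this]
    show "h \<mu> \<nu> b \<in> borel_measurable borel" unfolding h[abs_def] by simp
  qed
  show J0: "0 \<le> J b" if b: "b \<in> Basis" for b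
    using total_pos[OF b, of 1 0] H by (simp add: zero_le_mult_iff)
  define S where "S = (\<Sum>b\<in>Basis. J b)"
  have S0: "0 \<le> S" and JS: "\<And>b. b \<in> Basis \<Longrightarrow> J b \<le> S"
    unfolding S_def using J0 by (auto intro!: sum_nonneg member_le_sum)
  have "X powr ((N - p) / N) \<le> (2 * H) powr p * S"
  proof (rule Sobolev_from_interpolation[OF _ p(2) X0 S0 H])
    fix \<mu> :: real assume \<mu>: "0 < \<mu>"
    define \<nu> where "\<nu> = \<mu> powr (- 1 / (p - 1))"
    have \<nu>: "0 \<le> \<nu>" by (simp add: \<nu>_def)
    let ?r = "1 / real (DIM('a) - 1)" and ?Z = "H * (\<mu> * S + \<nu> * X)"
    have r: "0 < ?r" "?r = 1 / (N - 1)" using N3 by (auto simp: N of_nat_diff)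
    have Z: "0 \<le> ?Z" using H \<mu> \<nu> S0 X0 by simp
    have pow: "(\<Prod>b\<in>(Basis::'a set). ennreal_powr (ennreal z) ?r) = ennreal (z powr (N / (N - 1)))" if "0 \<le> z" for z
    proof -
      have "(z powr ?r) ^ DIM('a) = z powr (N / (N - 1))"
      proof (cases "z = 0")
        case False
        then have "(z powr (1 / (N - 1))) ^ DIM('a) = (z powr (1 / (N - 1))) powr N"
          using powr_realpow[of "z powr (1 / (N - 1))" "DIM('a)"] that by (simp add: N)
        then show ?thesis unfolding r(2) by (simp add: powr_powr)
      qed simp
      then show ?thesis using r that by (simp add: ennreal_powr_ennreal ennreal_power)
    qed
    have "ennreal X = (\<integral>\<^sup>+x. ennreal (norm (v x) powr q) \<partial>lborel)"
    proof -
      obtain b :: 'a where b: "b \<in> Basis" using nonempty_Basis by blast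
      show ?thesis unfolding X_def by (intro nn_integral_eq_integral[symmetric] ints(1)[OF b q0]) auto
    qed
    also have "\<dots> \<le> (\<integral>\<^sup>+x. (\<Prod>b\<in>Basis. ennreal_powr (ennreal (h \<mu> \<nu> b x)) ?r) \<partial>lborel)"
    proof (intro nn_integral_mono)
      fix x
      have "s * (N / (N - 1)) = q" unfolding s q using p N3 by simp
      then have "ennreal (norm (v x) powr q) = (\<Prod>b\<in>(Basis::'a set). ennreal_powr (ennreal (norm (v x) powr s)) ?r)"
        by (subst pow) (simp_all add: powr_powr)
      also have "\<dots> \<le> (\<Prod>b\<in>Basis. ennreal_powr (ennreal (h \<mu> \<nu> b x)) ?r)"
      proof (intro ennreal_powr_prod_mono r(1) ennreal_leI)
        fix b :: 'a assume b: "b \<in> Basis"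
        show "norm (v x) powr s \<le> h \<mu> \<nu> b x"
          unfolding h_def using line(2)[OF b \<mu>, of x] iF(2)[OF b, of x] slices(1)[OF b q0, of x] by (simp add: \<nu>_def)
      qed
      finally show "ennreal (norm (v x) powr q) \<le> (\<Prod>b\<in>Basis. ennreal_powr (ennreal (h \<mu> \<nu> b x)) ?r)" .
    qed
    also have "\<dots> = marginal Basis (\<lambda>x. \<Prod>b\<in>Basis. ennreal_powr (ennreal (h \<mu> \<nu> b x)) ?r) 0"
      using h_meas[OF _ less_imp_le[OF \<mu>] \<nu>]
      by (subst marginal_Basis) (auto intro!: borel_measurable_prod_ennreal borel_measurable_ennreal_powr measurable_compose[OF _ measurable_ennreal])
    also have "\<dots> \<le> (\<Prod>b\<in>Basis. ennreal_powr (marginal (Basis - {b}) (\<lambda>x. ennreal (h \<mu> \<nu> b x)) 0) ?r)"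
    proof (rule marginal_prod_le[OF N3(2) _ _ order_refl])
      show "(\<lambda>x. ennreal (h \<mu> \<nu> b x)) \<in> borel_measurable borel" if "b \<in> Basis" for b
        using h_meas[OF that less_imp_le[OF \<mu>] \<nu>] by simp
      show "ennreal (h \<mu> \<nu> b (set_coord b t x)) = ennreal (h \<mu> \<nu> b x)" if b: "b \<in> Basis" for b t x
      proof -
        have "set_coord b t' (set_coord b t x) = set_coord b t' x" for t'
          by (rule euclidean_eqI) (use b in \<open>auto simp: set_coord_inner\<close>)
        then show ?thesis by (simp add: h_def)
      qed
    qed
    also have "\<dots> \<le> (\<Prod>b\<in>(Basis::'a set). ennreal_powr (ennreal ?Z) ?r)"
    proof (intro ennreal_powr_prod_mono r(1))
      fix b :: 'a assume b: "b \<in> Basis"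
      have "marginal (Basis - {b}) (\<lambda>x. ennreal (h \<mu> \<nu> b x)) 0 = ennreal (H * (\<mu> * J b + \<nu> * X))"
        using b \<mu> \<nu> by (intro marg) auto
      also have "\<dots> \<le> ennreal ?Z"
        using JS[OF b] H \<mu> by (intro ennreal_leI mult_left_mono add_right_mono) auto
      finally show "marginal (Basis - {b}) (\<lambda>x. ennreal (h \<mu> \<nu> b x)) 0 \<le> ennreal ?Z" .
    qed
    also have "\<dots> = ennreal (?Z powr (N / (N - 1)))" by (rule pow[OF Z])
    finally show "X \<le> (H * (\<mu> * S + \<mu> powr (- 1 / (p - 1)) * X)) powr (N / (N - 1))"
      by (simp add: \<nu>_def)
  qed (use p in simp)
  then show "(LINT x|lborel. norm (v x) powr q) powr ((N - p) / N) \<le> (2 * interpolation_const p s) powr p * (\<Sum>b\<in>Basis. J b)"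
    by (simp add: X_def S_def H_def)
qed

section \<open>Linear changes of variables\<close>

text \<open>The formula \<open>measure_linear_image\<close> for the volume of a linear image needs coordinates that are indexed by a
  well-ordered type. This type has as many elements as \<open>'n\<close> and is well-ordered, and the coordinates are relabelled
  along a bijection. The relabelling is isometric and preserves Lebesgue measure, so results carry over.\<close>

typedef (overloaded) 'n ordered_index = "{..<CARD('n::finite)}"
  by (rule exI[of _ 0]) simp

setup_lifting type_definition_ordered_index

instantiation ordered_index :: (finite) wellorder
begin
lift_definition less_eq_ordered_index :: "'a ordered_index \<Rightarrow> 'a ordered_index \<Rightarrow> bool" is "(\<le>)" .
lift_definition less_ordered_index :: "'a ordered_index \<Rightarrow> 'a ordered_index \<Rightarrow> bool" is "(<)" .
instance
proof
  fix x y z :: "'a ordered_index" and P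
  show "(x < y) = (x \<le> y \<and> \<not> y \<le> x)" "x \<le> x" "x \<le> y \<or> y \<le> x" by (transfer; auto)+
  show "x \<le> y \<Longrightarrow> y \<le> z \<Longrightarrow> x \<le> z" "x \<le> y \<Longrightarrow> y \<le> x \<Longrightarrow> x = y" by (transfer; auto)+
  show "P x" if "\<And>x. (\<And>y. y < x \<Longrightarrow> P y) \<Longrightarrow> P x"
  proof (induction "Rep_ordered_index x" arbitrary: x rule: less_induct)
    case less
    then show ?case using that by (simp add: less_ordered_index.rep_eq)
  qed
qed
end

lemma UNIV_ordered_index: "(UNIV :: 'n::finite ordered_index set) = Abs_ordered_index ` {..<CARD('n)}"
  using type_definition.Abs_image[OF type_definition_ordered_index] by metis

instance ordered_index :: (finite) finite
  by standard (simp add: UNIV_ordered_index)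

lemma card_ordered_index: "CARD('n::finite ordered_index) = CARD('n)"
  unfolding UNIV_ordered_index
  by (subst card_image) (auto intro!: inj_onI simp: Abs_ordered_index_inject)

definition index_of :: "'n::finite \<Rightarrow> 'n ordered_index" where
  "index_of = (SOME h. bij h)"

lemma bij_index_of: "bij (index_of :: 'n::finite \<Rightarrow> 'n ordered_index)"
proof -
  have "\<exists>h :: 'n \<Rightarrow> 'n ordered_index. bij_betw h UNIV UNIV"
    by (rule finite_same_card_bij) (simp_all add: card_ordered_index)
  then show ?thesis unfolding index_of_def by (rule someI_ex)
qed

definition relabel :: "real ^ 'n::finite ordered_index \<Rightarrow> real ^ 'n" where
  "relabel y = (\<chi> i. y $ index_of i)"

definition unlabel :: "real ^ 'n::finite \<Rightarrow> real ^ 'n ordered_index" where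
  "unlabel x = (\<chi> j. x $ inv index_of j)"

lemma relabel_unlabel [simp]: "relabel (unlabel x) = x" and unlabel_relabel [simp]: "unlabel (relabel y) = y"
  by (simp_all add: relabel_def unlabel_def vec_eq_iff bij_is_inj[OF bij_index_of] bij_is_surj[OF bij_index_of] surj_f_inv_f)

lemma linear_relabel: "linear relabel" and linear_unlabel: "linear unlabel"
  by (auto intro!: linearI simp: relabel_def unlabel_def vec_eq_iff)

lemma inner_unlabel: "unlabel x \<bullet> unlabel y = x \<bullet> y"
  unfolding inner_vec_def unlabel_def
  using sum.reindex_bij_betw[OF bij_imp_bij_inv[OF bij_index_of], of "\<lambda>i. x $ i * y $ i"] by simp

lemma norm_unlabel: "norm (unlabel x) = norm x"
  by (simp add: norm_eq_sqrt_inner inner_unlabel)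

lemma unlabel_axis: "unlabel (axis i c) = axis (index_of i) c"
proof -
  have "inv index_of j = i \<longleftrightarrow> j = index_of i" for j
    using bij_index_of by (metis bij_inv_eq_iff)
  then show ?thesis by (auto simp: unlabel_def axis_def vec_eq_iff)
qed

lemma bij_betw_axis_Basis: "bij_betw (\<lambda>i. axis i (1::real)) (UNIV :: 'n::finite set) Basis"
  by (auto simp: bij_betw_def Basis_vec_def axis_eq_axis intro!: injI)

lemma borel_measurable_linear: "linear f \<Longrightarrow> (f :: 'a::euclidean_space \<Rightarrow> 'b::euclidean_space) \<in> borel \<rightarrow>\<^sub>M borel"
  by (intro borel_measurable_continuous_onI linear_continuous_on linear_conv_bounded_linear[THEN iffD1])

lemma lborel_relabel: "lborel = distr lborel borel (relabel :: real ^ 'n::finite ordered_index \<Rightarrow> real ^ 'n)"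
proof (rule lborel_eqI)
  fix l u :: "real ^ 'n" assume le: "\<And>b. b \<in> Basis \<Longrightarrow> l \<bullet> b \<le> u \<bullet> b"
  have [measurable]: "(relabel :: real ^ 'n ordered_index \<Rightarrow> real ^ 'n) \<in> borel \<rightarrow>\<^sub>M borel"
    by (rule borel_measurable_linear[OF linear_relabel])
  have surj: "surj (index_of :: 'n \<Rightarrow> _)" using bij_index_of by (rule bij_is_surj)
  have box: "relabel -` box l u = box (unlabel l) (unlabel u)"
  proof -
    have "(\<forall>i::'n. P (index_of i)) \<longleftrightarrow> (\<forall>j. P j)" for P using surj by (metis surjE)
    moreover have "inv index_of (index_of i) = i" for i :: 'n
      by (simp add: bij_is_inj[OF bij_index_of])
    ultimately show ?thesis
      by (auto simp: mem_box_cart relabel_def unlabel_def vimage_def) (metis surjE surj)+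
  qed
  have le': "unlabel l \<bullet> b \<le> unlabel u \<bullet> b" if b: "b \<in> Basis" for b
  proof -
    obtain j where "b = axis j 1" using b by (auto simp: Basis_vec_def)
    then show ?thesis using le[of "axis (inv index_of j) 1"]
      by (simp add: inner_axis unlabel_def)
  qed
  have "emeasure (distr lborel borel relabel) (box l u) = emeasure lborel (box (unlabel l) (unlabel u))"
    by (simp add: emeasure_distr box)
  also have "\<dots> = (\<Prod>b\<in>Basis. (unlabel u - unlabel l) \<bullet> b)"
    using le' by (intro emeasure_lborel_box) auto
  also have "(\<Prod>b\<in>Basis. (unlabel u - unlabel l) \<bullet> b) = (\<Prod>i\<in>UNIV. (u - l) $ i)"
    using prod.reindex_bij_betw[OF bij_imp_bij_inv[OF bij_index_of], of "\<lambda>i. (u - l) $ i"]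
    by (simp add: prod.reindex_bij_betw[OF bij_betw_axis_Basis, symmetric] inner_axis unlabel_def)
  also have "\<dots> = (\<Prod>b\<in>Basis. (u - l) \<bullet> b)"
    by (simp add: prod.reindex_bij_betw[OF bij_betw_axis_Basis, symmetric] inner_axis)
  finally show "emeasure (distr lborel borel relabel) (box l u) = (\<Prod>b\<in>Basis. (u - l) \<bullet> b)" .
qed simp

lemma lborel_linear_wellorder:
  fixes A :: "real ^ 'm::{finite,wellorder} \<Rightarrow> real ^ 'm::_"
  assumes A: "linear A" and det: "det (matrix A) \<noteq> 0"
  shows "lborel = density (distr lborel borel A) (\<lambda>_. ennreal \<bar>det (matrix A)\<bar>)"
proof (rule lborel_eqI)
  fix l u :: "real ^ 'm::_" assume le: "\<And>b. b \<in> Basis \<Longrightarrow> l \<bullet> b \<le> u \<bullet> b"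
  have [measurable]: "A \<in> borel \<rightarrow>\<^sub>M borel" by (rule borel_measurable_linear[OF A])
  obtain M where inv: "M ** matrix A = mat 1" "matrix A ** M = mat 1"
    using det unfolding invertible_det_nz[symmetric] invertible_def by auto
  have AM: "A x = matrix A *v x" for x using A by (simp add: matrix_works)
  have vim: "A -` S = (*v) M ` S" for S
  proof (intro equalityI subsetI)
    fix x assume "x \<in> A -` S"
    moreover have "x = M *v (A x)" by (simp add: AM matrix_vector_mul_assoc inv)
    ultimately show "x \<in> (*v) M ` S" by auto
  next
    fix x assume "x \<in> (*v) M ` S"
    then show "x \<in> A -` S" by (auto simp: AM matrix_vector_mul_assoc inv)
  qed
  have dM: "\<bar>det M\<bar> * \<bar>det (matrix A)\<bar> = 1"
    using inv(1) by (metis abs_mult abs_one det_I det_mul)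
  have lin: "linear ((*v) M)" by simp
  have lm: "A -` box l u \<in> lmeasurable"
    unfolding vim by (rule measurable_linear_image[OF lin]) simp
  have sets: "A -` box l u \<in> sets lborel"
    using measurable_sets[of A borel borel "box l u"] by simp
  have "measure lebesgue (A -` box l u) = \<bar>det M\<bar> * measure lebesgue (box l u)"
    unfolding vim by (subst measure_linear_image[OF lin]) simp_all
  then have "emeasure lborel (A -` box l u) = ennreal (\<bar>det M\<bar> * (\<Prod>b\<in>Basis. (u - l) \<bullet> b))"
  proof -
    assume *: "measure lebesgue (A -` box l u) = \<bar>det M\<bar> * measure lebesgue (box l u)"
    have "emeasure lborel (A -` box l u) = emeasure lebesgue (A -` box l u)"
      using sets by simp
    also have "\<dots> = ennreal (measure lebesgue (A -` box l u))"
      using lm by (rule emeasure_eq_measure2)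
    finally have "emeasure lborel (A -` box l u) = ennreal (measure lebesgue (A -` box l u))" .
    moreover have "measure lebesgue (box l u) = (\<Prod>b\<in>Basis. (u - l) \<bullet> b)"
      using le by (simp add: measure_lborel_box_eq)
    ultimately show ?thesis using * by simp
  qed
  then have "emeasure (density (distr lborel borel A) (\<lambda>_. ennreal \<bar>det (matrix A)\<bar>)) (box l u)
      = ennreal \<bar>det (matrix A)\<bar> * ennreal (\<bar>det M\<bar> * (\<Prod>b\<in>Basis. (u - l) \<bullet> b))"
    by (simp add: emeasure_density_const emeasure_distr)
  also have "\<dots> = (\<Prod>b\<in>Basis. (u - l) \<bullet> b)"
  proof -
    have "\<bar>det (matrix A)\<bar> * (\<bar>det M\<bar> * P) = P" for P
      using dM by (metis mult.assoc mult.commute mult_1)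
    note cancel = this
    show ?thesis by (simp only: ennreal_mult'[symmetric] abs_ge_zero cancel)
  qed
  finally show "emeasure (density (distr lborel borel A) (\<lambda>_. ennreal \<bar>det (matrix A)\<bar>)) (box l u)
      = (\<Prod>b\<in>Basis. (u - l) \<bullet> b)" .
qed simp

text \<open>The modulus of the determinant, computed in the relabelled coordinates.\<close>

definition volume_factor :: "(real ^ 'n::finite \<Rightarrow> real ^ 'n) \<Rightarrow> real" where
  "volume_factor A = \<bar>det (matrix (unlabel \<circ> A \<circ> relabel))\<bar>"

lemma lborel_linear:
  fixes A :: "real ^ 'n::finite \<Rightarrow> real ^ 'n"
  assumes A: "linear A" and pos: "volume_factor A \<noteq> 0"
  shows "lborel = density (distr lborel borel A) (\<lambda>_. ennreal (volume_factor A))"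
proof (rule measure_eqI)
  fix S :: "(real ^ 'n) set" assume "S \<in> sets lborel"
  then have S[measurable]: "S \<in> sets borel" by simp
  have [measurable]: "A \<in> borel \<rightarrow>\<^sub>M borel" "relabel \<in> borel \<rightarrow>\<^sub>M borel" "unlabel \<in> borel \<rightarrow>\<^sub>M borel"
    by (intro borel_measurable_linear A linear_relabel linear_unlabel)+
  let ?A = "unlabel \<circ> A \<circ> relabel"
  have linA: "linear ?A" by (intro linear_compose A linear_relabel linear_unlabel)
  have mA[measurable]: "?A \<in> borel \<rightarrow>\<^sub>M borel" by (rule borel_measurable_linear[OF linA])
  have "emeasure lborel S = emeasure lborel (relabel -` S)"
    by (subst lborel_relabel) (simp add: emeasure_distr)
  also have "\<dots> = ennreal (volume_factor A) * emeasure lborel (?A -` (relabel -` S))"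
    using pos measurable_sets[of relabel borel borel S]
    by (subst lborel_linear_wellorder[OF linA])
      (simp_all add: volume_factor_def emeasure_density_const emeasure_distr)
  also have "?A -` (relabel -` S) = relabel -` (A -` S)"
    by auto
  also have "emeasure lborel (relabel -` (A -` S)) = emeasure lborel (A -` S)"
    using measurable_sets[of A borel borel S]
    by (subst (2) lborel_relabel) (simp add: emeasure_distr)
  also have "ennreal (volume_factor A) * emeasure lborel (A -` S)
      = emeasure (density (distr lborel borel A) (\<lambda>_. ennreal (volume_factor A))) S"
    by (simp add: emeasure_density_const emeasure_distr)
  finally show "emeasure lborel S = emeasure (density (distr lborel borel A) (\<lambda>_. ennreal (volume_factor A))) S" .
qed simp

lemma volume_factor_orthogonal:
  assumes "orthogonal_transformation A"
  shows "volume_factor A = 1"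
proof -
  have "orthogonal_transformation (unlabel \<circ> A \<circ> relabel)"
    unfolding orthogonal_transformation_def
  proof (intro conjI allI)
    show "linear (unlabel \<circ> A \<circ> relabel)"
      using assms by (intro linear_compose linear_relabel linear_unlabel) (auto simp: orthogonal_transformation_def)
    show "(unlabel \<circ> A \<circ> relabel) v \<bullet> (unlabel \<circ> A \<circ> relabel) w = v \<bullet> w" for v w
      using assms inner_unlabel[of "relabel v" "relabel w"] by (simp add: inner_unlabel orthogonal_transformation_def)
  qed
  then have "orthogonal_matrix (matrix (unlabel \<circ> A \<circ> relabel))"
    by (simp add: orthogonal_transformation_matrix)
  then show ?thesis unfolding volume_factor_def using det_orthogonal_matrix by fastforce
qed

text \<open>Continuity of the determinant at the identity matrix.\<close>

lemma volume_factor_near_id: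
  obtains \<delta> where "0 < \<delta>"
    "\<And>A :: real ^ 'n::finite \<Rightarrow> real ^ 'n. linear A \<Longrightarrow> (\<And>i. norm (A (axis i 1) - axis i 1) < \<delta>) \<Longrightarrow> 1 / 2 \<le> volume_factor A"
proof -
  have "continuous_on UNIV (det :: real ^ 'n ordered_index ^ 'n ordered_index \<Rightarrow> real)"
    unfolding det_def[abs_def] by (intro continuous_intros)
  then obtain d where d: "0 < d" "\<And>M :: real ^ 'n ordered_index ^ 'n ordered_index. dist M (mat 1) < d \<Longrightarrow> dist (det M) (det (mat 1)) < 1/2"
    unfolding continuous_on_iff by (elim ballE[of _ _ "mat 1"] allE[of _ "1/2"]) auto
  \<comment> \<open>The distance of the matrices is at most the sum of the distances of their \<open>CARD('n)\<close> rows.\<close>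
  define \<delta> where "\<delta> = d / (2 * CARD('n))"
  have "1 / 2 \<le> volume_factor A"
    if A: "linear A" and near: "\<And>i. norm (A (axis i 1) - axis i 1) < \<delta>" for A :: "real ^ 'n \<Rightarrow> real ^ 'n"
  proof -
    let ?A = "unlabel \<circ> A \<circ> relabel"
    let ?M = "transpose (matrix ?A)"
    have row: "norm ((?M - mat 1) $ j) < \<delta>" for j
    proof -
      obtain i where i: "j = index_of i" using bij_is_surj[OF bij_index_of] by (metis surjE)
      have ax: "axis j 1 = unlabel (axis i 1)" by (simp add: i unlabel_axis)
      have "(?M - mat 1) $ j = ?A (axis j 1) - axis j 1"
        by (auto simp: transpose_def matrix_def vec_eq_iff mat_def axis_def)
      also have "\<dots> = unlabel (A (axis i 1) - axis i 1)"
        by (simp add: ax linear_diff[OF linear_unlabel])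
      finally show ?thesis using near[of i] by (simp add: norm_unlabel)
    qed
    have "norm (?M - mat 1) \<le> (\<Sum>j\<in>UNIV. norm ((?M - mat 1) $ j))"
      unfolding norm_vec_def by (rule L2_set_le_sum) simp
    also have "\<dots> \<le> (\<Sum>j\<in>(UNIV :: 'n ordered_index set). \<delta>)"
      using row by (intro sum_mono less_imp_le)
    also have "\<dots> < d" using d by (simp add: card_ordered_index \<delta>_def)
    finally have "dist (det ?M) 1 < 1 / 2" using d(2)[of ?M] by (simp add: dist_norm)
    then have "\<bar>det (matrix ?A) - 1\<bar> < 1 / 2" by (simp add: det_transpose dist_real_def)
    then show ?thesis unfolding volume_factor_def by linarith
  qed
  moreover have "0 < \<delta>" using d by (simp add: \<delta>_def)
  ultimately show ?thesis using that by blast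
qed

section \<open>Moments of the surface measure on the sphere\<close>

lemma ball_in_sets_borel [measurable]: "ball x r \<in> sets borel"
  by simp

lemma lborel_scale:
  fixes f :: "'a::euclidean_space \<Rightarrow> ennreal"
  assumes [measurable]: "f \<in> borel_measurable borel" and c: "0 < c"
  shows "(\<integral>\<^sup>+x. f x \<partial>lborel) = ennreal (c ^ DIM('a)) * (\<integral>\<^sup>+x. f (c *\<^sub>R x) \<partial>lborel)"
  by (subst lborel_affine[of c 0])
     (use c in \<open>simp_all add: nn_integral_density nn_integral_distr nn_integral_cmult\<close>)

lemma nn_integral_homogeneous_ball:
  fixes h :: "'a::euclidean_space \<Rightarrow> ennreal" and c k p :: real
  assumes h[measurable]: "h \<in> borel_measurable borel" and c: "0 < c"
    and hom: "\<And>c x. 0 < c \<Longrightarrow> h (c *\<^sub>R x) = ennreal (c powr k) * h x"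
  shows "(\<integral>\<^sup>+x. h x * indicator (ball 0 c) x \<partial>lborel)
         = ennreal (c powr (DIM('a) + k)) * (\<integral>\<^sup>+x. h x * indicator (ball 0 1) x \<partial>lborel)"
proof -
  have ind: "indicator (ball 0 c) (c *\<^sub>R x) = (indicator (ball 0 1) x :: ennreal)" for x :: 'a
    using c by (auto simp: indicator_def)
  have "(\<integral>\<^sup>+x. h x * indicator (ball 0 c) x \<partial>lborel)
      = ennreal (c ^ DIM('a)) * (\<integral>\<^sup>+x. ennreal (c powr k) * (h x * indicator (ball 0 1) x) \<partial>lborel)"
  proof -
    have "(\<lambda>x. h x * indicator (ball 0 c) x) \<in> borel_measurable borel" by measurable
    from lborel_scale[OF this c] show ?thesis by (simp add: hom[OF c] ind mult.assoc)
  qed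
  also have "\<dots> = ennreal (c ^ DIM('a)) * (ennreal (c powr k) * (\<integral>\<^sup>+x. h x * indicator (ball 0 1) x \<partial>lborel))"
    by (subst nn_integral_cmult) auto
  also have "ennreal (c ^ DIM('a)) * (ennreal (c powr k) * (\<integral>\<^sup>+x. h x * indicator (ball 0 1) x \<partial>lborel))
      = ennreal (c powr (DIM('a) + k)) * (\<integral>\<^sup>+x. h x * indicator (ball 0 1) x \<partial>lborel)"
    using c by (simp add: powr_add powr_realpow ennreal_mult' mult.assoc)
  finally show ?thesis .
qed

text \<open>Write the Gaussian as a superposition of indicators of balls, \<open>exp (- \<rho>)\<close> being the integral of \<open>exp (- s)\<close> over
  \<open>s > \<rho>\<close>. The integral of a homogeneous function over a ball scales with a power of the radius, and the
  remaining integral over \<open>s\<close> is a Gamma function.\<close>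

lemma nn_integral_homogeneous_Gaussian:
  fixes h :: "'a::euclidean_space \<Rightarrow> ennreal" and c k p :: real
  assumes h[measurable]: "h \<in> borel_measurable borel" and k: "0 \<le> k"
    and hom: "\<And>c x. 0 < c \<Longrightarrow> h (c *\<^sub>R x) = ennreal (c powr k) * h x"
  shows "(\<integral>\<^sup>+x. h x * ennreal (exp (- (norm x)\<^sup>2)) \<partial>lborel)
         = ennreal (Gamma ((DIM('a) + k) / 2 + 1)) * (\<integral>\<^sup>+x. h x * indicator (ball 0 1) x \<partial>lborel)"
proof -
  let ?m = "\<integral>\<^sup>+x. h x * indicator (ball 0 1) x \<partial>lborel"
  have layer: "ennreal (exp (- \<rho>)) = (\<integral>\<^sup>+s. ennreal (exp (- s)) * indicator {\<rho><..} s \<partial>lborel)" for \<rho> :: real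
  proof -
    have "((\<lambda>s::real. - exp (- s)) \<longlongrightarrow> - 0) at_top"
      by (intro tendsto_minus filterlim_compose[OF exp_at_bot filterlim_uminus_at_bot_at_top])
    then have "(\<integral>\<^sup>+s. ennreal (exp (- s)) * indicator {\<rho>..} s \<partial>lborel) = ennreal (0 - (- exp (- \<rho>)))"
      by (intro nn_integral_FTC_atLeast) (auto intro!: derivative_eq_intros)
    moreover have "(\<integral>\<^sup>+s. ennreal (exp (- s)) * indicator {\<rho>..} s \<partial>lborel)
        = (\<integral>\<^sup>+s. ennreal (exp (- s)) * indicator {\<rho><..} s \<partial>lborel)"
      by (intro nn_integral_cong_AE eventually_mono[OF AE_lborel_singleton[of \<rho>]]) (auto simp: indicator_def)
    ultimately show ?thesis by simp
  qed
  have "(\<integral>\<^sup>+x. h x * ennreal (exp (- (norm x)\<^sup>2)) \<partial>lborel)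
      = (\<integral>\<^sup>+x. (\<integral>\<^sup>+s. h x * (ennreal (exp (- s)) * indicator {(norm x)\<^sup>2<..} s) \<partial>lborel) \<partial>lborel)"
  proof (intro nn_integral_cong)
    fix x
    show "h x * ennreal (exp (- (norm x)\<^sup>2))
        = (\<integral>\<^sup>+s. h x * (ennreal (exp (- s)) * indicator {(norm x)\<^sup>2<..} s) \<partial>lborel)"
      unfolding layer[of "(norm x)\<^sup>2"] by (rule nn_integral_cmult[symmetric]) measurable
  qed
  also have "\<dots> = (\<integral>\<^sup>+s. (\<integral>\<^sup>+x. h x * (ennreal (exp (- s)) * indicator {(norm x)\<^sup>2<..} s) \<partial>lborel) \<partial>lborel)"
  proof (rule lborel_pair.Fubini'[symmetric])
    have "(\<lambda>p. indicator {p. (norm (fst p))\<^sup>2 < snd p} p :: ennreal) \<in> borel_measurable (lborel \<Otimes>\<^sub>M lborel :: ('a \<times> real) measure)"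
      by measurable
    then have [measurable]: "(\<lambda>p. indicator {(norm (fst p))\<^sup>2<..} (snd p) :: ennreal) \<in> borel_measurable (lborel \<Otimes>\<^sub>M lborel :: ('a \<times> real) measure)"
      by (simp add: indicator_def)
    show "(\<lambda>(x, s). h x * (ennreal (exp (- s)) * indicator {(norm x)\<^sup>2<..} s)) \<in> borel_measurable (lborel \<Otimes>\<^sub>M lborel)"
      unfolding split_beta by measurable
  qed
  also have "\<dots> = (\<integral>\<^sup>+s. ennreal (indicator {0..} s * s powr ((DIM('a) + k) / 2) / exp s) * ?m \<partial>lborel)"
  proof (intro nn_integral_cong_AE eventually_mono[OF AE_lborel_singleton[of 0]])
    fix s :: real assume s: "s \<noteq> 0"
    show "(\<integral>\<^sup>+x. h x * (ennreal (exp (- s)) * indicator {(norm x)\<^sup>2<..} s) \<partial>lborel)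
        = ennreal (indicator {0..} s * s powr ((DIM('a) + k) / 2) / exp s) * ?m"
    proof (cases "0 < s")
      case False
      have "\<not> (norm x)\<^sup>2 < s" for x :: 'a
        using False zero_le_power2[of "norm x"] by linarith
      then show ?thesis using False s by simp
    next
      case True
      have "indicator {(norm x)\<^sup>2<..} s = (indicator (ball 0 (sqrt s)) x :: ennreal)" for x :: 'a
        using real_sqrt_less_iff[of "(norm x)\<^sup>2" s] by (simp add: indicator_def)
      then have "(\<integral>\<^sup>+x. h x * (ennreal (exp (- s)) * indicator {(norm x)\<^sup>2<..} s) \<partial>lborel)
          = (\<integral>\<^sup>+x. ennreal (exp (- s)) * (h x * indicator (ball 0 (sqrt s)) x) \<partial>lborel)"
        by (simp add: mult_ac)
      also have "\<dots> = ennreal (exp (- s)) * (ennreal (sqrt s powr (DIM('a) + k)) * ?m)"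
        using True by (subst nn_integral_cmult, simp, subst nn_integral_homogeneous_ball[OF h _ hom]) auto
      also have "sqrt s powr (DIM('a) + k) = s powr ((DIM('a) + k) / 2)"
        using True by (simp add: powr_half_sqrt[symmetric] powr_powr)
      also have "ennreal (exp (- s)) * (ennreal (s powr ((DIM('a) + k) / 2)) * ?m)
          = ennreal (exp (- s) * s powr ((DIM('a) + k) / 2)) * ?m"
        by (simp add: ennreal_mult' mult.assoc)
      also have "exp (- s) * s powr ((DIM('a) + k) / 2) = indicator {0..} s * s powr ((DIM('a) + k) / 2) / exp s"
        using True by (simp add: exp_minus field_simps)
      finally show ?thesis .
    qed
  qed
  also have "\<dots> = ennreal (Gamma ((DIM('a) + k) / 2 + 1)) * ?m"
  proof -
    have "0 < (DIM('a) + k) / 2 + 1" using k by (intro add_nonneg_pos) auto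
    from Gamma_conv_nn_integral_real[OF this] show ?thesis
      by (simp add: nn_integral_multc)
  qed
  finally show ?thesis .
qed

text \<open>Layer cake again: inside the unit ball \<open>1 - norm x powr p\<close> is the integral of \<open>p * t powr (p - 1)\<close> over
  \<open>t \<ge> norm x\<close>, so exchanging the integrals leaves integrals of \<open>h\<close> over balls of radius \<open>t\<close>, which scale like
  \<open>t powr DIM('a)\<close>. Finiteness is needed to solve the resulting equation for the first integral.\<close>

lemma nn_integral_ball_radial_power:
  fixes h :: "'a::euclidean_space \<Rightarrow> ennreal" and c k p :: real
  assumes h[measurable]: "h \<in> borel_measurable borel" and p: "1 < p"
    and hom: "\<And>c x. 0 < c \<Longrightarrow> h (c *\<^sub>R x) = h x"
    and fin: "(\<integral>\<^sup>+x. h x * indicator (ball 0 1) x \<partial>lborel) < top"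
  shows "(\<integral>\<^sup>+x. ennreal (norm x powr p) * h x * indicator (ball 0 1) x \<partial>lborel)
         = ennreal (DIM('a) / (DIM('a) + p)) * (\<integral>\<^sup>+x. h x * indicator (ball 0 1) x \<partial>lborel)"
proof -
  let ?m = "\<integral>\<^sup>+x. h x * indicator (ball 0 1) x \<partial>lborel"
  let ?n = "\<integral>\<^sup>+x. ennreal (norm x powr p) * h x * indicator (ball 0 1) x \<partial>lborel"
  \<comment> \<open>The derivative of \<open>\<bar>t\<bar> powr r\<close>, which unlike \<open>r * t powr (r - 1)\<close> is correct on the whole line.\<close>
  define g where "g r t = r * (norm t powr (r - 2) * t)" for r t :: real
  have g: "(\<integral>\<^sup>+t. ennreal (g r t) * indicator {a..1} t \<partial>lborel) = ennreal (1 - a powr r)"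
    if "1 < r" "0 \<le> a" "a \<le> 1" for r a
  proof -
    have "((\<lambda>t. norm t powr r) has_real_derivative g r t) (at t)" for t :: real
      using has_derivative_norm_powr[OF that(1), of t] unfolding has_field_derivative_def
      by (rule has_derivative_eq_rhs) (auto simp: g_def)
    moreover have "(g r) \<in> borel_measurable borel" unfolding g_def[abs_def] by measurable
    ultimately have "(\<integral>\<^sup>+t. ennreal (g r t) * indicator {a..1} t \<partial>lborel) = ennreal (norm (1::real) powr r - norm a powr r)"
    proof (intro nn_integral_FTC_Icc)
      show "0 \<le> g r t" if "t \<in> {a..1}" for t
        using that \<open>1 < r\<close> \<open>0 \<le> a\<close> by (simp add: g_def)
    qed (use that in auto)
    then show ?thesis using that by simp
  qed
  have [measurable]: "g r \<in> borel_measurable borel" for r unfolding g_def[abs_def] by measurable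
  let ?J = "\<integral>\<^sup>+x. (\<integral>\<^sup>+t. h x * indicator (ball 0 1) x * (ennreal (g p t) * indicator {norm x..1} t) \<partial>lborel) \<partial>lborel"
  have "?n + ?J = (\<integral>\<^sup>+x. ennreal (norm x powr p) * h x * indicator (ball 0 1) x
       + h x * indicator (ball 0 1) x * ennreal (1 - norm x powr p) \<partial>lborel)"
  proof -
    have "?J = (\<integral>\<^sup>+x. h x * indicator (ball 0 1) x * ennreal (1 - norm x powr p) \<partial>lborel)"
    proof (intro nn_integral_cong)
      show "(\<integral>\<^sup>+t. h x * indicator (ball 0 1) x * (ennreal (g p t) * indicator {norm x..1} t) \<partial>lborel)
          = h x * indicator (ball 0 1) x * ennreal (1 - norm x powr p)" for x
        by (cases "x \<in> ball 0 1") (auto simp: nn_integral_cmult g[OF p])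
    qed
    then show ?thesis by (simp add: nn_integral_add)
  qed
  also have "\<dots> = ?m"
  proof (intro nn_integral_cong)
    fix x :: 'a
    have "norm x powr p \<le> 1" if "norm x < 1" using that p powr_mono2[of p "norm x" 1] by simp
    then have "ennreal (norm x powr p) + ennreal (1 - norm x powr p) = 1" if "norm x < 1"
      using that by (simp flip: ennreal_plus)
    then show "ennreal (norm x powr p) * h x * indicator (ball 0 1) x
       + h x * indicator (ball 0 1) x * ennreal (1 - norm x powr p) = h x * indicator (ball 0 1) x"
      by (auto simp: indicator_def mult.commute simp flip: distrib_left)
  qed
  finally have sum: "?n + ?J = ?m" .
  have "?J = (\<integral>\<^sup>+t. (\<integral>\<^sup>+x. h x * indicator (ball 0 1) x * (ennreal (g p t) * indicator {norm x..1} t) \<partial>lborel) \<partial>lborel)"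
  proof (rule lborel_pair.Fubini'[symmetric])
    have "(\<lambda>q. indicator {q. norm (fst q) \<le> snd q \<and> snd q \<le> 1} q :: ennreal) \<in> borel_measurable (lborel \<Otimes>\<^sub>M lborel :: ('a \<times> real) measure)"
      by measurable
    then have [measurable]: "(\<lambda>q. indicator {norm (fst q)..1} (snd q) :: ennreal) \<in> borel_measurable (lborel \<Otimes>\<^sub>M lborel :: ('a \<times> real) measure)"
      by (simp add: indicator_def)
    show "(\<lambda>(x, t). h x * indicator (ball 0 1) x * (ennreal (g p t) * indicator {norm x..1} t)) \<in> borel_measurable (lborel \<Otimes>\<^sub>M lborel)"
      unfolding split_beta by measurable
  qed
  also have "\<dots> = (\<integral>\<^sup>+t. ennreal (p / (DIM('a) + p)) * ?m * (ennreal (g (DIM('a) + p) t) * indicator {0..1} t) \<partial>lborel)"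
  proof (intro nn_integral_cong)
    fix t :: real
    show "(\<integral>\<^sup>+x. h x * indicator (ball 0 1) x * (ennreal (g p t) * indicator {norm x..1} t) \<partial>lborel)
       = ennreal (p / (DIM('a) + p)) * ?m * (ennreal (g (DIM('a) + p) t) * indicator {0..1} t)"
    proof (cases "0 < t \<and> t \<le> 1")
      case False
      then have "t \<le> 0 \<or> 1 < t" by auto
      then have z: "ennreal (g p t) * indicator {norm x..1} t = 0" for x :: 'a
      proof (cases "t \<le> 0")
        case True
        then have "g p t \<le> 0"
          unfolding g_def using p by (intro mult_nonneg_nonpos) auto
        then show ?thesis by (simp add: ennreal_neg)
      next
        case False
        then show ?thesis using \<open>t \<le> 0 \<or> 1 < t\<close> by simp
      qed
      have "ennreal (g (DIM('a) + p) t) * indicator {0..1} t = 0"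
        using \<open>t \<le> 0 \<or> 1 < t\<close> by (auto simp: indicator_def g_def)
      then show ?thesis unfolding z by simp
    next
      case True
      then have t: "0 < t" "t \<le> 1" by auto
      have "AE x in lborel. h x * indicator (ball 0 1) x * (ennreal (g p t) * indicator {norm x..1} t)
          = ennreal (g p t) * (h x * indicator (ball 0 t) x)"
      proof -
        have "AE x::'a in lborel. norm x \<noteq> t"
        proof -
          have "negligible (sphere (0::'a) t)" by (simp add: negligible_sphere)
          then have "sphere (0::'a) t \<in> null_sets lborel"
            unfolding negligible_iff_null_sets by (simp add: null_sets_def)
          then show ?thesis by (intro AE_I'[of "sphere 0 t"]) auto
        qed
        then show ?thesis
          by (rule AE_mp) (use t in \<open>auto intro!: AE_I2 simp: indicator_def mult_ac\<close>)
      qed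
      then have "(\<integral>\<^sup>+x. h x * indicator (ball 0 1) x * (ennreal (g p t) * indicator {norm x..1} t) \<partial>lborel)
          = (\<integral>\<^sup>+x. ennreal (g p t) * (h x * indicator (ball 0 t) x) \<partial>lborel)"
        by (rule nn_integral_cong_AE)
      also have "\<dots> = ennreal (g p t) * (ennreal (t powr (DIM('a) + 0)) * ?m)"
        using t hom by (subst nn_integral_cmult, simp, subst nn_integral_homogeneous_ball[OF h, where k = 0]) auto
      also have "\<dots> = ennreal (g p t * t powr DIM('a)) * ?m"
        by (simp add: ennreal_mult'' mult.assoc)
      also have "g p t * t powr DIM('a) = p / (DIM('a) + p) * g (DIM('a) + p) t"
      proof -
        have "t powr (p - 2) * t powr DIM('a) = t powr (DIM('a) + p - 2)"
        proof -
          have "DIM('a) + p - 2 = (p - 2) + DIM('a)" by simp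
          then show ?thesis by (simp only: powr_add)
        qed
        then show ?thesis using t p by (simp add: g_def)
      qed
      also have "ennreal (p / (DIM('a) + p) * g (DIM('a) + p) t)
          = ennreal (p / (DIM('a) + p)) * (ennreal (g (DIM('a) + p) t) * indicator {0..1} t)"
        using t p by (subst ennreal_mult') auto
      finally show ?thesis by (simp only: mult_ac)
    qed
  qed
  also have "\<dots> = ennreal (p / (DIM('a) + p)) * ?m"
    using p g[of "DIM('a) + p" 0] by (simp add: nn_integral_cmult)
  finally have J: "?J = ennreal (p / (DIM('a) + p)) * ?m" .
  obtain m where m: "0 \<le> m" "?m = ennreal m" using fin by (cases ?m) auto
  have "?n \<noteq> top" using sum fin by auto
  then obtain n where n: "0 \<le> n" "?n = ennreal n" by (cases ?n) auto
  have "n + p / (DIM('a) + p) * m = m"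
    using sum m n p unfolding J by (simp flip: ennreal_plus ennreal_mult')
  then have "n = DIM('a) / (DIM('a) + p) * m"
    using p by (simp add: field_simps)
  then have "?n = ennreal (DIM('a) / (DIM('a) + p) * m)" using n by simp
  also have "\<dots> = ennreal (DIM('a) / (DIM('a) + p)) * ennreal m"
    using p by (intro ennreal_mult') auto
  finally show ?thesis using m by simp
qed

lemma nn_integral_abs_powr_Gaussian:
  assumes p: "1 < p"
  shows "(\<integral>\<^sup>+t. ennreal (\<bar>t\<bar> powr p * exp (- t\<^sup>2)) \<partial>lborel) = ennreal (Gamma ((p + 1) / 2))"
    and "(\<integral>\<^sup>+t. ennreal (exp (- t\<^sup>2)) \<partial>lborel) = ennreal (sqrt pi)"
proof -
  have G: "Gamma (x + 1) = x * Gamma x" if "0 < x" for x :: real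
    using that by (intro Gamma_plus1) auto
  have len: "(\<integral>\<^sup>+t. indicator (ball 0 1) (t::real) \<partial>lborel) = ennreal 2"
  proof -
    have "ball 0 1 = {- 1<..<1::real}" by (auto simp: dist_real_def)
    then show ?thesis by simp
  qed
  have "(\<integral>\<^sup>+t. ennreal (exp (- t\<^sup>2)) \<partial>lborel) = ennreal (Gamma ((1 + 0) / 2 + 1)) * ennreal 2"
    using nn_integral_homogeneous_Gaussian[of "\<lambda>_::real. 1" 0] len by simp
  also have "\<dots> = ennreal (sqrt pi)"
    using G[of "1/2"] ennreal_mult''[of 2 "Gamma (3/2)"] by (simp add: Gamma_one_half_real)
  finally show "(\<integral>\<^sup>+t. ennreal (exp (- t\<^sup>2)) \<partial>lborel) = ennreal (sqrt pi)" .
  have "(\<integral>\<^sup>+t. ennreal (\<bar>t\<bar> powr p * exp (- t\<^sup>2)) \<partial>lborel)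
      = (\<integral>\<^sup>+t. ennreal (\<bar>t\<bar> powr p) * ennreal (exp (- (norm t)\<^sup>2)) \<partial>lborel)"
    by (simp add: ennreal_mult')
  also have "\<dots> = ennreal (Gamma ((1 + p) / 2 + 1)) * (\<integral>\<^sup>+t. ennreal (\<bar>t\<bar> powr p) * indicator (ball 0 1) t \<partial>lborel)"
    using p by (subst nn_integral_homogeneous_Gaussian[where k = p]) (auto simp: abs_mult powr_mult ennreal_mult')
  also have "(\<integral>\<^sup>+t. ennreal (\<bar>t\<bar> powr p) * indicator (ball 0 1) t \<partial>lborel) = ennreal (1 / (1 + p)) * ennreal 2"
    using nn_integral_ball_radial_power[of "\<lambda>_::real. 1" p] p len by simp
  also have "ennreal (Gamma ((1 + p) / 2 + 1)) * (ennreal (1 / (1 + p)) * ennreal 2)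
      = ennreal (Gamma ((1 + p) / 2 + 1) * (1 / (1 + p) * 2))"
    using p ennreal_mult''[of "1 / (1 + p) * 2" "Gamma ((1 + p) / 2 + 1)"] ennreal_mult''[of 2 "1 / (1 + p)"] by simp
  also have "Gamma ((1 + p) / 2 + 1) * (1 / (1 + p) * 2) = Gamma ((p + 1) / 2)"
    using G[of "(1 + p) / 2"] p by (simp add: add.commute)
  finally show "(\<integral>\<^sup>+t. ennreal (\<bar>t\<bar> powr p * exp (- t\<^sup>2)) \<partial>lborel) = ennreal (Gamma ((p + 1) / 2))" .
qed

lemma nn_integral_Gaussian_moment:
  fixes b :: "'a::euclidean_space"
  assumes p: "1 < p" and b: "b \<in> Basis"
  shows "(\<integral>\<^sup>+x. ennreal (\<bar>x \<bullet> b\<bar> powr p) * ennreal (exp (- (norm x)\<^sup>2)) \<partial>lborel)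
         = ennreal (Gamma ((p + 1) / 2) * sqrt pi ^ (DIM('a) - 1))"
    and "(\<integral>\<^sup>+x. ennreal (exp (- (norm (x::'a))\<^sup>2)) \<partial>lborel) = ennreal (sqrt pi ^ DIM('a))"
proof -
  have ex: "exp (- (norm x)\<^sup>2) = (\<Prod>c\<in>Basis. exp (- (x \<bullet> c)\<^sup>2))" for x :: 'a
    unfolding power2_norm_eq_inner euclidean_inner[of x x]
    by (simp add: exp_sum sum_negf[symmetric] power2_eq_square)
  define f where "f c t = (if c = b then \<bar>t\<bar> powr p * exp (- t\<^sup>2) else exp (- t\<^sup>2))" for c :: 'a and t :: real
  have "\<bar>x \<bullet> b\<bar> powr p * exp (- (norm x)\<^sup>2) = (\<Prod>c\<in>Basis. f c (x \<bullet> c))" for x :: 'a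
    unfolding ex using b by (simp add: prod.remove[of Basis b] f_def)
  then have "(\<integral>\<^sup>+x. ennreal (\<bar>x \<bullet> b\<bar> powr p) * ennreal (exp (- (norm x)\<^sup>2)) \<partial>lborel)
      = (\<integral>\<^sup>+x. (\<Prod>c\<in>Basis. ennreal (f c (x \<bullet> c))) \<partial>(lborel :: 'a measure))"
    by (intro nn_integral_cong) (simp add: prod_ennreal f_def flip: ennreal_mult')
  also have "\<dots> = (\<Prod>c\<in>(Basis::'a set). (\<integral>\<^sup>+t. ennreal (f c t) \<partial>lborel))"
    by (intro nn_integral_lborel_prod) (auto simp: f_def)
  also have "\<dots> = ennreal (Gamma ((p + 1) / 2)) * (\<Prod>c\<in>(Basis::'a set) - {b}. ennreal (sqrt pi))"
    using b p by (simp add: prod.remove[of Basis b] f_def nn_integral_abs_powr_Gaussian)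
  also have "\<dots> = ennreal (Gamma ((p + 1) / 2) * sqrt pi ^ (DIM('a) - 1))"
    using b by (simp add: card_Diff_singleton ennreal_mult'' ennreal_power)
  finally show "(\<integral>\<^sup>+x. ennreal (\<bar>x \<bullet> b\<bar> powr p) * ennreal (exp (- (norm x)\<^sup>2)) \<partial>lborel)
         = ennreal (Gamma ((p + 1) / 2) * sqrt pi ^ (DIM('a) - 1))" .
  have "(\<integral>\<^sup>+x. ennreal (exp (- (norm (x::'a))\<^sup>2)) \<partial>lborel)
      = (\<integral>\<^sup>+x. (\<Prod>c\<in>Basis. ennreal (exp (- (x \<bullet> c)\<^sup>2))) \<partial>(lborel :: 'a measure))"
    unfolding ex by (simp add: prod_ennreal)
  also have "\<dots> = (\<Prod>c\<in>(Basis::'a set). (\<integral>\<^sup>+t. ennreal (exp (- t\<^sup>2)) \<partial>lborel))"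
    by (intro nn_integral_lborel_prod) auto
  finally show "(\<integral>\<^sup>+x. ennreal (exp (- (norm (x::'a))\<^sup>2)) \<partial>lborel) = ennreal (sqrt pi ^ DIM('a))"
    using p by (simp add: nn_integral_abs_powr_Gaussian ennreal_power)
qed

lemma borel_measurable_sphere_measure:
  assumes "f \<in> borel_measurable borel"
  shows "f \<in> borel_measurable sphere_measure"
proof -
  have "sets sphere_measure = sets (restrict_space borel (sphere 0 1))"
    by (simp add: sphere_measure_def)
  then have "borel_measurable sphere_measure = borel_measurable (restrict_space borel (sphere 0 1))"
    by (rule measurable_cong_sets) simp
  then show ?thesis
    using measurable_restrict_space1[OF assms] by blast
qed

text \<open>The origin is excluded in the definition of the surface measure and is a null set.\<close>

lemma nn_integral_sphere_measure:
  fixes f :: "real ^ 'n \<Rightarrow> ennreal"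
  assumes [measurable]: "f \<in> borel_measurable borel"
  shows "(\<integral>\<^sup>+e. f e \<partial>sphere_measure) = of_nat CARD('n) * (\<integral>\<^sup>+x. f (sgn x) * indicator (ball 0 1) x \<partial>lborel)"
proof -
  let ?B = "ball 0 1 - {0::real ^ 'n}"
  have scale: "scale_measure r M = density M (\<lambda>_. r)" for r and M :: "(real ^ 'n) measure"
    by (rule measure_eqI) (simp_all add: emeasure_density_const)
  have sgn: "sgn \<in> borel_measurable (borel :: (real ^ 'n) measure)"
    unfolding sgn_div_norm[abs_def] by measurable
  have m: "sgn \<in> restrict_space lborel ?B \<rightarrow>\<^sub>M restrict_space borel (sphere (0::real ^ 'n) 1)"
  proof (rule measurable_restrict_space2)
    show "sgn \<in> space (restrict_space lborel ?B) \<rightarrow> sphere 0 1"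
      by (auto simp: space_restrict_space norm_sgn)
    show "sgn \<in> borel_measurable (restrict_space lborel ?B)"
      using sgn by (intro measurable_restrict_space1) simp
  qed
  have f: "f \<in> borel_measurable (restrict_space borel (sphere 0 1))"
    by (intro measurable_restrict_space1) simp
  have "(\<integral>\<^sup>+e. f e \<partial>sphere_measure) = of_nat CARD('n) * (\<integral>\<^sup>+x. f (sgn x) \<partial>restrict_space lborel ?B)"
    unfolding sphere_measure_def scale using f m by (simp add: nn_integral_density nn_integral_cmult nn_integral_distr)
  also have "(\<integral>\<^sup>+x. f (sgn x) \<partial>restrict_space lborel ?B) = (\<integral>\<^sup>+x. f (sgn x) * indicator ?B x \<partial>lborel)"
    by (rule nn_integral_restrict_space) simp
  also have "\<dots> = (\<integral>\<^sup>+x. f (sgn x) * indicator (ball 0 1) x \<partial>lborel)"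
    by (intro nn_integral_cong_AE eventually_mono[OF AE_lborel_singleton[of 0]]) (auto simp: indicator_def)
  finally show ?thesis .
qed

text \<open>The Gaussian integral of \<open>\<bar>x \<bullet> a\<bar> powr p\<close> is computed twice for a unit vector \<open>a\<close>: as a product of one-dimensional
  integrals after rotating \<open>a\<close> to a coordinate axis, and by homogeneity as a multiple of an integral over the unit
  ball, which is the integral over the sphere up to a constant. The same computation without the factor
  \<open>\<bar>x \<bullet> a\<bar> powr p\<close> gives the area of the sphere.\<close>

lemma sphere_moment:
  fixes a :: "real ^ 'n"
  assumes p: "1 < p" and N: "2 \<le> CARD('n)"
  shows "ennreal (sqrt pi * Gamma ((real CARD('n) + p) / 2) / (Gamma ((p + 1) / 2) * Gamma (real CARD('n) / 2)))
           * inverse (emeasure sphere_measure (sphere (0 :: real ^ 'n) 1))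
           * (\<integral>\<^sup>+e. ennreal (\<bar>e \<bullet> a\<bar> powr p) \<partial>sphere_measure) = ennreal (norm a powr p)"
proof -
  let ?N = "real CARD('n)"
  define S where "S = 2 * sqrt pi ^ CARD('n) / Gamma (?N / 2)"
  define I where "I = 2 * Gamma ((p + 1) / 2) * sqrt pi ^ (CARD('n) - 1) / Gamma ((?N + p) / 2)"
  have N0: "0 < ?N" by simp
  have Gpos: "0 < Gamma x" if "0 < x" for x :: real using that by (rule Gamma_real_pos)
  have gp: "0 < Gamma (?N / 2)" "0 < Gamma ((?N + p) / 2)" "0 < Gamma ((p + 1) / 2)"
    using p N0 by (auto intro!: Gpos)
  have G: "Gamma (x + 1) = x * Gamma x" if "0 < x" for x :: real
    using that by (intro Gamma_plus1) auto
  have vol: "(\<integral>\<^sup>+x. indicator (ball 0 1) x \<partial>(lborel :: (real ^ 'n) measure)) = ennreal (S / ?N)"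
  proof -
    obtain v where v: "0 \<le> v" "emeasure lborel (ball (0::real ^ 'n) 1) = ennreal v"
      using emeasure_bounded_finite[of "ball (0::real ^ 'n) 1"] by (cases "emeasure lborel (ball (0::real ^ 'n) 1)") auto
    have "ennreal (sqrt pi ^ CARD('n)) = ennreal (Gamma (?N / 2 + 1)) * ennreal v"
      using nn_integral_homogeneous_Gaussian[of "\<lambda>_::real ^ 'n. 1" 0] v p
        nn_integral_Gaussian_moment(2)[OF p, of "axis undefined 1 :: real ^ 'n"] by simp
    then have "sqrt pi ^ CARD('n) = Gamma (?N / 2 + 1) * v"
      using v Gpos[of "?N / 2 + 1"] by (simp flip: ennreal_mult')
    also have "Gamma (?N / 2 + 1) = ?N / 2 * Gamma (?N / 2)" by (rule G) simp
    finally have "v = S / ?N"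
      using gp(1)[THEN less_imp_neq] N0 by (simp add: S_def divide_simps mult_ac)
    then show ?thesis using v by simp
  qed
  have sphere: "emeasure sphere_measure (sphere (0 :: real ^ 'n) 1) = ennreal S"
  proof -
    have "emeasure sphere_measure (sphere (0 :: real ^ 'n) 1) = (\<integral>\<^sup>+e. 1 \<partial>(sphere_measure :: (real ^ 'n) measure))"
      by (simp add: sphere_measure_def space_restrict_space space_scale_measure)
    also have "\<dots> = of_nat CARD('n) * ennreal (S / ?N)"
      using vol by (subst nn_integral_sphere_measure) simp_all
    also have "\<dots> = ennreal S"
      by (simp add: ennreal_of_nat_eq_real_of_nat flip: ennreal_mult')
    finally show ?thesis .
  qed
  have unit: "(\<integral>\<^sup>+e. ennreal (\<bar>e \<bullet> a\<bar> powr p) \<partial>sphere_measure) = ennreal I" if a: "norm a = 1" for a :: "real ^ 'n"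
  proof -
    define h where "h x = ennreal (\<bar>sgn x \<bullet> a\<bar> powr p)" for x :: "real ^ 'n"
    let ?m = "\<integral>\<^sup>+x. h x * indicator (ball 0 1) x \<partial>lborel"
    let ?n = "\<integral>\<^sup>+x. ennreal (\<bar>x \<bullet> a\<bar> powr p) * indicator (ball 0 1) x \<partial>lborel"
    have [measurable]: "h \<in> borel_measurable borel"
      unfolding h_def[abs_def] sgn_div_norm by measurable
    have h1: "h x \<le> 1" for x
    proof -
      have "\<bar>sgn x \<bullet> a\<bar> \<le> norm (sgn x) * norm a" by (rule Cauchy_Schwarz_ineq2)
      also have "\<dots> \<le> 1" using a by (simp add: norm_sgn)
      finally have "\<bar>sgn x \<bullet> a\<bar> powr p \<le> 1" using p powr_mono2[of p "\<bar>sgn x \<bullet> a\<bar>" 1] by simp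
      then show ?thesis by (simp add: h_def)
    qed
    have "?m \<le> (\<integral>\<^sup>+x. indicator (ball 0 1) x \<partial>(lborel :: (real ^ 'n) measure))"
      using h1 by (intro nn_integral_mono) (auto simp: indicator_def)
    then have fin: "?m < top" using vol by (simp add: le_less_trans)
    have "ennreal (norm x powr p) * h x = ennreal (\<bar>x \<bullet> a\<bar> powr p)" for x
    proof -
      have "x \<bullet> a = norm x * (sgn x \<bullet> a)" by (cases "x = 0") (auto simp: sgn_div_norm)
      then show ?thesis by (simp add: h_def abs_mult powr_mult ennreal_mult')
    qed
    then have n: "?n = ennreal (?N / (?N + p)) * ?m"
      using nn_integral_ball_radial_power[of h p] p fin by (simp add: h_def sgn_scaleR)
    obtain k :: 'n where True by simp
    have "norm (axis k (1::real)) = 1" by (simp add: norm_axis_1)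
    then obtain A where A: "orthogonal_transformation A" "det (matrix A) = 1" "A (axis k 1) = a"
      using a by (rule rotation_exists_1[OF N])
    have linA: "linear A" using A by (simp add: orthogonal_transformation_def)
    have [measurable]: "A \<in> borel \<rightarrow>\<^sub>M borel" by (rule borel_measurable_linear[OF linA])
    have Aa: "A x \<bullet> a = x \<bullet> axis k 1" for x using A unfolding orthogonal_transformation_def by metis
    have nA: "norm (A x) = norm x" for x using A(1) by (simp add: orthogonal_transformation_norm)
    let ?g = "\<lambda>x. ennreal (\<bar>x \<bullet> a\<bar> powr p) * ennreal (exp (- (norm x)\<^sup>2))"
    have "(\<integral>\<^sup>+x. ?g x \<partial>lborel) = (\<integral>\<^sup>+x. ?g (A x) \<partial>lborel)"
      using volume_factor_orthogonal[OF A(1)]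
      by (subst lborel_linear[OF linA]) (simp_all add: nn_integral_density nn_integral_distr)
    also have "\<dots> = ennreal (Gamma ((p + 1) / 2) * sqrt pi ^ (CARD('n) - 1))"
      using nn_integral_Gaussian_moment(1)[OF p, of "axis k 1 :: real ^ 'n"] by (simp add: Aa nA)
    finally have gauss: "(\<integral>\<^sup>+x. ?g x \<partial>lborel) = ennreal (Gamma ((p + 1) / 2) * sqrt pi ^ (CARD('n) - 1))" .
    have "(\<integral>\<^sup>+x. ?g x \<partial>lborel) = ennreal (Gamma ((?N + p) / 2 + 1)) * ?n"
      using p by (subst nn_integral_homogeneous_Gaussian[where k = p]) (auto simp: abs_mult powr_mult ennreal_mult')
    then have eq: "ennreal (Gamma ((p + 1) / 2) * sqrt pi ^ (CARD('n) - 1))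
        = ennreal (Gamma ((?N + p) / 2 + 1)) * (ennreal (?N / (?N + p)) * ?m)"
      using gauss n by simp
    obtain m where m: "0 \<le> m" "?m = ennreal m" using fin by (cases ?m) auto
    have "Gamma ((p + 1) / 2) * sqrt pi ^ (CARD('n) - 1) = Gamma ((?N + p) / 2 + 1) * (?N / (?N + p) * m)"
    proof (rule ennreal_inj[THEN iffD1])
      have "0 < Gamma ((?N + p) / 2 + 1)" using p by (intro Gpos add_nonneg_pos) auto
      then show "0 \<le> Gamma ((?N + p) / 2 + 1) * (?N / (?N + p) * m)"
        using p m by simp
      show "0 \<le> Gamma ((p + 1) / 2) * sqrt pi ^ (CARD('n) - 1)" using gp by simp
      show "ennreal (Gamma ((p + 1) / 2) * sqrt pi ^ (CARD('n) - 1))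
          = ennreal (Gamma ((?N + p) / 2 + 1) * (?N / (?N + p) * m))"
      proof -
        have "ennreal (Gamma ((?N + p) / 2 + 1) * (?N / (?N + p) * m))
            = ennreal (Gamma ((?N + p) / 2 + 1)) * (ennreal (?N / (?N + p)) * ennreal m)"
          using m p by (subst ennreal_mult'', simp, subst ennreal_mult'') auto
        then show ?thesis using eq unfolding m(2) by simp
      qed
    qed
    also have "Gamma ((?N + p) / 2 + 1) = (?N + p) / 2 * Gamma ((?N + p) / 2)"
      using p by (intro G) (simp add: add_pos_pos)
    also have "(?N + p) / 2 * Gamma ((?N + p) / 2) * (?N / (?N + p) * m) = Gamma ((?N + p) / 2) / 2 * (?N * m)"
    proof -
      have "y / 2 * x * (?N / y * m) = x / 2 * (?N * m)" if "y \<noteq> 0" for x y :: real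
        using that by simp
      moreover have "?N + p \<noteq> 0" using p N0 by linarith
      ultimately show ?thesis by blast
    qed
    finally have "?N * m = I"
      using gp(2) by (simp add: I_def eq_divide_eq mult_ac)
    moreover have "(\<integral>\<^sup>+e. ennreal (\<bar>e \<bullet> a\<bar> powr p) \<partial>sphere_measure) = of_nat CARD('n) * ?m"
      unfolding h_def by (rule nn_integral_sphere_measure) measurable
    ultimately show ?thesis using m by (simp add: ennreal_of_nat_eq_real_of_nat flip: ennreal_mult')
  qed
  have I: "(\<integral>\<^sup>+e. ennreal (\<bar>e \<bullet> a\<bar> powr p) \<partial>sphere_measure) = ennreal (norm a powr p * I)"
  proof (cases "a = 0")
    case False
    have "(\<integral>\<^sup>+e. ennreal (\<bar>e \<bullet> a\<bar> powr p) \<partial>sphere_measure)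
        = (\<integral>\<^sup>+e. ennreal (norm a powr p) * ennreal (\<bar>e \<bullet> sgn a\<bar> powr p) \<partial>sphere_measure)"
    proof (intro nn_integral_cong)
      fix e :: "real ^ 'n"
      have "e \<bullet> a = norm a * (e \<bullet> sgn a)" using False by (simp add: sgn_div_norm)
      then show "ennreal (\<bar>e \<bullet> a\<bar> powr p) = ennreal (norm a powr p) * ennreal (\<bar>e \<bullet> sgn a\<bar> powr p)"
        by (simp add: abs_mult powr_mult ennreal_mult')
    qed
    also have "\<dots> = ennreal (norm a powr p) * (\<integral>\<^sup>+e. ennreal (\<bar>e \<bullet> sgn a\<bar> powr p) \<partial>sphere_measure)"
      by (intro nn_integral_cmult borel_measurable_sphere_measure) measurable
    finally show ?thesis using unit[of "sgn a"] False by (simp add: norm_sgn ennreal_mult')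
  qed (use p in simp)
  have "0 < S" using gp by (simp add: S_def)
  then have "ennreal (sqrt pi * Gamma ((?N + p) / 2) / (Gamma ((p + 1) / 2) * Gamma (?N / 2))) * inverse (ennreal S) * ennreal (norm a powr p * I)
     = ennreal (sqrt pi * Gamma ((?N + p) / 2) / (Gamma ((p + 1) / 2) * Gamma (?N / 2)) * inverse S * (norm a powr p * I))"
    using gp by (simp add: inverse_ennreal ennreal_mult'[symmetric] ennreal_mult''[symmetric])
  also have "sqrt pi * Gamma ((?N + p) / 2) / (Gamma ((p + 1) / 2) * Gamma (?N / 2)) * inverse S * (norm a powr p * I) = norm a powr p"
  proof -
    have pow: "sqrt pi ^ CARD('n) = sqrt pi * sqrt pi ^ (CARD('n) - 1)"
      by (simp flip: power_Suc)
    have cancel: "sqrt pi * y / (z * x) * inverse (2 * (sqrt pi * w) / x) * (norm a powr p * (2 * z * w / y)) = norm a powr p"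
      if "0 < x" "0 < y" "0 < z" "0 < w" for x y z w :: real
      using that by (simp add: field_simps)
    have "0 < sqrt pi ^ (CARD('n) - 1)" by simp
    then show ?thesis unfolding S_def I_def pow by (intro cancel gp)
  qed
  finally show ?thesis unfolding sphere I .
qed

section \<open>Distances along lines and averages over directions\<close>

definition dir_weight :: "(real ^ 'n) set \<Rightarrow> real \<Rightarrow> real ^ 'n \<Rightarrow> real ^ 'n \<Rightarrow> real" where
  "dir_weight \<Omega> p e x = enn2real (ennreal_powr (dir_dist \<Omega> e x) (- p))"

text \<open>The only pointwise property of the weight that the one-dimensional inequality needs. The second equation rules out the
  value \<open>0\<close> that \<open>enn2real\<close> assigns to \<open>\<infinity>\<close>.\<close>

lemma dir_weight_le:
  assumes "0 < p" "0 < r" "\<And>t. \<bar>t\<bar> < r \<Longrightarrow> x + t *\<^sub>R e \<in> \<Omega>"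
  shows "dir_weight \<Omega> p e x \<le> r powr (- p)"
    and "ennreal (dir_weight \<Omega> p e x) = ennreal_powr (dir_dist \<Omega> e x) (- p)"
proof -
  have r: "ennreal r \<le> dir_dist \<Omega> e x"
    unfolding dir_dist_def using assms(3) by (intro INF_greatest ennreal_leI) (force simp: not_less[symmetric])
  show "dir_weight \<Omega> p e x \<le> r powr (- p)"
    "ennreal (dir_weight \<Omega> p e x) = ennreal_powr (dir_dist \<Omega> e x) (- p)"
  proof (atomize (full), cases "dir_dist \<Omega> e x")
    case (real d)
    then have "r \<le> d" using r assms(2) by simp
    then show "dir_weight \<Omega> p e x \<le> r powr (- p) \<and> ennreal (dir_weight \<Omega> p e x) = ennreal_powr (dir_dist \<Omega> e x) (- p)"
      using real assms by (auto simp: dir_weight_def ennreal_powr_def intro!: powr_mono2')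
  next
    case top
    then show "dir_weight \<Omega> p e x \<le> r powr (- p) \<and> ennreal (dir_weight \<Omega> p e x) = ennreal_powr (dir_dist \<Omega> e x) (- p)"
      using assms by (auto simp: dir_weight_def ennreal_powr_def)
  qed
qed

text \<open>If the compact segment \<open>\<bar>t\<bar> \<le> r\<close> of the line lies in the open set, so does a slightly longer one; hence the infimum
  that defines the distance is attained.\<close>

lemma dir_dist_le_iff:
  assumes "open \<Omega>" "0 \<le> r"
  shows "dir_dist \<Omega> e x \<le> ennreal r \<longleftrightarrow> (\<exists>t\<in>{- r..r}. x + t *\<^sub>R e \<in> - \<Omega>)"
proof
  assume "\<exists>t\<in>{- r..r}. x + t *\<^sub>R e \<in> - \<Omega>"
  then obtain t where "t \<in> {- r..r}" "x + t *\<^sub>R e \<in> - \<Omega>" by blast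
  then have t: "\<bar>t\<bar> \<le> r" "x + t *\<^sub>R e \<in> - \<Omega>" by auto
  have "dir_dist \<Omega> e x \<le> ennreal \<bar>t\<bar>" unfolding dir_dist_def using t by (intro INF_lower) simp
  also have "\<dots> \<le> ennreal r" using t by (intro ennreal_leI)
  finally show "dir_dist \<Omega> e x \<le> ennreal r" .
next
  assume le: "dir_dist \<Omega> e x \<le> ennreal r"
  show "\<exists>t\<in>{- r..r}. x + t *\<^sub>R e \<in> - \<Omega>"
  proof (rule ccontr)
    assume none: "\<not> (\<exists>t\<in>{- r..r}. x + t *\<^sub>R e \<in> - \<Omega>)"
    have "open ((\<lambda>t. x + t *\<^sub>R e) -` \<Omega>)"
      using assms(1) by (intro open_vimage continuous_intros)
    moreover have "{- r..r} \<subseteq> (\<lambda>t. x + t *\<^sub>R e) -` \<Omega>" using none by auto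
    ultimately obtain \<epsilon> where \<epsilon>: "0 < \<epsilon>" "(\<Union>t\<in>{- r..r}. ball t \<epsilon>) \<subseteq> (\<lambda>t. x + t *\<^sub>R e) -` \<Omega>"
      using compact_subset_open_imp_ball_epsilon_subset[of "{- r..r}"] by (metis compact_Icc)
    have "ennreal (r + \<epsilon>) \<le> dir_dist \<Omega> e x"
      unfolding dir_dist_def
    proof (intro INF_greatest ennreal_leI)
      fix t assume t: "t \<in> {t. x + t *\<^sub>R e \<in> - \<Omega>}"
      show "r + \<epsilon> \<le> \<bar>t\<bar>"
      proof (rule ccontr)
        assume "\<not> r + \<epsilon> \<le> \<bar>t\<bar>"
        moreover have "max (- r) (min r t) \<in> {- r..r}" using assms(2) by auto
        moreover have "\<bar>max (- r) (min r t) - t\<bar> < \<epsilon>"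
          using \<open>\<not> r + \<epsilon> \<le> \<bar>t\<bar>\<close> assms(2) \<epsilon>(1) by (simp add: max_def min_def abs_if split: if_splits)
        ultimately have "t \<in> (\<Union>t\<in>{- r..r}. ball t \<epsilon>)" by (auto simp: dist_real_def)
        then show False using \<epsilon>(2) t by blast
      qed
    qed
    then have "ennreal (r + \<epsilon>) \<le> ennreal r" using le by (rule order_trans)
    then show False using \<epsilon>(1) assms(2) by simp
  qed
qed

text \<open>The sublevel sets are closed, being projections of closed sets along the compact interval \<open>{- r..r}\<close>.\<close>

lemma borel_measurable_dir_dist [measurable]:
  assumes "open \<Omega>"
  shows "(\<lambda>z. dir_dist \<Omega> (fst z) (snd z)) \<in> borel_measurable borel"
proof (rule borel_measurableI_le)
  fix y :: ennreal
  show "{z \<in> space borel. dir_dist \<Omega> (fst z) (snd z) \<le> y} \<in> sets borel"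
  proof (cases y)
    case (real r)
    let ?T = "{q. snd (snd q) + fst q *\<^sub>R fst (snd q) \<in> - \<Omega>}"
    have "closed ((\<lambda>q::real \<times> (real ^ 'a) \<times> (real ^ 'a). snd (snd q) + fst q *\<^sub>R fst (snd q)) -` (- \<Omega>))"
      using assms by (intro closed_vimage continuous_intros) (simp add: closed_Compl)
    then have "closed ?T" by (simp only: vimage_def)
    then have "closed {z. \<exists>t. t \<in> {- r..r} \<and> (t, z) \<in> ?T}"
      by (intro closed_compact_projection) auto
    moreover have "{z \<in> space borel. dir_dist \<Omega> (fst z) (snd z) \<le> y} = {z. \<exists>t. t \<in> {- r..r} \<and> (t, z) \<in> ?T}"
      using real dir_dist_le_iff[OF assms] by auto
    ultimately show ?thesis by simp
  qed simp
qed

lemma borel_measurable_dir_weight: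
  assumes "open \<Omega>"
  shows "(\<lambda>z. dir_weight \<Omega> p (fst z) (snd z)) \<in> borel_measurable borel"
  unfolding dir_weight_def using borel_measurable_dir_dist[OF assms] by measurable

text \<open>The surface measure is the image of Lebesgue measure on a ball, so Tonelli's theorem for Lebesgue measure applies.\<close>

lemma sphere_measure_Fubini:
  fixes g :: "real ^ 'n \<Rightarrow> 'b::euclidean_space \<Rightarrow> ennreal"
  assumes g[measurable]: "(\<lambda>(e, x). g e x) \<in> borel_measurable (borel \<Otimes>\<^sub>M borel)"
  shows "(\<integral>\<^sup>+e. (\<integral>\<^sup>+x. g e x \<partial>lborel) \<partial>sphere_measure) = (\<integral>\<^sup>+x. (\<integral>\<^sup>+e. g e x \<partial>sphere_measure) \<partial>lborel)"
proof -
  have [measurable]: "sgn \<in> borel_measurable (borel :: (real ^ 'n) measure)"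
    unfolding sgn_div_norm[abs_def] by measurable
  have [measurable]: "(\<lambda>e. \<integral>\<^sup>+x. g e x \<partial>lborel) \<in> borel_measurable borel"
    using g by (intro lborel.borel_measurable_nn_integral) simp
  have gx[measurable]: "(\<lambda>e. g e x) \<in> borel_measurable borel" for x
    using g by measurable
  have ge[measurable]: "(\<lambda>x. g e x) \<in> borel_measurable borel" for e
    using g by measurable
  have "(\<integral>\<^sup>+e. (\<integral>\<^sup>+x. g e x \<partial>lborel) \<partial>sphere_measure)
      = of_nat CARD('n) * (\<integral>\<^sup>+y. (\<integral>\<^sup>+x. g (sgn y) x * indicator (ball 0 1) y \<partial>lborel) \<partial>lborel)"
    by (simp add: nn_integral_sphere_measure nn_integral_multc)
  also have "(\<integral>\<^sup>+y. (\<integral>\<^sup>+x. g (sgn y) x * indicator (ball 0 1) y \<partial>lborel) \<partial>lborel)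
      = (\<integral>\<^sup>+x. (\<integral>\<^sup>+y. g (sgn y) x * indicator (ball 0 1) y \<partial>lborel) \<partial>lborel)"
  proof (rule lborel_pair.Fubini'[symmetric])
    have "(\<lambda>z. g (sgn (fst z)) (snd z)) \<in> borel_measurable (borel \<Otimes>\<^sub>M borel)"
      using measurable_compose[OF _ g, of "\<lambda>z. (sgn (fst z), snd z)" "borel \<Otimes>\<^sub>M borel"] by simp
    then show "(\<lambda>(y, x). g (sgn y) x * indicator (ball 0 1) y) \<in> borel_measurable (lborel \<Otimes>\<^sub>M lborel)"
      unfolding split_beta by measurable
  qed
  also have "of_nat CARD('n) * \<dots> = (\<integral>\<^sup>+x. of_nat CARD('n) * (\<integral>\<^sup>+y. g (sgn y) x * indicator (ball 0 1) y \<partial>lborel) \<partial>lborel)"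
  proof (rule nn_integral_cmult[symmetric])
    have "(\<lambda>z. g (sgn (snd z)) (fst z)) \<in> borel_measurable (borel \<Otimes>\<^sub>M borel)"
      using measurable_compose[OF _ g, of "\<lambda>z. (sgn (snd z), fst z)" "borel \<Otimes>\<^sub>M borel"] by simp
    then have "(\<lambda>(x, y). g (sgn y) x * indicator (ball 0 1) y) \<in> borel_measurable (lborel \<Otimes>\<^sub>M lborel)"
      unfolding split_beta by measurable
    then show "(\<lambda>x. \<integral>\<^sup>+y. g (sgn y) x * indicator (ball 0 1) y \<partial>lborel) \<in> borel_measurable lborel"
      by (intro lborel.borel_measurable_nn_integral)
  qed
  also have "\<dots> = (\<integral>\<^sup>+x. (\<integral>\<^sup>+e. g e x \<partial>sphere_measure) \<partial>lborel)"
    by (simp add: nn_integral_sphere_measure)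
  finally show ?thesis .
qed

text \<open>The normalization in \<open>mean_dist\<close>.\<close>

definition sphere_const :: "'n::finite itself \<Rightarrow> real \<Rightarrow> ennreal" where
  "sphere_const _ p = ennreal (sqrt pi * Gamma ((real CARD('n) + p) / 2) / (Gamma ((p + 1) / 2) * Gamma (real CARD('n) / 2)))
           * inverse (emeasure sphere_measure (sphere (0 :: real ^ 'n) 1))"

lemma sphere_const_bounds:
  assumes "1 < p" "2 \<le> CARD('n::finite)"
  shows "0 < sphere_const TYPE('n) p" "sphere_const TYPE('n) p < top"
proof -
  obtain k :: 'n where True by simp
  let ?I = "\<integral>\<^sup>+e. ennreal (\<bar>e \<bullet> axis k (1::real)\<bar> powr p) \<partial>sphere_measure"
  have 1: "sphere_const TYPE('n) p * ?I = 1"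
    using sphere_moment[OF assms, of "axis k 1"] by (simp add: sphere_const_def norm_axis_1)
  then show "0 < sphere_const TYPE('n) p" by (metis mult_zero_left not_gr_zero zero_neq_one)
  have "?I \<noteq> 0" using 1 by auto
  then show "sphere_const TYPE('n) p < top"
    using 1 by (auto simp: ennreal_top_mult less_top[symmetric])
qed

text \<open>The vectors \<open>a\<close> and \<open>b\<close> are the real and imaginary parts of a complex gradient. With the weights
  \<open>A = \<bar>a\<bar>\<^sup>2 / G\<close> and \<open>B = \<bar>b\<bar>\<^sup>2 / G\<close>, where \<open>G = \<bar>a\<bar>\<^sup>2 + \<bar>b\<bar>\<^sup>2\<close>, convexity of \<open>t powr (p / 2)\<close> reduces the claim to
  the real case for the vectors \<open>a / sqrt A\<close> and \<open>b / sqrt B\<close>; each has norm \<open>sqrt G\<close> unless its weight vanishes.\<close>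

lemma sphere_moment_complex:
  fixes a b :: "real ^ 'n"
  assumes p: "2 \<le> p" and N: "2 \<le> CARD('n)"
  shows "sphere_const TYPE('n) p * (\<integral>\<^sup>+e. ennreal (((e \<bullet> a)\<^sup>2 + (e \<bullet> b)\<^sup>2) powr (p / 2)) \<partial>sphere_measure)
         \<le> ennreal (((norm a)\<^sup>2 + (norm b)\<^sup>2) powr (p / 2))"
proof (cases "(norm a)\<^sup>2 + (norm b)\<^sup>2 = 0")
  case True
  then have "a = 0" "b = 0" by (auto simp: sum_power2_eq_zero_iff)
  then show ?thesis by simp
next
  case False
  define G where "G = (norm a)\<^sup>2 + (norm b)\<^sup>2"
  have G: "0 < G" using False by (simp add: G_def add_nonneg_pos less_le)
  have p1: "1 < p" using p by simp
  define A where "A = (norm a)\<^sup>2 / G"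
  define B where "B = (norm b)\<^sup>2 / G"
  have AB: "0 \<le> A" "0 \<le> B" "A + B = 1" using G by (auto simp: A_def B_def G_def simp flip: add_divide_distrib)
  define a' where "a' = (1 / sqrt A) *\<^sub>R a"
  define b' where "b' = (1 / sqrt B) *\<^sub>R b"
  have part: "C * norm c' powr p = C * G powr (p / 2)" "(e \<bullet> c)\<^sup>2 = C * (e \<bullet> c')\<^sup>2"
    if "C = (norm c)\<^sup>2 / G" "c' = (1 / sqrt C) *\<^sub>R c" for C and c c' e :: "real ^ 'n"
  proof -
    show "(e \<bullet> c)\<^sup>2 = C * (e \<bullet> c')\<^sup>2"
      using that G by (cases "c = 0") (auto simp: power_mult_distrib power_divide)
    show "C * norm c' powr p = C * G powr (p / 2)"
    proof (cases "c = 0")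
      case True then show ?thesis using that by simp
    next
      case False
      then have "0 < C" using that G by simp
      have "norm c' = sqrt G"
        using False G that by (simp add: real_sqrt_divide)
      then show ?thesis using G by (simp add: powr_half_sqrt[symmetric] powr_powr)
    qed
  qed
  have pw: "((e \<bullet> a)\<^sup>2 + (e \<bullet> b)\<^sup>2) powr (p / 2) \<le> A * \<bar>e \<bullet> a'\<bar> powr p + B * \<bar>e \<bullet> b'\<bar> powr p" for e
  proof -
    have sq: "(z\<^sup>2) powr (p / 2) = \<bar>z\<bar> powr p" for z :: real
      using powr_powr[of "\<bar>z\<bar>" 2 "p / 2"] by simp
    show ?thesis
      using powr_weighted_mean_le[of "p / 2" "(e \<bullet> a')\<^sup>2" "(e \<bullet> b')\<^sup>2" A B] AB p
        part(2)[OF A_def a'_def, of e] part(2)[OF B_def b'_def, of e] by (simp add: sq)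
  qed
  have "(\<integral>\<^sup>+e. ennreal (((e \<bullet> a)\<^sup>2 + (e \<bullet> b)\<^sup>2) powr (p / 2)) \<partial>sphere_measure)
      \<le> (\<integral>\<^sup>+e. ennreal A * ennreal (\<bar>e \<bullet> a'\<bar> powr p) + ennreal B * ennreal (\<bar>e \<bullet> b'\<bar> powr p) \<partial>sphere_measure)"
    using pw AB by (intro nn_integral_mono) (simp add: ennreal_mult'[symmetric] ennreal_plus[symmetric] ennreal_leI del: ennreal_plus)
  also have "\<dots> = ennreal A * (\<integral>\<^sup>+e. ennreal (\<bar>e \<bullet> a'\<bar> powr p) \<partial>sphere_measure)
      + ennreal B * (\<integral>\<^sup>+e. ennreal (\<bar>e \<bullet> b'\<bar> powr p) \<partial>sphere_measure)"
  proof -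
    have m[measurable]: "(\<lambda>e. ennreal (\<bar>e \<bullet> c\<bar> powr p)) \<in> borel_measurable sphere_measure" for c :: "real ^ 'n"
      by (rule borel_measurable_sphere_measure) measurable
    show ?thesis by (simp add: nn_integral_add nn_integral_cmult[OF m])
  qed
  finally have "sphere_const TYPE('n) p * (\<integral>\<^sup>+e. ennreal (((e \<bullet> a)\<^sup>2 + (e \<bullet> b)\<^sup>2) powr (p / 2)) \<partial>sphere_measure)
      \<le> sphere_const TYPE('n) p * \<dots>"
    by (rule mult_left_mono) simp
  also have "\<dots> = ennreal A * (sphere_const TYPE('n) p * (\<integral>\<^sup>+e. ennreal (\<bar>e \<bullet> a'\<bar> powr p) \<partial>sphere_measure))
      + ennreal B * (sphere_const TYPE('n) p * (\<integral>\<^sup>+e. ennreal (\<bar>e \<bullet> b'\<bar> powr p) \<partial>sphere_measure))"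
    by (simp add: distrib_left mult.left_commute)
  also have "\<dots> = ennreal A * ennreal (norm a' powr p) + ennreal B * ennreal (norm b' powr p)"
    unfolding sphere_const_def sphere_moment[OF p1 N] ..
  also have "\<dots> = ennreal (A * norm a' powr p + B * norm b' powr p)"
    using AB by (simp add: ennreal_mult' ennreal_plus)
  also have "A * norm a' powr p + B * norm b' powr p = G powr (p / 2)"
    unfolding part(1)[OF A_def a'_def] part(1)[OF B_def b'_def] distrib_right[symmetric] AB(3) by simp
  finally show ?thesis by (simp add: G_def)
qed

section \<open>Inequalities for bases of directions\<close>

lemma integral_lborel_linear:
  fixes f :: "real ^ 'n::finite \<Rightarrow> real"
  assumes A: "linear A" "volume_factor A \<noteq> 0" and f: "f \<in> borel_measurable borel"
  shows "(LINT x|lborel. f x) = volume_factor A * (LINT x|lborel. f (A x))"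
proof -
  have [measurable]: "A \<in> borel \<rightarrow>\<^sub>M borel" by (rule borel_measurable_linear[OF A(1)])
  have v: "0 \<le> volume_factor A" by (simp add: volume_factor_def)
  have "(LINT x|lborel. f x) = (LINT x|density (distr lborel borel A) (\<lambda>_. ennreal (volume_factor A)). f x)"
    using lborel_linear[OF A] by simp
  also have "\<dots> = (LINT x|distr lborel borel A. volume_factor A *\<^sub>R f x)"
    using f v by (intro integral_density) auto
  also have "\<dots> = (LINT x|lborel. volume_factor A *\<^sub>R f (A x))"
    using f by (intro integral_distr) auto
  finally show ?thesis by simp
qed

text \<open>\<open>E e\<close> is the directional Hardy difference, written as a Bochner integral. \<open>P e\<close> and \<open>Q e\<close> are its two parts as
  nonnegative integrals, which can be integrated over directions without integrability conditions.\<close>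

locale hardy_test_function =
  fixes \<Omega> :: "(real ^ 'n::finite) set" and u :: "real ^ 'n \<Rightarrow> complex" and p N :: real
  assumes N: "N = real CARD('n)" and open_dom: "open \<Omega>" and test: "u \<in> test_functions \<Omega>" and p2: "2 \<le> p" and pN: "p < N"
begin

definition K where "K = closure {x. u x \<noteq> 0}"
definition \<alpha> where "\<alpha> = (p - 1) / p"
definition q where "q = N * p / (N - p)"
definition D where "D e x = frechet_derivative u (at x) e"
definition w where "w = dir_weight \<Omega> p"
definition E where "E e = (LINT x|lborel. norm (D e x) powr p - \<alpha> powr p * (norm (u x) powr p * w e x))"
definition P where "P e = (\<integral>\<^sup>+x. ennreal (norm (D e x) powr p) \<partial>lborel)"
definition Q where "Q e = (\<integral>\<^sup>+x. ennreal (\<alpha> powr p * (norm (u x) powr p * w e x)) \<partial>lborel)"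
definition X where "X = (LINT x|lborel. norm (u x) powr q)"
definition C where "C = (2 * interpolation_const p (p * (N - 1) / (N - p))) powr p"

lemma numbers: "0 < p" "1 < p" "2 < N" "2 \<le> CARD('n)" "0 < q" "0 < \<alpha>" "0 < C"
proof -
  show "0 < p" "1 < p" "2 < N" using p2 pN by auto
  then show "2 \<le> CARD('n)" unfolding N by linarith
  show "0 < q" "0 < \<alpha>" using p2 pN by (auto simp: q_def \<alpha>_def)
  have "1 < p * (N - 1) / (N - p)" using p2 pN by (simp add: field_simps)
  from interpolation_const_pos[OF p2 this] show "0 < C" by (simp add: C_def)
qed

lemma K: "compact K" "K \<subseteq> \<Omega>" and u0: "x \<notin> K \<Longrightarrow> u x = 0"
  using test closure_subset[of "{x. u x \<noteq> 0}"] by (auto simp: K_def test_functions_def)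

lemma u_cont: "continuous_on UNIV u" and u_deriv: "(u has_derivative (\<lambda>e. D e x)) (at x)"
  and D_cont: "continuous_on UNIV (D e)"
proof -
  have "times_differentiable_on k u UNIV" for k
    using test by (simp add: test_functions_def smooth_on_def)
  from this[of 0] this[of 1] show "continuous_on UNIV u" "(u has_derivative (\<lambda>e. D e x)) (at x)" "continuous_on UNIV (D e)"
    by (auto simp: D_def[abs_def] frechet_derivative_works[symmetric])
qed

lemma D_linear: "linear (\<lambda>e. D e x)"
  using has_derivative_linear[OF u_deriv] .

lemma D_gradient: "D e x = (\<Sum>i\<in>UNIV. (e $ i) *\<^sub>R (gradient u x $ i))"
proof -
  have "D e x = D (\<Sum>i\<in>UNIV. (e $ i) *\<^sub>R axis i 1) x"
    using basis_expansion[of e] by (simp add: scalar_mult_eq_scaleR)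
  also have "\<dots> = (\<Sum>i\<in>UNIV. (e $ i) *\<^sub>R D (axis i 1) x)"
    by (simp add: linear_sum[OF D_linear] linear_scale[OF D_linear])
  finally show ?thesis by (simp add: D_def gradient_def)
qed

lemma D_measurable [measurable]: "(\<lambda>z. D (fst z) (snd z)) \<in> borel_measurable (borel \<Otimes>\<^sub>M borel)"
proof -
  have "(\<lambda>x. gradient u x $ i) \<in> borel_measurable borel" for i
    using D_cont[of "axis i 1"] by (simp add: gradient_def D_def[abs_def] borel_measurable_continuous_onI)
  from measurable_compose[OF measurable_snd this]
  have [measurable]: "(\<lambda>z. gradient u (snd z) $ i) \<in> borel_measurable (borel \<Otimes>\<^sub>M borel)" for i .
  have "(\<lambda>e :: real ^ 'n. e $ i) \<in> borel_measurable borel" for i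
    by (intro borel_measurable_continuous_onI continuous_intros)
  then have [measurable]: "(\<lambda>z. (fst z :: real ^ 'n) $ i) \<in> borel_measurable (borel \<Otimes>\<^sub>M (borel :: (real ^ 'n) measure))" for i :: 'n
    by (rule measurable_compose[OF measurable_fst])
  show ?thesis unfolding D_gradient by measurable
qed

lemma w_measurable [measurable]: "(\<lambda>z. w (fst z) (snd z)) \<in> borel_measurable (borel \<Otimes>\<^sub>M borel)"
  using borel_measurable_dir_weight[OF open_dom, of p] by (simp add: w_def borel_prod)

lemma w_measurable1 [measurable]: "w e \<in> borel_measurable borel"
proof -
  have "(\<lambda>x. w (fst (e, x)) (snd (e, x))) \<in> borel_measurable borel"
    by (rule measurable_compose[OF _ w_measurable]) measurable
  then show ?thesis by simp
qed

lemma u_measurable [measurable]: "u \<in> borel_measurable borel"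
  using u_cont by (simp add: borel_measurable_continuous_onI)

lemma w_nonneg: "0 \<le> w e x" by (simp add: w_def dir_weight_def)

lemma D0: assumes "x \<notin> K" shows "D e x = 0"
proof -
  have "open (- K)" using K by (simp add: compact_imp_closed open_Compl)
  then have "(u has_derivative (\<lambda>_. 0)) (at x)"
    using assms u0 by (intro has_derivative_transform_within_open[OF has_derivative_const, of "- K"]) auto
  then have "(\<lambda>e. D e x) = (\<lambda>_. 0)"
    using u_deriv has_derivative_unique by blast
  then show ?thesis by metis
qed

text \<open>The support has positive distance from the complement, so the weights are bounded on it uniformly in the direction.\<close>

lemma w_bound:
  assumes R: "0 < R"
  obtains M where "0 \<le> M" "\<And>x e. x \<in> K \<Longrightarrow> norm e \<le> R \<Longrightarrow> w e x \<le> M"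
    "\<And>x e. x \<in> K \<Longrightarrow> norm e \<le> R \<Longrightarrow> ennreal (w e x) = ennreal_powr (dir_dist \<Omega> e x) (- p)"
proof -
  obtain \<delta> where \<delta>: "0 < \<delta>" "(\<Union>x\<in>K. ball x \<delta>) \<subseteq> \<Omega>"
    using compact_subset_open_imp_ball_epsilon_subset[OF K(1) open_dom K(2)] by metis
  have in_dom: "x + t *\<^sub>R e \<in> \<Omega>" if "x \<in> K" "norm e \<le> R" "\<bar>t\<bar> < \<delta> / R" for x t and e :: "real ^ 'n"
  proof -
    have "\<bar>t\<bar> * norm e \<le> \<bar>t\<bar> * R" using that by (intro mult_left_mono) auto
    also have "\<dots> < \<delta>" using that R by (simp add: field_simps)
    finally have "x + t *\<^sub>R e \<in> ball x \<delta>" by (simp add: dist_norm)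
    then show ?thesis using \<delta> that by blast
  qed
  have "w e x \<le> (\<delta> / R) powr (- p)" "ennreal (w e x) = ennreal_powr (dir_dist \<Omega> e x) (- p)"
    if "x \<in> K" "norm e \<le> R" for x e
    unfolding w_def using dir_weight_le[of p "\<delta> / R" x e \<Omega>] in_dom[OF that] numbers \<delta> R by auto
  then show ?thesis by (intro that[of "(\<delta> / R) powr (- p)"]) auto
qed

lemma integrable_parts:
  "integrable lborel (\<lambda>x. norm (D e x) powr p)" "integrable lborel (\<lambda>x. norm (u x) powr p * w e x)"
  "integrable lborel (\<lambda>x. norm (u x) powr q)"
proof -
  obtain M where M: "\<And>x e'. x \<in> K \<Longrightarrow> norm e' \<le> norm e + 1 \<Longrightarrow> w e' x \<le> M"
    using w_bound[of "norm e + 1"] by (metis add_nonneg_pos norm_ge_zero zero_less_one)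
  have "w e x \<le> M" if "x \<in> K" for x using M[OF that, of e] by simp
  note I = integrable_Hardy_density[OF _ K(1) u0 D0 u_cont D_cont w_measurable1 w_nonneg this]
  show "integrable lborel (\<lambda>x. norm (D e x) powr p)" "integrable lborel (\<lambda>x. norm (u x) powr p * w e x)"
    by (rule I(2) I(3); use numbers in simp)+
  show "integrable lborel (\<lambda>x. norm (u x) powr q)" by (rule I(1); use numbers in simp)
qed

text \<open>Apply \<open>axis_Hardy_Sobolev\<close> to \<open>u \<circ> A\<close>. Lines in coordinate directions become lines in the directions \<open>A (axis i 1)\<close>,
  the parameter \<open>t\<close> along them being unchanged, so the weights transform into \<open>w (A b)\<close>. Both sides pick up
  powers of the volume factor.\<close>

lemma frame_inequality:
  assumes A: "linear A" and vol: "volume_factor A \<noteq> 0"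
  shows "0 \<le> E (A (axis i 1))"
    and "X powr ((N - p) / N) \<le> C * (volume_factor A powr (- p / N) * (\<Sum>i\<in>UNIV. E (A (axis i 1))))"
proof -
  let ?c = "volume_factor A"
  have c: "0 < ?c" using vol by (auto simp: volume_factor_def)
  have A_cont: "continuous_on S A" for S
    using A by (simp add: linear_continuous_on linear_conv_bounded_linear)
  have inj: "inj A"
  proof -
    have "det (matrix (unlabel \<circ> A \<circ> relabel)) \<noteq> 0" using vol by (simp add: volume_factor_def)
    then have "inj (unlabel \<circ> A \<circ> relabel)"
      using invertible_det_nz invertible_eq_bij A linear_compose[OF linear_compose[OF linear_relabel A] linear_unlabel]
      by (metis bij_betw_def comp_assoc matrix_works inj_on_def matrix_vector_mul(2))
    then show ?thesis by (metis (no_types, lifting) comp_apply injD injI relabel_unlabel)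
  qed
  obtain g where g: "linear g" "g \<circ> A = id"
    using linear_injective_left_inverse[OF A inj] by blast
  let ?v = "\<lambda>y. u (A y)" and ?v' = "\<lambda>b y. D (A b) (A y)" and ?W = "\<lambda>b y. w (A b) (A y)"
  define J where "J b = (LINT y|lborel. norm (?v' b y) powr p - \<alpha> powr p * (norm (?v y) powr p * ?W b y))" for b
  obtain B where B: "0 < B" "\<And>x. norm (A x) \<le> B * norm x"
    using linear_bounded_pos[OF A] by blast
  obtain M where M: "\<And>x e. x \<in> K \<Longrightarrow> norm e \<le> B \<Longrightarrow> w e x \<le> M" using w_bound[OF B(1)] by metis
  have JE: "J b = E (A b) / ?c" for b
  proof -
    have [measurable]: "D (A b) \<in> borel_measurable borel"
      using D_cont by (simp add: borel_measurable_continuous_onI)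
    show ?thesis
      using integral_lborel_linear[OF A vol, of "\<lambda>x. norm (D (A b) x) powr p - \<alpha> powr p * (norm (u x) powr p * w (A b) x)"] c
      by (simp add: J_def E_def)
  qed
  have XX: "(LINT y|lborel. norm (?v y) powr q) = X / ?c"
    using integral_lborel_linear[OF A vol, of "\<lambda>x. norm (u x) powr q"] c by (simp add: X_def)
  have gA: "g (A y) = y" for y using g(2) by (metis comp_apply id_apply)
  have gK: "compact (A -` K)"
  proof -
    have "closed (A -` K)" using K A_cont[of UNIV] by (intro closed_vimage) (auto simp: compact_imp_closed)
    moreover have "A -` K \<subseteq> g ` K"
    proof
      fix y assume "y \<in> A -` K"
      then have "g (A y) \<in> g ` K" by blast
      then show "y \<in> g ` K" by (simp add: gA)
    qed
    moreover have "compact (g ` K)"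
      using K g(1) by (intro compact_continuous_image linear_continuous_on) (auto simp: linear_conv_bounded_linear)
    ultimately show ?thesis by (metis compact_Int_closed inf.absorb_iff2)
  qed
  have v0: "?v y = 0" if "y \<notin> A -` K" for y using that u0 by simp
  have v': "((\<lambda>t. ?v (y + t *\<^sub>R b)) has_vector_derivative ?v' b y) (at 0)" for b y
  proof -
    have 1: "((\<lambda>t. A (y + t *\<^sub>R b)) has_derivative (\<lambda>t. t *\<^sub>R A b)) (at 0)"
    proof -
      have "A (y + t *\<^sub>R b) = A y + t *\<^sub>R A b" for t
        by (simp add: linear_add[OF A] linear_scale[OF A])
      then show ?thesis by (auto intro!: derivative_eq_intros)
    qed
    have 2: "(u has_derivative (\<lambda>e. D e (A y))) (at (A (y + 0 *\<^sub>R b)))"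
      using u_deriv[of "A y"] by simp
    show ?thesis
      using has_derivative_compose[OF 1 2] linear_scale[OF D_linear, of _ "A b"] by (simp add: has_vector_derivative_def)
  qed
  have W_le: "?W b y \<le> r powr (- p)"
    if "0 < r" "\<And>t. \<bar>t\<bar> < r \<Longrightarrow> y + t *\<^sub>R b \<in> A -` \<Omega>" for b y r
    unfolding w_def
  proof (rule dir_weight_le(1)[OF numbers(1) that(1)])
    fix t :: real assume "\<bar>t\<bar> < r"
    from that(2)[OF this] show "A y + t *\<^sub>R A b \<in> \<Omega>"
      by (simp add: linear_add[OF A] linear_scale[OF A])
  qed
  have Wm: "?W b \<in> borel_measurable borel" for b
    using measurable_compose[OF borel_measurable_linear[OF A] w_measurable1[of "A b"]] by simp
  have WM: "?W b y \<le> M" if "b \<in> Basis" "y \<in> A -` K" for b y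
    using M[of "A y" "A b"] B(2)[of b] that by simp
  have NN: "N = real DIM(real ^ 'n)" by (simp add: N)
  note ax = axis_Hardy_Sobolev[where v = ?v and v' = ?v' and W = ?W and \<Omega> = "A -` \<Omega>" and K = "A -` K" and M = M,
      OF NN p2 pN \<alpha>_def q_def refl gK _ _ v0 _ v' _ Wm w_nonneg WM W_le J_def]
  have cont: "continuous_on UNIV ?v" "continuous_on UNIV (?v' b)" for b
    by (rule continuous_on_compose2[OF u_cont A_cont] continuous_on_compose2[OF D_cont A_cont]; simp)+
  have sub: "A -` K \<subseteq> A -` \<Omega>" "open (A -` \<Omega>)"
    using K(2) open_vimage[OF open_dom A_cont] by auto
  have J0: "0 \<le> J b" if b: "b \<in> Basis" for b
    by (rule ax(1)) (use sub cont b in auto)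
  have main: "(LINT y|lborel. norm (?v y) powr q) powr ((N - p) / N) \<le> C * (\<Sum>b\<in>Basis. J b)"
    unfolding C_def by (rule ax(2)) (use sub cont in auto)
  show "0 \<le> E (A (axis i 1))"
    using J0[of "axis i 1"] c by (simp add: JE zero_le_divide_iff)
  have X0: "0 \<le> X" by (simp add: X_def)
  have "X powr ((N - p) / N) = (X / ?c) powr ((N - p) / N) * ?c powr ((N - p) / N)"
    using X0 c by (simp add: powr_divide)
  also have "\<dots> \<le> C * ((\<Sum>i\<in>UNIV. E (A (axis i 1))) / ?c) * ?c powr ((N - p) / N)"
    using main unfolding XX by (intro mult_right_mono) (simp_all add: sum.reindex_bij_betw[OF bij_betw_axis_Basis, symmetric] JE sum_divide_distrib)
  also have "\<dots> = C * (?c powr (- p / N) * (\<Sum>i\<in>UNIV. E (A (axis i 1))))"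
  proof -
    have "(N - p) / N - 1 = - p / N" using numbers by (simp add: field_simps)
    then have "?c powr ((N - p) / N) / ?c = ?c powr (- p / N)"
      using c by (metis powr_diff powr_one less_imp_le)
    moreover have "C * (S / ?c) * a = C * (a / ?c * S)" for S a by simp
    ultimately show ?thesis by (simp only:)
  qed
  finally show "X powr ((N - p) / N) \<le> C * (?c powr (- p / N) * (\<Sum>i\<in>UNIV. E (A (axis i 1))))" .
qed

text \<open>Some rotation maps a coordinate axis to \<open>e\<close>.\<close>

lemma E_nonneg:
  assumes "norm e = 1"
  shows "0 \<le> E e"
proof -
  obtain k :: 'n where True by simp
  have "norm (axis k (1::real)) = 1" by (simp add: norm_axis_1)
  then obtain A where A: "orthogonal_transformation A" "det (matrix A) = 1" "A (axis k 1) = e"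
    using assms by (rule rotation_exists_1[OF numbers(4)])
  then show ?thesis
    using frame_inequality(1)[of A k] volume_factor_orthogonal[OF A(1)] by (simp add: orthogonal_transformation_def)
qed

lemma P_eq: "0 \<le> E e \<Longrightarrow> P e = Q e + ennreal (E e)"
proof -
  assume E: "0 \<le> E e"
  have i: "integrable lborel (\<lambda>x. \<alpha> powr p * (norm (u x) powr p * w e x))"
    by (intro integrable_mult_right integrable_parts)
  have "P e = ennreal (LINT x|lborel. norm (D e x) powr p)"
    unfolding P_def by (intro nn_integral_eq_integral integrable_parts) auto
  moreover have "Q e = ennreal (LINT x|lborel. \<alpha> powr p * (norm (u x) powr p * w e x))"
    unfolding Q_def using i w_nonneg by (intro nn_integral_eq_integral) auto
  moreover have "E e = (LINT x|lborel. norm (D e x) powr p) - (LINT x|lborel. \<alpha> powr p * (norm (u x) powr p * w e x))"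
    unfolding E_def by (intro Bochner_Integration.integral_diff integrable_parts i)
  moreover have "0 \<le> (LINT x|lborel. \<alpha> powr p * (norm (u x) powr p * w e x))"
    using w_nonneg by (intro Bochner_Integration.integral_nonneg) auto
  ultimately show ?thesis using E by (simp flip: ennreal_plus)
qed

lemma P_measurable [measurable]: "P \<in> borel_measurable borel" and Q_measurable [measurable]: "Q \<in> borel_measurable borel"
proof -
  have [measurable]: "(\<lambda>z. u (snd z)) \<in> borel_measurable (borel \<Otimes>\<^sub>M borel)"
    by (rule measurable_compose[OF measurable_snd u_measurable])
  have "(\<lambda>(e, x). ennreal (norm (D e x) powr p)) \<in> borel_measurable (borel \<Otimes>\<^sub>M lborel)"
    unfolding split_beta by measurable
  then show "P \<in> borel_measurable borel"
    unfolding P_def[abs_def] by (rule lborel.borel_measurable_nn_integral)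
  have "(\<lambda>(e, x). ennreal (\<alpha> powr p * (norm (u x) powr p * w e x))) \<in> borel_measurable (borel \<Otimes>\<^sub>M lborel)"
    unfolding split_beta by measurable
  then show "Q \<in> borel_measurable borel"
    unfolding Q_def[abs_def] by (rule lborel.borel_measurable_nn_integral)
qed

text \<open>Otherwise each axis would have a nearby direction with small \<open>E\<close>, and \<open>frame_inequality\<close> fails for the linear map
  that sends the axes to these directions: its volume factor is at least \<open>1 / 2\<close>, which costs at most a factor \<open>2\<close>.\<close>

lemma cone_inequality:
  assumes \<delta>: "0 < \<delta>"
    "\<And>A :: real ^ 'n \<Rightarrow> real ^ 'n. linear A \<Longrightarrow> (\<And>i. norm (A (axis i 1) - axis i 1) < \<delta>) \<Longrightarrow> 1 / 2 \<le> volume_factor A"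
  obtains i where "\<And>e. norm (e - axis i 1) < \<delta> \<Longrightarrow> X powr ((N - p) / N) / (2 * C * N) \<le> E e"
proof -
  define Y where "Y = X powr ((N - p) / N)"
  have Y0: "0 \<le> Y" by (simp add: Y_def)
  have "\<exists>i. \<forall>e. norm (e - axis i 1) < \<delta> \<longrightarrow> Y / (2 * C * N) \<le> E e"
  proof (rule ccontr)
    assume "\<not> ?thesis"
    then have "\<forall>i. \<exists>e. norm (e - axis i 1) < \<delta> \<and> E e < Y / (2 * C * N)" by (simp add: not_le)
    then obtain e where e: "\<And>i. norm (e i - axis i 1) < \<delta>" "\<And>i. E (e i) < Y / (2 * C * N)" by metis
    define A where "A x = (\<Sum>i\<in>UNIV. (x $ i) *\<^sub>R e i)" for x :: "real ^ 'n"
    have linA: "linear A"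
      unfolding A_def[abs_def] by (intro linearI) (simp_all add: scaleR_left_distrib sum.distrib scaleR_sum_right)
    have Ae: "A (axis i 1) = e i" for i
    proof -
      have "A (axis i 1) = (\<Sum>j\<in>UNIV. if j = i then e j else 0)"
        unfolding A_def by (intro sum.cong) (auto simp: axis_def)
      then show ?thesis by simp
    qed
    have vol: "1 / 2 \<le> volume_factor A" using \<delta>(2)[OF linA] e(1) by (simp add: Ae)
    have pos: "0 \<le> E (e i)" for i using frame_inequality(1)[OF linA, of i] vol by (simp add: Ae)
    have "volume_factor A powr (- p / N) \<le> (1 / 2) powr (- p / N)"
      using vol numbers by (intro powr_mono2') (auto simp: divide_nonneg_pos)
    also have "\<dots> = 2 powr (p / N)" by (simp add: powr_minus powr_divide)
    also have "\<dots> \<le> 2 powr 1" using pN numbers by (intro powr_mono) auto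
    finally have vp: "volume_factor A powr (- p / N) \<le> 2" by simp
    have "Y \<le> C * (volume_factor A powr (- p / N) * (\<Sum>i\<in>UNIV. E (e i)))"
      using frame_inequality(2)[OF linA] vol by (simp add: Ae Y_def)
    also have "\<dots> \<le> C * (2 * (\<Sum>i\<in>UNIV. E (e i)))"
      using vp pos numbers by (intro mult_left_mono mult_right_mono sum_nonneg) auto
    also have "\<dots> < C * (2 * (\<Sum>i\<in>(UNIV::'n set). Y / (2 * C * N)))"
      using e(2) numbers by (intro mult_strict_left_mono sum_strict_mono) auto
    also have "\<dots> = Y" using numbers by (simp flip: N)
    finally show False by simp
  qed
  then show ?thesis using that unfolding Y_def by blast
qed

text \<open>\<open>P = Q + E\<close> with \<open>E\<close> nonnegative, and on a cone of volume at least \<open>\<kappa>\<close> in the unit ball the bound of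
  \<open>cone_inequality\<close> is available.\<close>

lemma sphere_inequality:
  assumes \<delta>: "0 < \<delta>"
    "\<And>A :: real ^ 'n \<Rightarrow> real ^ 'n. linear A \<Longrightarrow> (\<And>i. norm (A (axis i 1) - axis i 1) < \<delta>) \<Longrightarrow> 1 / 2 \<le> volume_factor A"
    and \<kappa>: "0 \<le> \<kappa>" "\<And>i :: 'n. ennreal \<kappa> \<le> emeasure lborel ({x. norm (sgn x - axis i (1::real)) < \<delta>} \<inter> ball 0 1)"
  shows "(\<integral>\<^sup>+e. Q e \<partial>sphere_measure) + ennreal (N * \<kappa> * (X powr ((N - p) / N) / (2 * C * N)))
         \<le> (\<integral>\<^sup>+e. P e \<partial>sphere_measure)"
proof -
  define y where "y = X powr ((N - p) / N) / (2 * C * N)"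
  have y0: "0 \<le> y" using numbers by (simp add: y_def)
  obtain i where i: "\<And>e. norm (e - axis i 1) < \<delta> \<Longrightarrow> y \<le> E e"
    using cone_inequality[OF \<delta>] unfolding y_def by metis
  let ?U = "{x. norm (sgn x - axis i (1::real)) < \<delta>}"
  have sgn[measurable]: "sgn \<in> borel_measurable (borel :: (real ^ 'n) measure)"
    unfolding sgn_div_norm[abs_def] by measurable
  have [measurable]: "?U \<in> sets borel" by measurable
  have pw: "Q (sgn x) * indicator (ball 0 1) x + ennreal y * indicator (?U \<inter> ball 0 1) x \<le> P (sgn x) * indicator (ball 0 1) x"
    if x: "x \<noteq> 0" for x
  proof -
    have e: "norm (sgn x) = 1" using x by (simp add: norm_sgn)
    have "ennreal y * indicator ?U x \<le> ennreal (E (sgn x))"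
      using i[of "sgn x"] by (auto simp: indicator_def intro: ennreal_leI)
    then have "Q (sgn x) + ennreal y * indicator ?U x \<le> P (sgn x)"
      unfolding P_eq[OF E_nonneg[OF e]] by (rule add_left_mono)
    then show ?thesis by (auto simp: indicator_def)
  qed
  have "(\<integral>\<^sup>+e. Q e \<partial>sphere_measure) + ennreal (N * \<kappa> * y)
      = of_nat CARD('n) * ((\<integral>\<^sup>+x. Q (sgn x) * indicator (ball 0 1) x \<partial>lborel) + ennreal y * ennreal \<kappa>)"
    using y0 \<kappa>(1) by (simp add: nn_integral_sphere_measure distrib_left N ennreal_of_nat_eq_real_of_nat mult_ac flip: ennreal_mult'')
  also have "\<dots> \<le> of_nat CARD('n) * ((\<integral>\<^sup>+x. Q (sgn x) * indicator (ball 0 1) x \<partial>lborel)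
        + ennreal y * emeasure lborel (?U \<inter> ball 0 1))"
    using \<kappa>(2)[of i] by (intro mult_left_mono add_left_mono) auto
  also have "(\<integral>\<^sup>+x. Q (sgn x) * indicator (ball 0 1) x \<partial>lborel) + ennreal y * emeasure lborel (?U \<inter> ball 0 1)
      = (\<integral>\<^sup>+x. Q (sgn x) * indicator (ball 0 1) x + ennreal y * indicator (?U \<inter> ball 0 1) x \<partial>lborel)"
    by (subst nn_integral_add) (auto simp: nn_integral_cmult_indicator)
  also have "\<dots> \<le> (\<integral>\<^sup>+x. P (sgn x) * indicator (ball 0 1) x \<partial>lborel)"
    using pw by (intro nn_integral_mono_AE eventually_mono[OF AE_lborel_singleton[of 0]]) auto
  also have "of_nat CARD('n) * \<dots> = (\<integral>\<^sup>+e. P e \<partial>sphere_measure)"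
    by (rule nn_integral_sphere_measure[symmetric]) measurable
  finally show ?thesis
    by (simp add: y_def mult_left_mono)
qed

end

section \<open>The averaged inequality\<close>

text \<open>The quotient by the \<open>p\<close>-th power of the mean distance is a product with the mean of the weights. The value
  \<open>M = 0\<close> belongs to an infinite mean distance.\<close>

lemma divide_ennreal_powr_powr:
  assumes p: "0 < p" and M: "M < top" and a: "0 \<le> a"
  shows "enn2real (ennreal a / ennreal_powr (ennreal_powr M (- 1 / p)) p) = a * enn2real M"
proof (cases "M = 0")
  case True
  then show ?thesis using p by (simp add: ennreal_powr_def)
next
  case False
  then obtain m where m: "0 < m" "M = ennreal m"
    using M by (cases M) (auto simp: less_le)
  have "ennreal_powr (ennreal m) (- 1 / p) = ennreal (m powr (- 1 / p))"
    using m p by (simp add: ennreal_powr_def)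
  moreover have "ennreal_powr (ennreal (m powr (- 1 / p))) p = ennreal (1 / m)"
  proof -
    have "(m powr (- 1 / p)) powr p = m powr (- 1)" using p by (simp only: powr_powr) simp
    then have "(m powr (- 1 / p)) powr p = 1 / m" using m by (simp add: powr_minus_divide)
    then show ?thesis using ennreal_powr_ennreal[OF p, of "m powr (- 1 / p)"] by simp
  qed
  ultimately have "ennreal a / ennreal_powr (ennreal_powr M (- 1 / p)) p = ennreal (a * m)"
    using m a by (simp add: divide_ennreal)
  then show ?thesis using m a by simp
qed

lemma space_sphere_measure: "space sphere_measure = sphere 0 1"
  by (simp add: sphere_measure_def space_restrict_space space_scale_measure)

context hardy_test_function
begin

definition k where "k = enn2real (sphere_const TYPE('n) p)"
definition M where "M x = sphere_const TYPE('n) p * (\<integral>\<^sup>+e. ennreal (w e x) \<partial>sphere_measure)"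

lemma k: "0 < k" "sphere_const TYPE('n) p = ennreal k"
  using sphere_const_bounds[OF numbers(2,4)] by (auto simp: k_def enn2real_positive_iff)

lemma w_measurable2 [measurable]: "(\<lambda>e. w e x) \<in> borel_measurable borel"
proof -
  have "(\<lambda>e. w (fst (e, x)) (snd (e, x))) \<in> borel_measurable borel"
    by (rule measurable_compose[OF _ w_measurable]) measurable
  then show ?thesis by simp
qed

lemma sphere_integral_measurable:
  assumes "(\<lambda>(e, x). g e x) \<in> borel_measurable (borel \<Otimes>\<^sub>M borel)"
  shows "(\<lambda>x. \<integral>\<^sup>+e. g e x \<partial>(sphere_measure :: (real ^ 'n) measure)) \<in> borel_measurable (borel :: (real ^ 'n) measure)"
proof -
  have [measurable]: "sgn \<in> borel_measurable (borel :: (real ^ 'n) measure)"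
    unfolding sgn_div_norm[abs_def] by measurable
  have gx: "(\<lambda>e. g e x) \<in> borel_measurable borel" for x
    using assms by measurable
  have "(\<lambda>z. g (sgn (snd z)) (fst z)) \<in> borel_measurable (borel \<Otimes>\<^sub>M borel)"
    using measurable_compose[OF _ assms, of "\<lambda>z. (sgn (snd z), fst z)" "borel \<Otimes>\<^sub>M borel"] by simp
  then have "(\<lambda>(x, y). g (sgn y) x * indicator (ball 0 1) y) \<in> borel_measurable (borel \<Otimes>\<^sub>M lborel)"
    unfolding split_beta by measurable
  then have "(\<lambda>x. \<integral>\<^sup>+y. g (sgn y) x * indicator (ball 0 1) y \<partial>lborel) \<in> borel_measurable borel"
    by (rule lborel.borel_measurable_nn_integral)
  then show ?thesis by (simp add: nn_integral_sphere_measure[OF gx])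
qed

lemma M_measurable [measurable]: "M \<in> borel_measurable borel"
proof -
  have "(\<lambda>(e, x). ennreal (w e x)) \<in> borel_measurable (borel \<Otimes>\<^sub>M borel)"
    unfolding split_beta by measurable
  from sphere_integral_measurable[OF this] show ?thesis
    unfolding M_def[abs_def] by measurable
qed

lemma M_bound:
  obtains B where "0 \<le> B" "\<And>x. x \<in> K \<Longrightarrow> M x \<le> ennreal B"
proof -
  obtain B where B: "0 \<le> B" "\<And>x e. x \<in> K \<Longrightarrow> norm e \<le> 1 \<Longrightarrow> w e x \<le> B"
    using w_bound[of 1] by (metis zero_less_one)
  let ?S = "emeasure sphere_measure (sphere (0 :: real ^ 'n) 1)"
  have "?S \<noteq> top"
    using sphere_const_bounds(1)[OF numbers(2,4)] by (auto simp: sphere_const_def)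
  then obtain S where S: "?S = ennreal S" "0 \<le> S" by (cases ?S) auto
  show ?thesis
  proof (rule that)
    fix x assume x: "x \<in> K"
    have "(\<integral>\<^sup>+e. ennreal (w e x) \<partial>sphere_measure) \<le> (\<integral>\<^sup>+e. ennreal B \<partial>(sphere_measure :: (real ^ 'n) measure))"
      using B(2)[OF x] by (intro nn_integral_mono ennreal_leI) (auto simp: space_sphere_measure)
    also have "\<dots> = ennreal (B * S)"
      using B(1) S by (simp add: space_sphere_measure ennreal_mult)
    finally have "M x \<le> ennreal k * ennreal (B * S)"
      unfolding M_def k(2) by (intro mult_left_mono) auto
    then show "M x \<le> ennreal (k * (B * S))" using k B S by (simp add: ennreal_mult)
  qed (use k B S in simp)
qed

lemma M_eq: "x \<in> K \<Longrightarrow> M x = sphere_const TYPE('n) p * (\<integral>\<^sup>+e. ennreal_powr (dir_dist \<Omega> e x) (- p) \<partial>sphere_measure)"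
proof -
  assume x: "x \<in> K"
  obtain B where "\<And>x e. x \<in> K \<Longrightarrow> norm e \<le> 1 \<Longrightarrow> ennreal (w e x) = ennreal_powr (dir_dist \<Omega> e x) (- p)"
    using w_bound[of 1] by (metis zero_less_one)
  then have "(\<integral>\<^sup>+e. ennreal (w e x) \<partial>sphere_measure) = (\<integral>\<^sup>+e. ennreal_powr (dir_dist \<Omega> e x) (- p) \<partial>sphere_measure)"
    using x by (intro nn_integral_cong) (auto simp: space_sphere_measure)
  then show ?thesis by (simp add: M_def)
qed

lemma weight_eq:
  "enn2real (ennreal (norm (u x) powr p) / ennreal_powr (mean_dist \<Omega> p x) p) = norm (u x) powr p * enn2real (M x)"
proof (cases "x \<in> K")
  case True
  obtain B where "M x \<le> ennreal B" using M_bound True by metis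
  then have "M x < top" using le_less_trans ennreal_less_top by blast
  then show ?thesis
    using divide_ennreal_powr_powr[OF numbers(1), of "M x" "norm (u x) powr p"] M_eq[OF True]
    by (simp add: mean_dist_def sphere_const_def)
next
  case False
  then show ?thesis using u0 by simp
qed

lemma gradient_cont: "continuous_on UNIV (gradient u)"
  unfolding gradient_def[abs_def] using D_cont by (intro continuous_on_vec_lambda) (simp add: D_def[abs_def])

lemma gradient_0: "x \<notin> K \<Longrightarrow> gradient u x = 0"
  using D0[of x] by (simp add: gradient_def D_def vec_eq_iff)

lemma integrable_energy:
  "integrable lborel (\<lambda>x. norm (gradient u x) powr p)"
  "integrable lborel (\<lambda>x. norm (u x) powr p * enn2real (M x))"
proof -
  obtain B where B: "0 \<le> B" "\<And>x. x \<in> K \<Longrightarrow> M x \<le> ennreal B" using M_bound by metis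
  have m: "(\<lambda>x. enn2real (M x)) \<in> borel_measurable borel" by measurable
  have b: "enn2real (M x) \<le> B" if "x \<in> K" for x
    using B(2)[OF that] B(1) by (cases "M x") (auto simp: top_unique)
  note I = integrable_Hardy_density[where f = u and f' = "gradient u" and W = "\<lambda>x. enn2real (M x)",
      OF numbers(1) K(1) u0 gradient_0 u_cont gradient_cont m _ b]
  show "integrable lborel (\<lambda>x. norm (gradient u x) powr p)"
    "integrable lborel (\<lambda>x. norm (u x) powr p * enn2real (M x))"
    by (rule I(2) I(3); simp)+
qed

text \<open>The squared modulus of \<open>e \<bullet> \<nabla>u\<close> is the sum of the squares of \<open>e \<bullet> Re (\<nabla>u)\<close> and \<open>e \<bullet> Im (\<nabla>u)\<close>.\<close>

lemma sphere_average_derivative: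
  "sphere_const TYPE('n) p * (\<integral>\<^sup>+e. ennreal (norm (D e x) powr p) \<partial>sphere_measure) \<le> ennreal (norm (gradient u x) powr p)"
proof -
  define a where "a = (\<chi> i. Re (gradient u x $ i))"
  define b where "b = (\<chi> i. Im (gradient u x $ i))"
  have sq: "r powr p = (r\<^sup>2) powr (p / 2)" if "0 \<le> r" for r :: real
    using powr_powr[of r 2 "p / 2"] that by simp
  have "norm (D e x) powr p = ((e \<bullet> a)\<^sup>2 + (e \<bullet> b)\<^sup>2) powr (p / 2)" for e
  proof -
    have "Re (D e x) = e \<bullet> a" "Im (D e x) = e \<bullet> b"
      unfolding D_gradient inner_vec_def a_def b_def by simp_all
    then have "(norm (D e x))\<^sup>2 = (e \<bullet> a)\<^sup>2 + (e \<bullet> b)\<^sup>2" by (simp add: cmod_power2)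
    then show ?thesis using sq[of "norm (D e x)"] by simp
  qed
  moreover have "norm (gradient u x) powr p = ((norm a)\<^sup>2 + (norm b)\<^sup>2) powr (p / 2)"
  proof -
    have "(norm (gradient u x))\<^sup>2 = (\<Sum>i\<in>UNIV. (norm (gradient u x $ i))\<^sup>2)"
      by (simp add: norm_vec_def L2_set_def sum_nonneg)
    also have "\<dots> = (norm a)\<^sup>2 + (norm b)\<^sup>2"
      unfolding norm_vec_def L2_set_def by (simp add: a_def b_def sum_nonneg cmod_power2 sum.distrib)
    finally show ?thesis using sq[of "norm (gradient u x)"] by simp
  qed
  ultimately show ?thesis using sphere_moment_complex[OF p2 numbers(4), of a b] by simp
qed

text \<open>Integrate \<open>sphere_inequality\<close> in the other order, over directions first. The gradient term is bounded by
  \<open>sphere_average_derivative\<close>, and the weights average to \<open>M\<close> by its definition.\<close>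

lemma averaged_inequality:
  assumes \<delta>: "0 < \<delta>"
    "\<And>A :: real ^ 'n \<Rightarrow> real ^ 'n. linear A \<Longrightarrow> (\<And>i. norm (A (axis i 1) - axis i 1) < \<delta>) \<Longrightarrow> 1 / 2 \<le> volume_factor A"
    and \<kappa>: "0 \<le> \<kappa>" "\<And>i :: 'n. ennreal \<kappa> \<le> emeasure lborel ({x. norm (sgn x - axis i (1::real)) < \<delta>} \<inter> ball 0 1)"
  shows "k * \<kappa> / (2 * C) * X powr ((N - p) / N)
         \<le> (LINT x|lborel. norm (gradient u x) powr p - \<alpha> powr p * (norm (u x) powr p * enn2real (M x)))"
proof -
  let ?s = "sphere_const TYPE('n) p"
  let ?c = "N * \<kappa> * (X powr ((N - p) / N) / (2 * C * N))"
  have c: "?c = \<kappa> / (2 * C) * X powr ((N - p) / N)" using numbers by simp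
  have c0: "0 \<le> ?c" unfolding c using \<kappa> numbers by simp
  have [measurable]: "(\<lambda>z. u (snd z)) \<in> borel_measurable (borel \<Otimes>\<^sub>M borel)"
    by (rule measurable_compose[OF measurable_snd u_measurable])
  have mP: "(\<lambda>(e, x). ennreal (norm (D e x) powr p)) \<in> borel_measurable (borel \<Otimes>\<^sub>M borel)"
    unfolding split_beta by measurable
  have mQ: "(\<lambda>(e, x). ennreal (\<alpha> powr p * (norm (u x) powr p * w e x))) \<in> borel_measurable (borel \<Otimes>\<^sub>M borel)"
    unfolding split_beta by measurable
  have "?s * (\<integral>\<^sup>+e. P e \<partial>sphere_measure)
      = (\<integral>\<^sup>+x. ?s * (\<integral>\<^sup>+e. ennreal (norm (D e x) powr p) \<partial>sphere_measure) \<partial>lborel)"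
    unfolding P_def sphere_measure_Fubini[OF mP] using sphere_integral_measurable[OF mP]
    by (simp add: nn_integral_cmult)
  also have "\<dots> \<le> (\<integral>\<^sup>+x. ennreal (norm (gradient u x) powr p) \<partial>lborel)"
    by (intro nn_integral_mono sphere_average_derivative)
  also have "\<dots> = ennreal (LINT x|lborel. norm (gradient u x) powr p)"
    by (intro nn_integral_eq_integral integrable_energy) auto
  finally have P: "?s * (\<integral>\<^sup>+e. P e \<partial>sphere_measure) \<le> ennreal (LINT x|lborel. norm (gradient u x) powr p)" .
  have "?s * (\<integral>\<^sup>+e. Q e \<partial>sphere_measure)
      = (\<integral>\<^sup>+x. ?s * (\<integral>\<^sup>+e. ennreal (\<alpha> powr p * (norm (u x) powr p * w e x)) \<partial>sphere_measure) \<partial>lborel)"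
    unfolding Q_def sphere_measure_Fubini[OF mQ] using sphere_integral_measurable[OF mQ]
    by (simp add: nn_integral_cmult)
  also have "\<dots> = (\<integral>\<^sup>+x. ennreal (\<alpha> powr p * (norm (u x) powr p * enn2real (M x))) \<partial>lborel)"
  proof (intro nn_integral_cong)
    fix x
    show "?s * (\<integral>\<^sup>+e. ennreal (\<alpha> powr p * (norm (u x) powr p * w e x)) \<partial>sphere_measure)
        = ennreal (\<alpha> powr p * (norm (u x) powr p * enn2real (M x)))"
    proof (cases "x \<in> K")
      case True
      obtain B where "M x \<le> ennreal B" using M_bound True by metis
      then have "M x < top" using le_less_trans ennreal_less_top by blast
      then have Mx: "M x = ennreal (enn2real (M x))" by simp
      have "(\<integral>\<^sup>+e. ennreal (\<alpha> powr p * (norm (u x) powr p * w e x)) \<partial>sphere_measure)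
          = (\<integral>\<^sup>+e. ennreal (\<alpha> powr p * norm (u x) powr p) * ennreal (w e x) \<partial>sphere_measure)"
        using w_nonneg by (intro nn_integral_cong) (simp add: mult.assoc flip: ennreal_mult)
      also have "\<dots> = ennreal (\<alpha> powr p * norm (u x) powr p) * (\<integral>\<^sup>+e. ennreal (w e x) \<partial>sphere_measure)"
        by (intro nn_integral_cmult borel_measurable_sphere_measure) measurable
      finally have "?s * (\<integral>\<^sup>+e. ennreal (\<alpha> powr p * (norm (u x) powr p * w e x)) \<partial>sphere_measure)
          = ennreal (\<alpha> powr p * norm (u x) powr p) * M x"
        by (simp add: M_def mult.left_commute)
      also have "\<dots> = ennreal (\<alpha> powr p * norm (u x) powr p * enn2real (M x))"
        by (subst Mx, rule ennreal_mult[symmetric]) auto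
      finally show ?thesis by (simp add: mult.assoc)
    qed (use u0 in simp)
  qed
  also have "\<dots> = ennreal (LINT x|lborel. \<alpha> powr p * (norm (u x) powr p * enn2real (M x)))"
    by (intro nn_integral_eq_integral integrable_mult_right integrable_energy) auto
  finally have Q: "?s * (\<integral>\<^sup>+e. Q e \<partial>sphere_measure)
      = ennreal (LINT x|lborel. \<alpha> powr p * (norm (u x) powr p * enn2real (M x)))" .
  have "ennreal (LINT x|lborel. \<alpha> powr p * (norm (u x) powr p * enn2real (M x))) + ennreal (k * ?c)
      = ?s * ((\<integral>\<^sup>+e. Q e \<partial>sphere_measure) + ennreal ?c)"
  proof -
    have "ennreal (k * ?c) = ennreal k * ennreal ?c"
      using k(1) c0 by (intro ennreal_mult) auto
    then show ?thesis unfolding distrib_left Q unfolding k(2) by (simp only:)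
  qed
  also have "\<dots> \<le> ?s * (\<integral>\<^sup>+e. P e \<partial>sphere_measure)"
    by (intro mult_left_mono sphere_inequality[OF \<delta> \<kappa>]) auto
  also note P
  finally have "ennreal ((LINT x|lborel. \<alpha> powr p * (norm (u x) powr p * enn2real (M x))) + k * ?c)
      \<le> ennreal (LINT x|lborel. norm (gradient u x) powr p)"
    using k c0 by simp
  then have "(LINT x|lborel. \<alpha> powr p * (norm (u x) powr p * enn2real (M x))) + k * ?c
      \<le> (LINT x|lborel. norm (gradient u x) powr p)"
    by (subst (asm) ennreal_le_iff) auto
  moreover have "(LINT x|lborel. norm (gradient u x) powr p - \<alpha> powr p * (norm (u x) powr p * enn2real (M x)))
      = (LINT x|lborel. norm (gradient u x) powr p) - (LINT x|lborel. \<alpha> powr p * (norm (u x) powr p * enn2real (M x)))"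
    by (intro Bochner_Integration.integral_diff integrable_mult_right integrable_energy)
  moreover have "k * ?c = k * \<kappa> / (2 * C) * X powr ((N - p) / N)"
    unfolding c by simp
  ultimately show ?thesis by linarith
qed

lemma set_integrals:
  "(LINT x:\<Omega>|lborel. norm (gradient u x) powr p
      - \<alpha> powr p * enn2real (ennreal (norm (u x) powr p) / ennreal_powr (mean_dist \<Omega> p x) p))
   = (LINT x|lborel. norm (gradient u x) powr p - \<alpha> powr p * (norm (u x) powr p * enn2real (M x)))"
  "(LINT x:\<Omega>|lborel. norm (u x) powr q) = X"
proof -
  have "indicator \<Omega> x *\<^sub>R g x = g x" if "x \<notin> K \<Longrightarrow> g x = 0" for g :: "real ^ 'n \<Rightarrow> real" and x
    using that K(2) by (cases "x \<in> K") auto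
  then have *: "(LINT x:\<Omega>|lborel. g x) = (LINT x|lborel. g x)" if "\<And>x. x \<notin> K \<Longrightarrow> g x = 0" for g :: "real ^ 'n \<Rightarrow> real"
    unfolding set_lebesgue_integral_def using that by (intro Bochner_Integration.integral_cong) auto
  show "(LINT x:\<Omega>|lborel. norm (gradient u x) powr p
      - \<alpha> powr p * enn2real (ennreal (norm (u x) powr p) / ennreal_powr (mean_dist \<Omega> p x) p))
   = (LINT x|lborel. norm (gradient u x) powr p - \<alpha> powr p * (norm (u x) powr p * enn2real (M x)))"
    unfolding weight_eq using u0 gradient_0 by (intro *) simp
  show "(LINT x:\<Omega>|lborel. norm (u x) powr q) = X"
    unfolding X_def using u0 by (intro *) simp
qed

end

text \<open>The cones are neighbourhoods of \<open>axis i 1 / 2\<close>, and there are finitely many of them.\<close>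

lemma cones_around_axes:
  assumes "0 < \<delta>"
  obtains \<kappa> where "0 < \<kappa>"
    "\<And>i :: 'n::finite. ennreal \<kappa> \<le> emeasure lborel ({x. norm (sgn x - axis i (1::real)) < \<delta>} \<inter> ball 0 1)"
proof -
  let ?U = "\<lambda>i::'n. {x. norm (sgn x - axis i (1::real)) < \<delta>} \<inter> ball 0 1"
  have sgn[measurable]: "sgn \<in> borel_measurable (borel :: (real ^ 'n) measure)"
    unfolding sgn_div_norm[abs_def] by measurable
  have meas: "?U i \<in> sets lborel" for i by measurable
  have "\<exists>c>0. ennreal c \<le> emeasure lborel (?U i)" for i
  proof -
    let ?a = "(1/2) *\<^sub>R axis i 1 :: real ^ 'n"
    have a: "norm ?a = 1/2" "sgn ?a = axis i 1" "?a \<noteq> 0"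
      by (auto simp: norm_axis_1 sgn_div_norm)
    have "isCont sgn ?a"
      unfolding sgn_div_norm[abs_def] using a by (intro continuous_intros) auto
    then obtain d where d: "0 < d" "\<And>x. dist x ?a < d \<Longrightarrow> dist (sgn x) (axis i 1) < \<delta>"
      using assms a(2) unfolding continuous_at_eps_delta by metis
    define r where "r = min d (1/2)"
    have r: "0 < r" using d by (simp add: r_def)
    have "ball ?a r \<subseteq> ?U i"
    proof
      fix x assume x: "x \<in> ball ?a r"
      then have "dist x ?a < d" "dist x ?a < 1/2" by (auto simp: r_def dist_commute)
      moreover have "norm x \<le> norm (x - ?a) + norm ?a" by (metis diff_add_cancel norm_triangle_ineq)
      ultimately show "x \<in> ?U i" using d(2)[of x] a(1) by (simp add: dist_norm)
    qed
    then have "emeasure lborel (ball ?a r) \<le> emeasure lborel (?U i)"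
      using meas by (intro emeasure_mono) auto
    moreover have "emeasure lborel (ball ?a r) = ennreal (measure lborel (ball ?a r))"
      using emeasure_bounded_finite[of "ball ?a r"] by (simp add: emeasure_eq_ennreal_measure)
    moreover have "0 < measure lborel (ball ?a r)"
      using r content_ball_pos by blast
    ultimately show ?thesis by (intro exI[of _ "measure lborel (ball ?a r)"]) auto
  qed
  then obtain c where c: "\<And>i. 0 < c i" "\<And>i. ennreal (c i) \<le> emeasure lborel (?U i)" by metis
  show ?thesis
  proof (rule that[of "Min (range c)"])
    show "0 < Min (range c)" using c(1) by (subst Min_gr_iff) auto
    show "ennreal (Min (range c)) \<le> emeasure lborel (?U i)" for i
      using c(2)[of i] by (meson Min_le ennreal_leI finite finite_imageI order_trans rangeI)
  qed
qed

theorem theorem1p3: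
  fixes p :: real
  assumes "2 \<le> p" and "p < real CARD('n::finite)"
  shows "\<exists>K > 0. \<forall>(\<Omega> :: (real ^ 'n) set) u.
           open \<Omega> \<longrightarrow> connected \<Omega> \<longrightarrow> \<Omega> \<noteq> {} \<longrightarrow> \<Omega> \<noteq> UNIV \<longrightarrow> u \<in> test_functions \<Omega> \<longrightarrow>
           (LINT x:\<Omega>|lborel.
              norm (gradient u x) powr p
              - ((p - 1) / p) powr p
                * enn2real (ennreal (norm (u x) powr p) / ennreal_powr (mean_dist \<Omega> p x) p))
           \<ge> K * (LINT x:\<Omega>|lborel. norm (u x) powr (real CARD('n) * p / (real CARD('n) - p)))
                  powr ((real CARD('n) - p) / real CARD('n))"
proof -
  obtain \<delta> where \<delta>: "0 < \<delta>"
    "\<And>A :: real ^ 'n \<Rightarrow> real ^ 'n. linear A \<Longrightarrow> (\<And>i. norm (A (axis i 1) - axis i 1) < \<delta>) \<Longrightarrow> 1 / 2 \<le> volume_factor A"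
    using volume_factor_near_id by metis
  obtain \<kappa> where \<kappa>: "0 < \<kappa>"
    "\<And>i :: 'n. ennreal \<kappa> \<le> emeasure lborel ({x. norm (sgn x - axis i (1::real)) < \<delta>} \<inter> ball 0 1)"
    using cones_around_axes[OF \<delta>(1)] by metis
  let ?N = "real CARD('n)"
  define c where "c = enn2real (sphere_const TYPE('n) p) * \<kappa> / (2 * (2 * interpolation_const p (p * (?N - 1) / (?N - p))) powr p)"
  show ?thesis
  proof (intro exI[of _ c] conjI allI impI)
    have "1 < p * (?N - 1) / (?N - p)" using assms by (simp add: field_simps)
    then have "0 < interpolation_const p (p * (?N - 1) / (?N - p))" using assms by (intro interpolation_const_pos)
    moreover have "0 < enn2real (sphere_const TYPE('n) p)"
      using sphere_const_bounds[where 'n = 'n, of p] assms by (simp add: enn2real_positive_iff)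
    ultimately show "0 < c" using \<kappa> by (simp add: c_def)
    fix \<Omega> :: "(real ^ 'n) set" and u
    assume "open \<Omega>" "u \<in> test_functions \<Omega>"
    then interpret hardy_test_function \<Omega> u p ?N
      using assms by unfold_locales auto
    have "c * X powr ((?N - p) / ?N)
        \<le> (LINT x|lborel. norm (gradient u x) powr p - \<alpha> powr p * (norm (u x) powr p * enn2real (M x)))"
      using averaged_inequality[OF \<delta> less_imp_le[OF \<kappa>(1)] \<kappa>(2)] by (simp add: c_def k_def C_def)
    then show "c * (LINT x:\<Omega>|lborel. norm (u x) powr (?N * p / (?N - p))) powr ((?N - p) / ?N)
        \<le> (LINT x:\<Omega>|lborel. norm (gradient u x) powr p
              - ((p - 1) / p) powr p * enn2real (ennreal (norm (u x) powr p) / ennreal_powr (mean_dist \<Omega> p x) p))"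
      using set_integrals by (simp add: \<alpha>_def q_def)
  qed
qed

end
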